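(* Let $r\geqslant 3$ and let $X$ be the vector field associated with the planar $C^r$ system $$\dot x=y+X_2(x,y),\qquad \dot y=Y_2(x,y),$$ where $X_2,Y_2$ are $C^r$ functions in a neighborhood of the origin with $j^1X_2(0)=j^1Y_2(0)=0$, and assume that the origin is an isolated singular point. Let $y=F(x)$ be the solution of the equation $y+X_2(x,y)=0$ through $(0,0)$, and set $f(x)=Y_2(x,F(x))$ and $\Phi(x)=\operatorname{div}X|_{(x,F(x))}$. Write $$f(x)=ax^{\alpha}+O(x^{\alpha+1}),\qquad \Phi(x)=bx^{\beta}+O(x^{\beta+1}),$$ with $\alpha<r$, and suppose $a\neq 0$ (and $b\ne 0$ unless the Taylor polynomial of $\Phi$ at $0$ vanishes identically). Then the origin is monodromic if and only if $a<0$, $\alpha=2n-1$ for some positive integer $n$, and one of the following conditions holds: (i) $\beta>n-1$ or $j^{r-1}\Phi(0)\equiv 0$; (ii) $\beta=n-1$ and $b^2+4an<0$.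
   Context: $j^lG(0)$ denotes the $l$-jet (Taylor polynomial of degree $l$) of $G$ at $0$. The function $F$ is defined near $x=0$ by the Implicit Function Theorem. An isolated singular point is monodromic if orbits near it turn around it, i.e. there are no characteristic orbits (orbits tending to the point in forward or backward time with a definite tangent direction); equivalently a first return map is well defined on a transversal section ending at the point. *)

theory Defs
  imports "HOL-Analysis.Analysis" "HOL-Library.Landau_Symbols"
begin

text \<open>Meaningful for open \<open>U\<close>: every derivative is taken with respect to full neighbourhoods.\<close>

primrec C_diff_on :: "nat \<Rightarrow> ('a::euclidean_space \<Rightarrow> real) \<Rightarrow> 'a set \<Rightarrow> bool" where
  "C_diff_on 0 g U \<longleftrightarrow> continuous_on U g"
| "C_diff_on (Suc k) g U \<longleftrightarrow> (\<forall>p\<in>U. g differentiable (at p)) \<and>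
     (\<forall>v\<in>Basis. C_diff_on k (\<lambda>p. frechet_derivative g (at p) v) U)"

text \<open>
  The Taylor polynomial of degree \<open>l\<close> at the origin, as a polynomial function of \<open>v\<close>: for
  \<open>G\<close> of class \<open>C\<^sup>l\<close>, the \<open>k\<close>-th derivative of \<open>t \<mapsto> G (t v)\<close> at \<open>0\<close> is the \<open>k\<close>-th differential
  of \<open>G\<close> at the origin evaluated at \<open>(v, \<dots>, v)\<close>.
\<close>

definition jet :: "nat \<Rightarrow> ('a::real_normed_vector \<Rightarrow> real) \<Rightarrow> 'a \<Rightarrow> real" where
  "jet l G v = (\<Sum>k\<le>l. (deriv ^^ k) (\<lambda>t::real. G (t *\<^sub>R v)) 0 / fact k)"

definition divergence :: "('a::euclidean_space \<Rightarrow> 'a) \<Rightarrow> 'a \<Rightarrow> real" where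
  "divergence X p = (\<Sum>v\<in>Basis. frechet_derivative X (at p) v \<bullet> v)"

definition isolated_singular_point :: "('a::real_normed_vector \<Rightarrow> 'a) \<Rightarrow> 'a \<Rightarrow> bool" where
  "isolated_singular_point X p \<longleftrightarrow> X p = 0 \<and> (\<forall>\<^sub>F q in at p. X q \<noteq> 0)"

definition integral_curve_on ::
  "('a::real_normed_vector \<Rightarrow> 'a) \<Rightarrow> 'a set \<Rightarrow> real set \<Rightarrow> (real \<Rightarrow> 'a) \<Rightarrow> bool" where
  "integral_curve_on X U J \<gamma> \<longleftrightarrow>
     (\<forall>t\<in>J. \<gamma> t \<in> U \<and> (\<gamma> has_vector_derivative X (\<gamma> t)) (at t within J))"

text \<open>The tangent direction is the limit of \<open>sgn (\<gamma> t - p)\<close>, the unit vector pointing from \<open>p\<close> to \<open>\<gamma> t\<close>.\<close>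

definition tends_with_tangent ::
  "(real \<Rightarrow> 'a::real_normed_vector) \<Rightarrow> 'a \<Rightarrow> real filter \<Rightarrow> bool" where
  "tends_with_tangent \<gamma> p T \<longleftrightarrow>
     (\<forall>\<^sub>F t in T. \<gamma> t \<noteq> p) \<and> (\<gamma> \<longlongrightarrow> p) T \<and> (\<exists>d. ((\<lambda>t. sgn (\<gamma> t - p)) \<longlongrightarrow> d) T)"

text \<open>
  An orbit tending to a singular point does so in infinite time, and the field is autonomous, so
  after a time shift it is enough to consider half-orbits parametrized by \<open>{0..}\<close> or \<open>{..0}\<close>.
\<close>

definition characteristic_orbit ::
  "('a::real_normed_vector \<Rightarrow> 'a) \<Rightarrow> 'a set \<Rightarrow> 'a \<Rightarrow> (real \<Rightarrow> 'a) \<Rightarrow> bool" where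
  "characteristic_orbit X U p \<gamma> \<longleftrightarrow>
     integral_curve_on X U {0..} \<gamma> \<and> tends_with_tangent \<gamma> p at_top \<or>
     integral_curve_on X U {..0} \<gamma> \<and> tends_with_tangent \<gamma> p at_bot"

text \<open>\<open>U\<close> is the domain of the planar vector field \<open>X\<close>.\<close>

definition monodromic ::
  "(real \<times> real \<Rightarrow> real \<times> real) \<Rightarrow> (real \<times> real) set \<Rightarrow> real \<times> real \<Rightarrow> bool" where
  "monodromic X U p \<longleftrightarrow>
     isolated_singular_point X p \<and> (\<nexists>\<gamma>. characteristic_orbit X U p \<gamma>)"

text \<open>
  The germ at \<open>0\<close> of the function given by the Implicit Function Theorem: a solution of
  \<open>H (x, y) = 0\<close> for \<open>y\<close> near \<open>0\<close> through the origin. Continuity at \<open>0\<close> alone already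
  determines the germ when \<open>H\<close> is \<open>C\<^sup>1\<close> with nonzero \<open>y\<close>-derivative at the origin.
\<close>

definition implicit_solution :: "(real \<times> real \<Rightarrow> real) \<Rightarrow> (real \<Rightarrow> real) \<Rightarrow> bool" where
  "implicit_solution H F \<longleftrightarrow> F 0 = 0 \<and> isCont F 0 \<and> (\<forall>\<^sub>F x in nhds 0. H (x, F x) = 0)"

end

theory Submission
  imports Defs "HOL-Real_Asymp.Real_Asymp"
begin

text \<open>
  In the coordinates \<open>x\<close> and \<open>w = y - F x\<close> the system becomes \<open>x' = w (1 + O(|x| + |w|))\<close>,
  \<open>w' = f x + \<Phi> x w + O(w\<^sup>2)\<close>; there is no further error term because
  \<open>F' (1 + \<partial>X\<^sub>2/\<partial>y) = - \<partial>X\<^sub>2/\<partial>x\<close> on the graph of \<open>F\<close>.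

  If the conditions hold with \<open>\<alpha> = 2 n - 1\<close> and \<open>\<Phi> x = B x\<^sup>n\<^sup>-\<^sup>1 + O(x\<^sup>n)\<close>, then \<open>v = w / x\<^sup>n\<close> satisfies
  \<open>v' = x\<^sup>n\<^sup>-\<^sup>1 (a + B v - n v\<^sup>2 + o(1 + v\<^sup>2))\<close> with a negative definite quadratic. Comparing \<open>ln x\<close> with
  \<open>arctan v\<close> while \<open>v\<close> is bounded, and \<open>ln |w|\<close> with \<open>ln x\<close> once \<open>v\<close> is very negative, excludes orbits
  that reach the origin within a cone around the \<open>x\<close>-axis; the vertical direction is excluded directly.

  If they fail, a reflection of the axes and of time produces either \<open>a > 0\<close> on the side \<open>x > 0\<close>, or
  \<open>a < 0\<close> and \<open>\<Phi> x \<ge> B x\<^sup>n\<^sup>-\<^sup>1 - O(x\<^sup>n)\<close> with \<open>B > 0\<close> and \<open>B\<^sup>2 + 4 a n \<ge> 0\<close>. In both cases a wedge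
  \<open>x\<^sup>\<alpha> < w < u x\<close> with \<open>u x = o(x)\<close> is crossed by the field in one direction along its two curved edges,
  and an orbit trapped in the wedge tends to the origin tangentially to the \<open>x\<close>-axis.
\<close>

section \<open>Global solutions of Lipschitz fields\<close>

text \<open>The exponent in \<open>v = w / x^n\<close> comes from a balance: along orbits
  \<open>dw/dx\<close> is about \<open>f / w + \<Phi>\<close>, and for \<open>f\<close> of order
  \<open>2 n - 1\<close> all terms share the order \<open>n - 1\<close> when \<open>w\<close> has
  order \<open>n\<close> and \<Phi> has order \<open>n - 1\<close>. Curves \<open>w = v x^n\<close>
  that are invariant at leading order solve \<open>n v^2 = a + B v\<close>, whose discriminant is
  \<open>B^2 + 4 a n\<close>. Condition (i) is the case \<open>B = 0\<close>; an order of \<Phi>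
  below \<open>n - 1\<close> acts like an arbitrarily large \<open>B\<close>. In a wedge with
  \<open>w > 0\<close> the field moves to the right, so orbits tending to the origin are sought in
  reversed time. If the field leaves the wedge through both curved edges (the case
  \<open>B > 0\<close>), every backward orbit is trapped. If it enters through them (the case
  \<open>a > 0\<close>), a backward orbit may escape, and one that stays has to be found by
  compactness. Solutions are taken for a globally Lipschitz extension of the field, so that they
  exist for all times and, by Gronwall, do not reach the origin in finite time.\<close>

lemma integral_exp_mult:
  fixes K t :: real
  assumes "K > 0" "t \<ge> 0"
  shows "((\<lambda>s. C * exp (K * s)) has_integral C * ((exp (K * t) - 1) / K)) {0..t}"
proof -
  have "((\<lambda>s. C * exp (K * s)) has_integral (C / K * exp (K * t) - C / K * exp (K * 0))) {0..t}"
    using assms by (intro fundamental_theorem_of_calculus)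
      (auto intro!: derivative_eq_intros simp flip: has_real_derivative_iff_has_vector_derivative)
  moreover have "C / K * exp (K * t) - C / K * exp (K * 0) = C * ((exp (K * t) - 1) / K)"
    by (simp add: right_diff_distrib diff_divide_distrib)
  ultimately show ?thesis by simp
qed

lemma has_vector_derivative_within_atLeast:
  fixes f :: "real \<Rightarrow> 'a::real_normed_vector"
  assumes "(f has_vector_derivative D) (at t within {0..b})" "0 \<le> t" "t < b"
  shows "(f has_vector_derivative D) (at t within {0..})"
proof -
  have "at t within {0..b} = at t within {0..}"
    by (rule at_within_nhd[where S = "{..<b}"]) (use assms in auto)
  with assms(1) show ?thesis by simp
qed

text \<open>
  Picard iteration in the weight \<open>exp (- K t)\<close>, \<open>K > L\<close>, contracts on the whole half-line, so
  that no gluing of local solutions is needed.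
\<close>

theorem lipschitz_field_forward_solution:
  fixes Z :: "'a::euclidean_space \<Rightarrow> 'a"
  assumes lip: "L-lipschitz_on UNIV Z"
  obtains z where "z 0 = p"
    "\<And>t. t \<ge> 0 \<Longrightarrow> (z has_vector_derivative Z (z t)) (at t within {0..})"
proof -
  \<comment> \<open>\<open>L / K\<close> is the contraction factor below; this choice keeps it at
    most 1/2.\<close>
  define K where "K = 2 * L + 1"
  have L0: "L \<ge> 0" using lip by (rule lipschitz_on_nonneg)
  have K: "K > 0" and LK: "L / K \<le> 1/2" using L0 by (auto simp: K_def field_simps)
  have Zc: "continuous_on S Z" for S
    using lip lipschitz_on_continuous_on lipschitz_on_subset by blast
  have Zd: "norm (Z x - Z y) \<le> L * norm (x - y)" for x y
    using lipschitz_onD[OF lip, of x y] by (simp add: dist_norm)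
  \<comment> \<open>The unknown is the weighted displacement
    \<open>v t = exp (- K * t) *\<^sub>R (z t - p)\<close>, an element of the Banach space of
    bounded continuous functions; \<open>g v\<close> is the field along the curve that
    \<open>v\<close> encodes, and \<open>f\<close> is the Picard operator in this weight.\<close>
  define g where "g v s = Z (p + exp (K * s) *\<^sub>R apply_bcontfun v s)"
    for v :: "real \<Rightarrow>\<^sub>C 'a" and s
  define J where "J v t = integral {0..t} (g v)" for v t
  \<comment> \<open>\<open>max 0 t\<close> extends the operator by zero to negative times, since the
    function space lives on the whole line.\<close>
  define f where "f v t = exp (- K * max 0 t) *\<^sub>R J v (max 0 t)" for v t
  have gc: "continuous_on S (g v)" for v S
    unfolding g_def
    by (rule continuous_on_compose2[OF Zc _ subset_UNIV])
      (intro continuous_intros continuous_on_apply_bcontfun)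
  have gi: "g v integrable_on {0..t}" for v t
    by (intro integrable_continuous_interval gc)
  have Jd: "(J v has_vector_derivative g v t) (at t within {0..})" if "t \<ge> 0" for v t
  proof (rule has_vector_derivative_within_atLeast[where b = "t + 1"])
    show "(J v has_vector_derivative g v t) (at t within {0..t + 1})"
      unfolding J_def by (rule integral_has_vector_derivative[OF gc]) (use that in auto)
  qed (use that in auto)
  have Jc: "continuous_on {0..} (J v)" for v
    unfolding continuous_on_eq_continuous_within
    using has_vector_derivative_continuous[OF Jd] by auto
  have fc: "continuous_on UNIV (f v)" for v
  proof -
    have "continuous_on UNIV (\<lambda>t. J v (max 0 t))"
      by (rule continuous_on_compose2[OF Jc]) (auto intro!: continuous_intros)
    then show ?thesis
      unfolding f_def by (intro continuous_intros)
  qed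
  have gb: "norm (g v s) \<le> (norm (Z p) + L * norm v) * exp (K * s)" if "s \<ge> 0" for v s
  proof -
    have "norm (g v s - Z p) \<le> L * norm (exp (K * s) *\<^sub>R apply_bcontfun v s)"
      using Zd[of "p + exp (K * s) *\<^sub>R apply_bcontfun v s" p] by (simp add: g_def)
    also have "\<dots> \<le> L * (norm v * exp (K * s))"
      using L0 norm_bounded[of v s] by (intro mult_left_mono) auto
    finally have 1: "norm (g v s - Z p) \<le> L * norm v * exp (K * s)" by simp
    have "norm (Z p) * 1 \<le> norm (Z p) * exp (K * s)"
      using that K by (intro mult_left_mono) auto
    with 1 norm_triangle_sub[of "g v s" "Z p"] show ?thesis by (simp add: algebra_simps)
  qed
  \<comment> \<open>The weight cancels the growth of the integral of \<open>exp (K * s)\<close>; the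
    surviving factor \<open>1 / K\<close> yields both boundedness and contraction.\<close>
  have scale: "exp (- K * t) * (C * ((exp (K * t) - 1) / K)) \<le> C / K" if "C \<ge> 0" for C t
  proof -
    have "exp (- K * t) * (C * ((exp (K * t) - 1) / K)) = C / K * (1 - exp (- K * t))"
      by (simp add: field_simps exp_minus)
    also have "\<dots> \<le> C / K * 1"
      using that K by (intro mult_left_mono) auto
    finally show ?thesis by simp
  qed
  have fb: "norm (f v t) \<le> (norm (Z p) + L * norm v) / K" for v t
  proof -
    have "norm (J v (max 0 t)) \<le> (norm (Z p) + L * norm v) * ((exp (K * max 0 t) - 1) / K)"
      unfolding J_def
      by (rule integral_norm_bound_integral[OF gi has_integral_integrable[OF integral_exp_mult],
            THEN order_trans[OF _ eq_refl[OF integral_unique[OF integral_exp_mult]]]])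
        (use gb K in auto)
    then have "norm (f v t) \<le> exp (- K * max 0 t) *
        ((norm (Z p) + L * norm v) * ((exp (K * max 0 t) - 1) / K))"
      unfolding f_def norm_scaleR abs_exp_cancel by (intro mult_left_mono) auto
    also have "\<dots> \<le> (norm (Z p) + L * norm v) / K"
      by (rule scale) (use L0 in auto)
    finally show ?thesis .
  qed
  have fB: "f v \<in> bcontfun" for v
    using fc fb by (auto simp: bcontfun_def bounded_iff intro!: exI)
  have appf: "apply_bcontfun (Bcontfun (f v)) = f v" for v
    using fB by (rule Bcontfun_inverse)
  have contr: "dist (Bcontfun (f v)) (Bcontfun (f w)) \<le> 1/2 * dist v w" for v w
  proof (rule dist_bound)
    fix t :: real
    let ?t = "max 0 t"
    have "norm (g v s - g w s) \<le> L * dist v w * exp (K * s)" for s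
    proof -
      have "norm (g v s - g w s) \<le> L * norm (exp (K * s) *\<^sub>R (apply_bcontfun v s - apply_bcontfun w s))"
        using Zd[of "p + exp (K * s) *\<^sub>R apply_bcontfun v s" "p + exp (K * s) *\<^sub>R apply_bcontfun w s"]
        by (simp add: g_def algebra_simps)
      also have "\<dots> \<le> L * (dist v w * exp (K * s))"
        using L0 dist_bounded[of v s w] by (intro mult_left_mono) (auto simp: dist_norm)
      finally show ?thesis by simp
    qed
    then have "norm (integral {0..?t} (\<lambda>s. g v s - g w s)) \<le>
        L * dist v w * ((exp (K * ?t) - 1) / K)"
      by (intro integral_norm_bound_integral[OF integrable_diff[OF gi gi]
            has_integral_integrable[OF integral_exp_mult],
            THEN order_trans[OF _ eq_refl[OF integral_unique[OF integral_exp_mult]]]])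
        (use K in auto)
    then have "norm (J v ?t - J w ?t) \<le> L * dist v w * ((exp (K * ?t) - 1) / K)"
      by (simp add: J_def integral_diff gi)
    then have "exp (- K * ?t) * norm (J v ?t - J w ?t) \<le>
        exp (- K * ?t) * (L * dist v w * ((exp (K * ?t) - 1) / K))"
      by (intro mult_left_mono) auto
    also have "\<dots> \<le> L * dist v w / K"
      by (rule scale) (use L0 in auto)
    also have "\<dots> \<le> 1/2 * dist v w"
      using mult_right_mono[OF LK, of "dist v w"] by simp
    finally show "dist (apply_bcontfun (Bcontfun (f v)) t) (apply_bcontfun (Bcontfun (f w)) t)
        \<le> 1/2 * dist v w"
      by (simp add: appf dist_norm f_def flip: scaleR_diff_right)
  qed
  have "\<exists>!v. Bcontfun (f v) = v"
    by (rule banach_fix_type[where c = "1/2"]) (use contr in auto)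
  then obtain v where v: "Bcontfun (f v) = v" by blast
  have vt: "apply_bcontfun v t = exp (- K * t) *\<^sub>R J v t" if "t \<ge> 0" for t
    using appf[of v] v that by (simp add: f_def)
  show ?thesis
  proof (rule that[of "\<lambda>t. p + J v t"])
    show "p + J v 0 = p" by (simp add: J_def)
    fix t :: real assume t: "t \<ge> 0"
    have "Z (p + J v t) = g v t"
      using t by (simp add: g_def vt exp_minus)
    with Jd[OF t, of v] show "((\<lambda>t. p + J v t) has_vector_derivative Z (p + J v t)) (at t within {0..})"
      by (auto intro!: derivative_eq_intros)
  qed
qed

lemma nondecreasing_within:
  fixes f :: "real \<Rightarrow> real"
  assumes "a \<le> b" "\<And>t. t \<in> {a..b} \<Longrightarrow> (f has_real_derivative f' t) (at t within {a..b})"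
    "\<And>t. t \<in> {a..b} \<Longrightarrow> 0 \<le> f' t"
  shows "f a \<le> f b"
proof -
  obtain t where "t \<in> {a..b}" "f b - f a = f' t * (b - a)"
    using mvt_very_simple[OF assms(1), of f "\<lambda>t. (*) (f' t)"] assms(2)
    by (auto simp: has_field_derivative_def)
  with assms(1,3) show ?thesis
    by (metis diff_ge_0_iff_ge mult_nonneg_nonneg)
qed

text \<open>Gronwall in both directions: \<open>exp (\<mp>2 L t) |z t - \<eta> t|\<^sup>2\<close> is monotone.\<close>

lemma lipschitz_field_solutions_dist:
  fixes Z :: "'a::euclidean_space \<Rightarrow> 'a"
  assumes lip: "L-lipschitz_on UNIV Z" and T: "0 \<le> T"
    and g: "\<And>t. 0 \<le> t \<Longrightarrow> t \<le> T \<Longrightarrow> (z has_vector_derivative Z (z t)) (at t within {0..T})"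
    and e: "\<And>t. 0 \<le> t \<Longrightarrow> t \<le> T \<Longrightarrow> (\<eta> has_vector_derivative Z (\<eta> t)) (at t within {0..T})"
  shows "norm (z T - \<eta> T) \<le> exp (L * T) * norm (z 0 - \<eta> 0)"
    and "norm (z 0 - \<eta> 0) \<le> exp (L * T) * norm (z T - \<eta> T)"
proof -
  have L0: "L \<ge> 0" using lip by (rule lipschitz_on_nonneg)
  define u where "u t = z t - \<eta> t" for t
  define d where "d t = Z (z t) - Z (\<eta> t)" for t
  have ud: "(u has_vector_derivative d t) (at t within {0..T})" if "t \<in> {0..T}" for t
    unfolding u_def d_def using that by (auto intro!: has_vector_derivative_diff g e)
  have Nd: "((\<lambda>t. u t \<bullet> u t) has_real_derivative 2 * (u t \<bullet> d t)) (at t within {0..T})"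
    if "t \<in> {0..T}" for t
    unfolding has_field_derivative_def
    using has_derivative_inner[OF ud[OF that, unfolded has_vector_derivative_def]
        ud[OF that, unfolded has_vector_derivative_def]]
    by (rule has_derivative_eq_rhs) (auto simp: fun_eq_iff inner_commute algebra_simps)
  have bd: "\<bar>u t \<bullet> d t\<bar> \<le> L * (u t \<bullet> u t)" for t
  proof -
    have "\<bar>u t \<bullet> d t\<bar> \<le> norm (u t) * norm (d t)" by (rule Cauchy_Schwarz_ineq2)
    also have "\<dots> \<le> norm (u t) * (L * norm (u t))"
      using lipschitz_onD[OF lip, of "z t" "\<eta> t"]
      by (intro mult_left_mono) (simp_all add: dist_norm u_def d_def)
    finally show ?thesis
      by (simp add: dot_square_norm power2_eq_square mult.left_commute)
  qed
  have nn: "0 \<le> 2 * L * (u t \<bullet> u t) + 2 * (u t \<bullet> d t)"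
    "- (2 * L * (u t \<bullet> u t)) + 2 * (u t \<bullet> d t) \<le> 0" for t
    using bd[of t] by (auto simp: abs_le_iff)
  have sq: "norm x \<le> exp (L * T) * norm y" if "x \<bullet> x \<le> exp (2 * L * T) * (y \<bullet> y)" for x y :: 'a
  proof (rule power2_le_imp_le)
    show "(norm x)\<^sup>2 \<le> (exp (L * T) * norm y)\<^sup>2"
      using that by (simp add: power_mult_distrib power2_norm_eq_inner mult.assoc
          flip: exp_of_nat_mult)
  qed simp
  have Ed: "((\<lambda>t. exp (c * t) * (u t \<bullet> u t)) has_real_derivative
      exp (c * t) * (c * (u t \<bullet> u t) + 2 * (u t \<bullet> d t))) (at t within {0..T})"
    if "t \<in> {0..T}" for t c
    by (auto intro!: derivative_eq_intros Nd[OF that] simp: algebra_simps)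
  have "exp (2 * L * 0) * (u 0 \<bullet> u 0) \<le> exp (2 * L * T) * (u T \<bullet> u T)"
    by (rule nondecreasing_within[OF T Ed]) (use nn in \<open>auto intro!: mult_nonneg_nonneg\<close>)
  then show "norm (z 0 - \<eta> 0) \<le> exp (L * T) * norm (z T - \<eta> T)"
    by (intro sq) (simp add: u_def)
  have "- (exp (- 2 * L * 0) * (u 0 \<bullet> u 0)) \<le> - (exp (- 2 * L * T) * (u T \<bullet> u T))"
    by (rule nondecreasing_within[OF T DERIV_minus[OF Ed]])
      (use nn in \<open>auto intro!: mult_nonneg_nonpos\<close>)
  then have "exp (2 * L * T) * (exp (- 2 * L * T) * (u T \<bullet> u T)) \<le> exp (2 * L * T) * (u 0 \<bullet> u 0)"
    by (intro mult_left_mono) auto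
  then show "norm (z T - \<eta> T) \<le> exp (L * T) * norm (z 0 - \<eta> 0)"
    by (intro sq) (simp add: u_def flip: mult.assoc exp_add)
qed

section \<open>Smooth functions and jets\<close>

lemma C_diff_on_Suc_imp: "C_diff_on (Suc k) g U \<Longrightarrow> C_diff_on k g U"
proof (induction k arbitrary: g)
  case 0
  then show ?case
    by (auto intro!: continuous_at_imp_continuous_on differentiable_imp_continuous_within)
next
  case (Suc k)
  then show ?case by auto
qed

lemma C_diff_on_le: "C_diff_on m g U \<Longrightarrow> k \<le> m \<Longrightarrow> C_diff_on k g U"
  by (induction m) (auto dest: C_diff_on_Suc_imp simp: le_Suc_eq simp del: C_diff_on.simps)

lemma C_diff_on_imp_continuous_on: "C_diff_on k g U \<Longrightarrow> continuous_on U g"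
  using C_diff_on_le[of k g U 0] by simp

text \<open>Each partial derivative is continuous, hence bounded on the compact ball. The sum of
  these bounds controls the derivative, and convexity of the ball turns it into a Lipschitz
  constant.\<close>

lemma C_diff_on_Suc_lipschitz_on_cball:
  fixes g :: "'a::euclidean_space \<Rightarrow> real"
  assumes g: "C_diff_on (Suc k) g U" and U: "cball p \<rho> \<subseteq> U"
  obtains L where "L-lipschitz_on (cball p \<rho>) g"
proof -
  define D where "D q = frechet_derivative g (at q)" for q
  have D: "(g has_derivative D q) (at q)" if "q \<in> cball p \<rho>" for q
    using g U that unfolding D_def by (auto simp: frechet_derivative_works)
  have "\<exists>B. \<forall>q\<in>cball p \<rho>. \<bar>D q v\<bar> \<le> B" if "v \<in> Basis" for v
  proof -
    have "C_diff_on k (\<lambda>q. D q v) U"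
      using g that by (simp add: D_def)
    then have "continuous_on (cball p \<rho>) (\<lambda>q. D q v)"
      using U by (blast intro: continuous_on_subset C_diff_on_imp_continuous_on)
    then have "bounded ((\<lambda>q. D q v) ` cball p \<rho>)"
      by (intro compact_imp_bounded compact_continuous_image) auto
    then show ?thesis by (auto simp: bounded_iff)
  qed
  then obtain B where B: "\<And>v q. v \<in> Basis \<Longrightarrow> q \<in> cball p \<rho> \<Longrightarrow> \<bar>D q v\<bar> \<le> B v"
    by metis
  have "\<bar>D q v\<bar> \<le> norm v * (\<Sum>b\<in>Basis. \<bar>B b\<bar>)" if q: "q \<in> cball p \<rho>" for q v
  proof -
    have lin: "linear (D q)" using D[OF q] by (rule has_derivative_linear)
    have "D q v = D q (\<Sum>b\<in>Basis. (v \<bullet> b) *\<^sub>R b)" by (simp add: euclidean_representation)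
    also have "\<dots> = (\<Sum>b\<in>Basis. (v \<bullet> b) * D q b)"
      using lin by (simp add: linear_sum linear_cmul o_def)
    finally have "\<bar>D q v\<bar> \<le> (\<Sum>b\<in>Basis. \<bar>(v \<bullet> b) * D q b\<bar>)" by simp
    also have "\<dots> \<le> (\<Sum>b\<in>Basis. norm v * \<bar>B b\<bar>)"
      using B q by (intro sum_mono) (force simp: abs_mult Basis_le_norm intro!: mult_mono)
    finally show ?thesis by (simp add: sum_distrib_left)
  qed
  then have "(\<Sum>b\<in>Basis. \<bar>B b\<bar>)-lipschitz_on (cball p \<rho>) g"
    by (intro bounded_derivative_imp_lipschitz[of _ _ D] convex_cball onorm_bound sum_nonneg)
      (use D in \<open>auto intro: has_derivative_at_withinI simp: mult.commute\<close>)
  then show ?thesis by (rule that)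
qed

lemma C_diff_on_Suc_has_derivative:
  fixes h :: "real \<times> real \<Rightarrow> real"
  assumes "C_diff_on (Suc k) h U" "p \<in> U"
  shows "(h has_derivative (\<lambda>v. fst v * frechet_derivative h (at p) (1, 0)
    + snd v * frechet_derivative h (at p) (0, 1))) (at p)"
proof -
  have D: "(h has_derivative frechet_derivative h (at p)) (at p)"
    using assms by (auto simp: frechet_derivative_works)
  have "frechet_derivative h (at p) v = fst v * frechet_derivative h (at p) (1, 0)
    + snd v * frechet_derivative h (at p) (0, 1)" for v
  proof -
    have lin: "linear (frechet_derivative h (at p))" using D by (rule has_derivative_linear)
    have "frechet_derivative h (at p) v =
        frechet_derivative h (at p) (fst v *\<^sub>R (1, 0) + snd v *\<^sub>R (0, 1))"
      by simp
    then show ?thesis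
      by (simp only: linear_add[OF lin] linear_cmul[OF lin] real_scaleR_def)
  qed
  then have "frechet_derivative h (at p) = (\<lambda>v. fst v * frechet_derivative h (at p) (1, 0)
    + snd v * frechet_derivative h (at p) (0, 1))" by blast
  with D show ?thesis by simp
qed

text \<open>Mean value inequality on the segment from \<open>p\<close> to \<open>q\<close> for
  \<open>h\<close> minus its linear part at \<open>p\<close>: the derivative of that difference is
  at most \<open>2 * K * norm (q - p)\<close> there. Lipschitz partial derivatives take the place of
  second derivatives.\<close>

lemma quadratic_remainder:
  fixes h h1 h2 :: "real \<times> real \<Rightarrow> real"
  assumes D: "\<And>p. p \<in> S \<Longrightarrow> (h has_derivative (\<lambda>v. fst v * h1 p + snd v * h2 p)) (at p)"
    and S: "convex S" and lip: "K-lipschitz_on S h1" "K-lipschitz_on S h2"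
    and pq: "p \<in> S" "q \<in> S"
  shows "\<bar>h q - h p - (fst q - fst p) * h1 p - (snd q - snd p) * h2 p\<bar> \<le> 2 * K * (norm (q - p))\<^sup>2"
proof -
  let ?\<phi> = "\<lambda>z. h z - fst z * h1 p - snd z * h2 p"
  let ?D = "\<lambda>z v. fst v * (h1 z - h1 p) + snd v * (h2 z - h2 p)"
  have sub: "closed_segment p q \<subseteq> S" using S pq by (simp add: closed_segment_subset)
  have K: "K \<ge> 0" using lip(1) by (rule lipschitz_on_nonneg)
  have "norm (?\<phi> q - ?\<phi> p) \<le> 2 * K * norm (q - p) * norm (q - p)"
  proof (rule differentiable_bound[where S = "closed_segment p q" and f' = ?D])
    fix z assume z: "z \<in> closed_segment p q"
    show "(?\<phi> has_derivative ?D z) (at z within closed_segment p q)"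
      using sub z by (auto intro!: derivative_eq_intros has_derivative_at_withinI[OF D]
          simp: algebra_simps)
    show "onorm (?D z) \<le> 2 * K * norm (q - p)"
    proof (rule onorm_bound)
      have zp: "norm (z - p) \<le> norm (q - p)"
        using segment_bound1[OF z] by (simp add: norm_minus_commute)
      have b: "\<bar>h' z - h' p\<bar> \<le> K * norm (q - p)" if "K-lipschitz_on S h'" for h'
        using lipschitz_onD[OF that, of z p] sub z pq mult_left_mono[OF zp K]
        by (auto simp: dist_norm)
      fix v :: "real \<times> real"
      have "norm (?D z v) \<le> \<bar>fst v\<bar> * \<bar>h1 z - h1 p\<bar> + \<bar>snd v\<bar> * \<bar>h2 z - h2 p\<bar>"
        by (simp flip: abs_mult)
      also have "\<dots> \<le> norm v * (K * norm (q - p)) + norm v * (K * norm (q - p))"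
        using b lip norm_fst_le[of "fst v" "snd v"] norm_snd_le[of "snd v" "fst v"]
        by (intro add_mono mult_mono) auto
      finally show "norm (?D z v) \<le> 2 * K * norm (q - p) * norm v" by (simp add: algebra_simps)
    qed (use K in simp)
  qed auto
  then show ?thesis by (simp add: algebra_simps power2_eq_square)
qed

text \<open>One-variable analogue of \<open>C_diff_on\<close>. The derivative is quantified
  existentially rather than named by an operator, so that closure properties follow by exhibiting a
  formula for it.\<close>

primrec Ck_on :: "nat \<Rightarrow> (real \<Rightarrow> real) \<Rightarrow> real set \<Rightarrow> bool" where
  "Ck_on 0 g I \<longleftrightarrow> continuous_on I g"
| "Ck_on (Suc k) g I \<longleftrightarrow>
     (\<exists>g'. (\<forall>x\<in>I. (g has_real_derivative g' x) (at x)) \<and> Ck_on k g' I)"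

lemma Ck_on_Suc_imp: "Ck_on (Suc k) g I \<Longrightarrow> Ck_on k g I"
proof (induction k arbitrary: g)
  case 0
  then show ?case
    by (metis Ck_on.simps DERIV_isCont continuous_at_imp_continuous_on)
next
  case (Suc k)
  then show ?case by (metis Ck_on.simps(2))
qed

lemma Ck_on_const: "Ck_on k (\<lambda>_. c) I"
  by (induction k arbitrary: c) (auto intro!: exI[where x = "\<lambda>_. 0"])

lemma Ck_on_add: "Ck_on k g I \<Longrightarrow> Ck_on k h I \<Longrightarrow> Ck_on k (\<lambda>x. g x + h x) I"
proof (induction k arbitrary: g h)
  case (Suc k)
  then obtain g' h' where "\<forall>x\<in>I. (g has_real_derivative g' x) (at x)" "Ck_on k g' I"
    "\<forall>x\<in>I. (h has_real_derivative h' x) (at x)" "Ck_on k h' I" by auto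
  then show ?case
    by (auto intro!: exI[where x = "\<lambda>x. g' x + h' x"] derivative_eq_intros Suc.IH)
qed (auto intro: continuous_intros)

lemma Ck_on_mult: "Ck_on k g I \<Longrightarrow> Ck_on k h I \<Longrightarrow> Ck_on k (\<lambda>x. g x * h x) I"
proof (induction k arbitrary: g h)
  case (Suc k)
  then obtain g' h' where "\<forall>x\<in>I. (g has_real_derivative g' x) (at x)" "Ck_on k g' I"
    "\<forall>x\<in>I. (h has_real_derivative h' x) (at x)" "Ck_on k h' I" by auto
  with Suc.prems[THEN Ck_on_Suc_imp] show ?case
    by (auto intro!: exI[where x = "\<lambda>x. g' x * h x + g x * h' x"] derivative_eq_intros
        Suc.IH Ck_on_add)
qed (auto intro: continuous_intros)

lemma Ck_on_inverse:
  assumes "\<And>x. x \<in> I \<Longrightarrow> g x \<noteq> 0"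
  shows "Ck_on k g I \<Longrightarrow> Ck_on k (\<lambda>x. inverse (g x)) I"
proof (induction k)
  case (Suc k)
  then obtain g' where g': "\<forall>x\<in>I. (g has_real_derivative g' x) (at x)" "Ck_on k g' I" by auto
  let ?h = "\<lambda>x. (- 1) * (g' x * (inverse (g x) * inverse (g x)))"
  have "Ck_on k ?h I"
    using g' Suc.IH[OF Ck_on_Suc_imp[OF Suc.prems]]
    by (intro Ck_on_mult Ck_on_const)
  with g' assms show ?case
    by (auto intro!: exI[where x = ?h] derivative_eq_intros)
qed (use assms in \<open>auto intro: continuous_intros\<close>)

text \<open>Induction through the chain rule: the derivative is built from the partial derivatives
  along the same graph and from \<open>F'\<close>, all of them one class lower.\<close>

lemma Ck_on_compose_graph:
  fixes h :: "real \<times> real \<Rightarrow> real"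
  assumes U: "\<And>x. x \<in> I \<Longrightarrow> (x, F x) \<in> U"
  shows "C_diff_on k h U \<Longrightarrow> Ck_on k F I \<Longrightarrow> Ck_on k (\<lambda>x. h (x, F x)) I"
proof (induction k arbitrary: h)
  case 0
  then have "continuous_on I (\<lambda>x. (x, F x))" by (auto intro!: continuous_intros)
  with 0 U show ?case by (auto intro!: continuous_on_compose2[where t = U])
next
  case (Suc k)
  then obtain F' where F': "\<forall>x\<in>I. (F has_real_derivative F' x) (at x)" "Ck_on k F' I" by auto
  define h1 where "h1 = (\<lambda>p. frechet_derivative h (at p) (1, 0))"
  define h2 where "h2 = (\<lambda>p. frechet_derivative h (at p) (0, 1))"
  have C: "C_diff_on k h1 U" "C_diff_on k h2 U"
    using Suc.prems(1) by (auto simp: h1_def h2_def Basis_prod_def)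
  have D: "((\<lambda>x. h (x, F x)) has_real_derivative h1 (x, F x) + F' x * h2 (x, F x)) (at x)"
    if "x \<in> I" for x
  proof -
    have "((\<lambda>x. (x, F x)) has_derivative (\<lambda>t. (t, F' x * t))) (at x)"
      using F' that by (auto intro!: derivative_intros simp: has_field_derivative_def)
    from has_derivative_compose[OF this
        C_diff_on_Suc_has_derivative[OF Suc.prems(1) U[OF that]]]
    show ?thesis
      unfolding has_field_derivative_def
      by (rule has_derivative_eq_rhs) (auto simp: h1_def h2_def algebra_simps)
  qed
  note FI = Ck_on_Suc_imp[OF Suc.prems(2)]
  have "Ck_on k (\<lambda>x. h1 (x, F x) + F' x * h2 (x, F x)) I"
    by (rule Ck_on_add[OF Suc.IH[OF C(1) FI] Ck_on_mult[OF F'(2) Suc.IH[OF C(2) FI]]])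
  with D show ?case
    unfolding Ck_on.simps by (intro exI[of _ "\<lambda>x. h1 (x, F x) + F' x * h2 (x, F x)"]) simp
qed

lemma Ck_on_derivatives:
  assumes "Ck_on k g I"
  obtains D where "D 0 = g" "continuous_on I (D k)"
    "\<And>j x. j < k \<Longrightarrow> x \<in> I \<Longrightarrow> (D j has_real_derivative D (Suc j) x) (at x)"
proof -
  have "\<exists>D. D 0 = g \<and> continuous_on I (D k) \<and>
    (\<forall>j x. j < k \<longrightarrow> x \<in> I \<longrightarrow> (D j has_real_derivative D (Suc j) x) (at x))"
    using assms
  proof (induction k arbitrary: g)
    case 0
    then show ?case by auto
  next
    case (Suc k)
    then obtain g' where g': "\<forall>x\<in>I. (g has_real_derivative g' x) (at x)" "Ck_on k g' I" by auto
    obtain D where D: "D 0 = g'" "continuous_on I (D k)"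
      "\<And>j x. j < k \<Longrightarrow> x \<in> I \<Longrightarrow> (D j has_real_derivative D (Suc j) x) (at x)"
      using Suc.IH[OF g'(2)] by auto
    define E where "E j = (case j of 0 \<Rightarrow> g | Suc i \<Rightarrow> D i)" for j
    have "(E j has_real_derivative E (Suc j) x) (at x)" if "j < Suc k" "x \<in> I" for j x
      using that g' D by (auto simp: E_def split: nat.split)
    with D show ?case by (intro exI[of _ E]) (auto simp: E_def)
  qed
  with that show ?thesis by blast
qed

text \<open>\<open>jet\<close> differentiates along the ray \<open>t * v\<close>. In dimension one
  each differentiation contributes a factor \<open>v\<close>, which turns \<open>jet\<close> into
  the usual Taylor polynomial in \<open>v\<close>. A general \<open>t\<close> is needed because the
  induction differentiates on a neighbourhood.\<close>

lemma higher_deriv_scaled: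
  assumes I: "open I" and g: "D 0 = g"
    and D: "\<And>j x. j < k \<Longrightarrow> x \<in> I \<Longrightarrow> (D j has_real_derivative D (Suc j) x) (at x)"
  shows "j \<le> k \<Longrightarrow> t * v \<in> I \<Longrightarrow> (deriv ^^ j) (\<lambda>t. g (t * v)) t = v ^ j * D j (t * v)"
proof (induction j arbitrary: t)
  case (Suc j)
  have op: "open ((\<lambda>t. t * v) -` I)"
    by (intro open_vimage I continuous_intros)
  have "((\<lambda>t. v ^ j * D j (t * v)) has_real_derivative v ^ Suc j * D (Suc j) (t * v)) (at t)"
  proof -
    have "((\<lambda>t. D j (t * v)) has_real_derivative D (Suc j) (t * v) * v) (at t)"
      by (rule DERIV_chain2[OF D]) (use Suc.prems in \<open>auto intro!: derivative_eq_intros\<close>)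
    then have "((\<lambda>t. v ^ j * D j (t * v)) has_real_derivative v ^ j * (D (Suc j) (t * v) * v)) (at t)"
      by (rule DERIV_cmult)
    then show ?thesis by (simp add: mult_ac)
  qed
  then have "((deriv ^^ j) (\<lambda>t. g (t * v)) has_real_derivative v ^ Suc j * D (Suc j) (t * v)) (at t)"
    by (rule has_field_derivative_transform_within_open[OF _ op])
      (use Suc in \<open>auto simp: Suc_le_eq dest: less_imp_le\<close>)
  from DERIV_imp_deriv[OF this] show ?case by simp
qed (simp add: g)

text \<open>A polynomial in \<open>v\<close> that vanishes identically has zero coefficients, so
  only the Lagrange remainder of Taylor's formula survives. Its exponent is \<open>k\<close>, not
  \<open>k + 1\<close>, since only \<open>k\<close> derivatives are at hand. Halving the interval
  makes the last one bounded.\<close>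

lemma jet_zero_imp_bound:
  fixes g :: "real \<Rightarrow> real"
  assumes g: "Ck_on k g {-\<delta><..<\<delta>}" and \<delta>: "\<delta> > 0" and jet: "jet k g = (\<lambda>_. 0)"
  obtains C where "C \<ge> 0" "\<And>x. \<bar>x\<bar> \<le> \<delta> / 2 \<Longrightarrow> \<bar>g x\<bar> \<le> C * \<bar>x\<bar> ^ k"
proof -
  obtain D where D0: "D 0 = g" and Dc: "continuous_on {-\<delta><..<\<delta>} (D k)"
    and D: "\<And>j x. j < k \<Longrightarrow> x \<in> {-\<delta><..<\<delta>} \<Longrightarrow> (D j has_real_derivative D (Suc j) x) (at x)"
    using Ck_on_derivatives[OF g] by metis
  have "(\<Sum>j\<le>k. D j 0 / fact j * v ^ j) = 0" for v
    using fun_cong[OF jet, of v] higher_deriv_scaled[where t = 0 and v = v, OF open_greaterThanLessThan D0 D] \<delta>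
    by (simp add: jet_def mult.commute)
  then have z: "D j 0 = 0" if "j \<le> k" for j
    using that polyfun_eq_0[of "\<lambda>j. D j 0 / fact j" k] by auto
  have "bounded (D k ` {-\<delta>/2..\<delta>/2})"
    using \<delta> by (intro compact_imp_bounded compact_continuous_image continuous_on_subset[OF Dc]) auto
  then obtain C where C: "\<And>x. x \<in> {-\<delta>/2..\<delta>/2} \<Longrightarrow> \<bar>D k x\<bar> \<le> C"
    unfolding bounded_iff by (metis image_eqI real_norm_def)
  show ?thesis
  proof (rule that[of "C / fact k"])
    have "0 \<le> C" using C[of 0] \<delta> by auto
    then show "0 \<le> C / fact k" by simp
    fix x :: real assume x: "\<bar>x\<bar> \<le> \<delta> / 2"
    have "\<forall>m t. m < k \<and> \<bar>t\<bar> \<le> \<bar>x\<bar> \<longrightarrow> (D m has_real_derivative D (Suc m) t) (at t)"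
      using x \<delta> by (auto intro!: D)
    from Maclaurin_bi_le[OF D0 this] obtain t where t: "\<bar>t\<bar> \<le> \<bar>x\<bar>"
      "g x = (\<Sum>m<k. D m 0 / fact m * x ^ m) + D k t / fact k * x ^ k" by auto
    then have "\<bar>g x\<bar> = \<bar>D k t\<bar> / fact k * \<bar>x\<bar> ^ k"
      by (simp add: z abs_mult power_abs)
    also have "\<dots> \<le> C / fact k * \<bar>x\<bar> ^ k"
      using t x by (intro mult_right_mono divide_right_mono C) auto
    finally show "\<bar>g x\<bar> \<le> C / fact k * \<bar>x\<bar> ^ k" .
  qed
qed

section \<open>The normal form\<close>

text \<open>The change of variables is never carried out: \<open>X\<close> and its orbits stay in
  the original coordinates, and \<open>w = snd p - F (fst p)\<close> is only a function along them.
  The estimates bound absolute values, so that reflections preserve them with the same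
  constants.\<close>

locale nilpotent_field =
  fixes X :: "real \<times> real \<Rightarrow> real \<times> real" and F F' f \<Phi> :: "real \<Rightarrow> real" and \<rho> K L :: real
  assumes \<rho>: "0 < \<rho>" and K: "1 \<le> K"
    and lip: "L-lipschitz_on (cball 0 \<rho>) X" and X0: "X 0 = 0" and F0: "F 0 = 0"
    and F_deriv: "\<bar>x\<bar> \<le> \<rho> \<Longrightarrow> (F has_real_derivative F' x) (at x)"
    and F'_bound: "\<bar>x\<bar> \<le> \<rho> \<Longrightarrow> \<bar>F' x\<bar> \<le> K * \<bar>x\<bar>"
    and fst_field: "p \<in> cball 0 \<rho> \<Longrightarrow> \<bar>fst (X p) - (snd p - F (fst p))\<bar>
      \<le> K * \<bar>snd p - F (fst p)\<bar> * (\<bar>fst p\<bar> + \<bar>snd p - F (fst p)\<bar>)"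
    and snd_field: "p \<in> cball 0 \<rho> \<Longrightarrow>
      \<bar>snd (X p) - F' (fst p) * fst (X p) - f (fst p) - \<Phi> (fst p) * (snd p - F (fst p))\<bar>
      \<le> K * (snd p - F (fst p))\<^sup>2"
    and f_bound: "\<bar>x\<bar> \<le> \<rho> \<Longrightarrow> \<bar>f x\<bar> \<le> K * x\<^sup>2"
    and \<Phi>_bound: "\<bar>x\<bar> \<le> \<rho> \<Longrightarrow> \<bar>\<Phi> x\<bar> \<le> K * \<bar>x\<bar>"

section \<open>Reflections of the axes and of time\<close>

definition flip :: "real \<Rightarrow> real \<Rightarrow> real \<times> real \<Rightarrow> real \<times> real" where
  "flip s \<sigma> p = (s * fst p, \<sigma> * snd p)"

text \<open>The push-forward of the field under the reflection has \<open>s * \<sigma>\<close> times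
  \<open>y\<close> as leading term of \<open>x'\<close>. The factor \<open>s * \<sigma>\<close>, a
  reversal of time if it is \<open>- 1\<close>, restores the leading term \<open>y\<close>.\<close>

definition flip_field ::
  "real \<Rightarrow> real \<Rightarrow> (real \<times> real \<Rightarrow> real \<times> real) \<Rightarrow> real \<times> real \<Rightarrow> real \<times> real" where
  "flip_field s \<sigma> X p = (s * \<sigma>) *\<^sub>R flip s \<sigma> (X (flip s \<sigma> p))"

lemma abs_eq_1_cases: "\<bar>s\<bar> = 1 \<Longrightarrow> s = 1 \<or> s = (- 1 :: real)"
  by auto

lemma norm_flip: "\<bar>s\<bar> = 1 \<Longrightarrow> \<bar>\<sigma>\<bar> = 1 \<Longrightarrow> norm (flip s \<sigma> p) = norm p"
  by (auto dest!: abs_eq_1_cases simp: flip_def norm_prod_def)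

lemma linear_flip: "linear (flip s \<sigma>)"
  by (auto simp: linear_iff flip_def algebra_simps)

lemma flip_flip: "\<bar>s\<bar> = 1 \<Longrightarrow> \<bar>\<sigma>\<bar> = 1 \<Longrightarrow> flip s \<sigma> (flip s \<sigma> p) = p"
  by (auto simp: flip_def abs_if prod_eq_iff split: if_splits)

text \<open>A leading coefficient \<open>a\<close> of \<open>f\<close> at order \<alpha> becomes
  \<open>s^(\<alpha>+1) a\<close>, and a leading coefficient \<open>b\<close> of \<Phi> at order
  \<beta> becomes \<open>\<sigma> s^(\<beta>+1) b\<close>. So \<open>s = - 1\<close> changes the
  sign of \<open>a\<close> for even \<alpha>, while \<sigma> can always adjust the sign of
  \<open>b\<close>.\<close>

lemma (in nilpotent_field) flip:
  assumes s: "\<bar>s\<bar> = 1" and \<sigma>: "\<bar>\<sigma>\<bar> = 1"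
  shows "nilpotent_field (flip_field s \<sigma> X) (\<lambda>x. \<sigma> * F (s * x)) (\<lambda>x. \<sigma> * s * F' (s * x))
    (\<lambda>x. s * f (s * x)) (\<lambda>x. s * \<sigma> * \<Phi> (s * x)) \<rho> K L"
proof
  note cases = abs_eq_1_cases[OF s] abs_eq_1_cases[OF \<sigma>]
  have mem: "flip s \<sigma> p \<in> cball 0 \<rho> \<longleftrightarrow> p \<in> cball 0 \<rho>" for p
    by (simp add: norm_flip s \<sigma>)
  have sx: "\<bar>s * x\<bar> = \<bar>x\<bar>" for x using s by (simp add: abs_mult)
  show "L-lipschitz_on (cball 0 \<rho>) (flip_field s \<sigma> X)"
  proof (rule lipschitz_onI)
    show "0 \<le> L" using lip by (rule lipschitz_on_nonneg)
    fix p q :: "real \<times> real" assume "p \<in> cball 0 \<rho>" "q \<in> cball 0 \<rho>"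
    then have "flip s \<sigma> p \<in> cball 0 \<rho>" "flip s \<sigma> q \<in> cball 0 \<rho>"
      by (simp_all only: mem)
    then have "dist (X (flip s \<sigma> p)) (X (flip s \<sigma> q)) \<le> L * dist (flip s \<sigma> p) (flip s \<sigma> q)"
      by (rule lipschitz_onD[OF lip])
    then show "dist (flip_field s \<sigma> X p) (flip_field s \<sigma> X q) \<le> L * dist p q"
      by (simp add: dist_norm flip_field_def norm_flip s \<sigma> abs_mult
          flip: linear_diff[OF linear_flip] scaleR_diff_right)
  qed
  show "flip_field s \<sigma> X 0 = 0" using X0 by (simp add: flip_field_def flip_def zero_prod_def)
  show "((\<lambda>x. \<sigma> * F (s * x)) has_real_derivative \<sigma> * s * F' (s * x)) (at x)" if "\<bar>x\<bar> \<le> \<rho>" for x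
    using DERIV_cmult[OF DERIV_chain2[OF F_deriv DERIV_cmult[OF DERIV_ident]], of s x \<sigma>] that
    by (simp add: sx mult_ac)
  show "\<bar>\<sigma> * s * F' (s * x)\<bar> \<le> K * \<bar>x\<bar>" if "\<bar>x\<bar> \<le> \<rho>" for x
    using F'_bound[of "s * x"] that s \<sigma> by (simp add: abs_mult)
  show "\<bar>s * f (s * x)\<bar> \<le> K * x\<^sup>2" if "\<bar>x\<bar> \<le> \<rho>" for x
    using f_bound[of "s * x"] that cases by (auto simp: abs_mult)
  show "\<bar>s * \<sigma> * \<Phi> (s * x)\<bar> \<le> K * \<bar>x\<bar>" if "\<bar>x\<bar> \<le> \<rho>" for x
    using \<Phi>_bound[of "s * x"] that s \<sigma> by (simp add: abs_mult)
  fix p :: "real \<times> real" assume p: "p \<in> cball 0 \<rho>"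
  define q where "q = flip s \<sigma> p"
  have q: "q \<in> cball 0 \<rho>" using p by (simp only: q_def mem)
  have qe: "fst q = s * fst p" "snd q = \<sigma> * snd p" by (auto simp: q_def flip_def)
  have Xe: "fst (flip_field s \<sigma> X p) = \<sigma> * fst (X q)" "snd (flip_field s \<sigma> X p) = s * snd (X q)"
    using cases by (auto simp: flip_field_def q_def flip_def)
  have W: "snd p - \<sigma> * F (s * fst p) = \<sigma> * (snd q - F (fst q))"
    using cases by (auto simp: qe)
  have "\<bar>fst (flip_field s \<sigma> X p) - (snd p - \<sigma> * F (s * fst p))\<bar> = \<bar>fst (X q) - (snd q - F (fst q))\<bar>"
    unfolding Xe W by (simp add: \<sigma> abs_mult flip: right_diff_distrib)
  then show "\<bar>fst (flip_field s \<sigma> X p) - (snd p - \<sigma> * F (s * fst p))\<bar>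
      \<le> K * \<bar>snd p - \<sigma> * F (s * fst p)\<bar> * (\<bar>fst p\<bar> + \<bar>snd p - \<sigma> * F (s * fst p)\<bar>)"
    using fst_field[OF q] unfolding W by (simp add: abs_mult s \<sigma> qe)
  have "snd (flip_field s \<sigma> X p) - \<sigma> * s * F' (s * fst p) * fst (flip_field s \<sigma> X p)
      - s * f (s * fst p) - s * \<sigma> * \<Phi> (s * fst p) * (snd p - \<sigma> * F (s * fst p)) =
    s * (snd (X q) - F' (fst q) * fst (X q) - f (fst q) - \<Phi> (fst q) * (snd q - F (fst q)))"
    unfolding Xe W qe(1)[symmetric] using cases by (auto simp: qe(2) algebra_simps)
  then show "\<bar>snd (flip_field s \<sigma> X p) - \<sigma> * s * F' (s * fst p) * fst (flip_field s \<sigma> X p)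
      - s * f (s * fst p) - s * \<sigma> * \<Phi> (s * fst p) * (snd p - \<sigma> * F (s * fst p))\<bar>
      \<le> K * (snd p - \<sigma> * F (s * fst p))\<^sup>2"
    using snd_field[OF q] cases s unfolding W by (auto simp: abs_mult power_mult_distrib)
qed (use \<rho> K F0 in auto)

context nilpotent_field
begin

definition W :: "real \<times> real \<Rightarrow> real" where
  "W p = snd p - F (fst p)"

text \<open>The derivative of \<open>W\<close> along the field, see
  \<open>curve_derivs\<close>.\<close>

definition V :: "real \<times> real \<Rightarrow> real" where
  "V p = snd (X p) - F' (fst p) * fst (X p)"

text \<open>Time runs backwards because the abscissa increases along the field near the origin where
  \<open>W\<close> is positive, which is where the wedges lie.\<close>

definition reverse_orbit :: "(real \<Rightarrow> real \<times> real) \<Rightarrow> bool" where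
  "reverse_orbit \<eta> \<longleftrightarrow> (\<forall>t\<ge>0. \<eta> t \<in> cball 0 \<rho> \<and>
     (\<eta> has_vector_derivative - X (\<eta> t)) (at t within {0..})) \<and> tends_with_tangent \<eta> 0 at_top"

lemma abs_fst_le: "(p :: real \<times> real) \<in> cball 0 \<rho> \<Longrightarrow> \<bar>fst p\<bar> \<le> \<rho>"
  using norm_fst_le[of "fst p" "snd p"] by simp

lemma F_bound:
  assumes "\<bar>x\<bar> \<le> \<rho>"
  shows "\<bar>F x\<bar> \<le> K * x\<^sup>2"
proof -
  have "norm (F x - F 0) \<le> K * \<bar>x\<bar> * norm (x - 0)"
  proof (rule field_differentiable_bound[where S = "closed_segment 0 x"])
    fix z assume "z \<in> closed_segment 0 x"
    then have "\<bar>z\<bar> \<le> \<bar>x\<bar>" using segment_bound1[of z 0 x] by simp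
    moreover from this have "K * \<bar>z\<bar> \<le> K * \<bar>x\<bar>" using K by (intro mult_left_mono) auto
    ultimately show "(F has_real_derivative F' z) (at z within closed_segment 0 x)"
      "norm (F' z) \<le> K * \<bar>x\<bar>"
      using assms F'_bound[of z] by (auto intro!: has_field_derivative_at_within[OF F_deriv])
  qed auto
  then show ?thesis by (simp add: F0 power2_eq_square abs_mult_self_eq mult.assoc)
qed

lemma curve_derivs:
  assumes "(z has_vector_derivative c *\<^sub>R X (z t)) (at t within S)" "z t \<in> cball 0 \<rho>"
  shows "((\<lambda>t. fst (z t)) has_real_derivative c * fst (X (z t))) (at t within S)"
    and "((\<lambda>t. W (z t)) has_real_derivative c * V (z t)) (at t within S)"
proof -
  have 1: "((\<lambda>t. fst (z t)) has_real_derivative c * fst (X (z t))) (at t within S)"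
    using has_derivative_fst[OF assms(1)[unfolded has_vector_derivative_def]]
    unfolding has_field_derivative_def
    by (rule has_derivative_eq_rhs) (simp add: fun_eq_iff mult_ac)
  have 2: "((\<lambda>t. snd (z t)) has_real_derivative c * snd (X (z t))) (at t within S)"
    using has_derivative_snd[OF assms(1)[unfolded has_vector_derivative_def]]
    unfolding has_field_derivative_def
    by (rule has_derivative_eq_rhs) (simp add: fun_eq_iff mult_ac)
  show "((\<lambda>t. fst (z t)) has_real_derivative c * fst (X (z t))) (at t within S)" by (rule 1)
  show "((\<lambda>t. W (z t)) has_real_derivative c * V (z t)) (at t within S)"
    using DERIV_diff[OF 2 DERIV_chain2[OF F_deriv[OF abs_fst_le[OF assms(2)]] 1]]
    by (simp add: W_def V_def algebra_simps)
qed

lemma fst_X_near: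
  assumes "p \<in> cball 0 \<rho>" "2 * K * (\<bar>fst p\<bar> + \<bar>W p\<bar>) \<le> 1"
  shows "\<bar>fst (X p) - W p\<bar> \<le> \<bar>W p\<bar> / 2"
proof -
  have "K * \<bar>W p\<bar> * (\<bar>fst p\<bar> + \<bar>W p\<bar>) = \<bar>W p\<bar> * (K * (\<bar>fst p\<bar> + \<bar>W p\<bar>))" by simp
  also have "K * (\<bar>fst p\<bar> + \<bar>W p\<bar>) \<le> 1 / 2"
    using assms(2) by (simp only: mult.assoc)
  then have "\<bar>W p\<bar> * (K * (\<bar>fst p\<bar> + \<bar>W p\<bar>)) \<le> \<bar>W p\<bar> * (1 / 2)"
    by (intro mult_left_mono) auto
  finally show ?thesis using fst_field[OF assms(1)] by (simp add: W_def)
qed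

lemma V_near:
  "p \<in> cball 0 \<rho> \<Longrightarrow> \<bar>V p - f (fst p) - \<Phi> (fst p) * W p\<bar> \<le> K * (W p)\<^sup>2"
  using snd_field by (simp add: W_def V_def)

end

text \<open>Every exclusion ends here: a monotone quantity bounds the logarithm of a coordinate from
  below although that coordinate tends to zero.\<close>

lemma ln_bounded_below_contradiction:
  fixes x :: "real \<Rightarrow> real"
  assumes "(x \<longlongrightarrow> 0) at_top" "\<And>t. t \<ge> t\<^sub>0 \<Longrightarrow> 0 < x t \<and> c \<le> ln (x t)"
  shows False
proof -
  have "\<forall>\<^sub>F t in at_top. x t < exp c"
    using assms(1) by (rule order_tendstoD) simp
  with eventually_ge_at_top[of t\<^sub>0] have "\<forall>\<^sub>F t in at_top :: real filter. False"
  proof eventually_elim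
    case (elim t)
    with assms(2)[of t] have "x t < x t" by (smt (verit) exp_le_cancel_iff exp_ln)
    then show False by simp
  qed
  then show False by simp
qed

section \<open>Excluding characteristic orbits\<close>

lemma negative_definite_quadratic:
  fixes a B N :: real
  assumes N: "N > 0" and disc: "B\<^sup>2 + 4 * a * N < 0"
  obtains \<kappa> where "\<kappa> > 0" "\<And>v. a + B * v - N * v\<^sup>2 \<le> - (2 * \<kappa> * (1 + v\<^sup>2))"
proof -
  have aN: "a * N < 0" using disc zero_le_power2[of B] by linarith
  then have a: "a < 0" using N by (simp add: mult_less_0_iff)
  \<comment> \<open>With \<open>P = N - 2 * \<kappa>\<close> the claim is that
    \<open>P v^2 - B v - a - 2 \<kappa>\<close> is nonnegative, that is
    \<open>4 P (- a - 2 \<kappa>) >= B^2\<close>. The left-hand side expands to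
    \<open>- 4 a N - 8 (N - a) \<kappa> + 16 \<kappa>^2\<close>, and this \<kappa> makes it equal to
    \<open>B^2 + 16 \<kappa>^2\<close>.\<close>
  define \<kappa> where "\<kappa> = (- 4 * a * N - B\<^sup>2) / (8 * (N - a))"
  have \<kappa>: "\<kappa> > 0" unfolding \<kappa>_def using disc a N by (intro divide_pos_pos) auto
  have e: "8 * (N - a) * \<kappa> = - 4 * a * N - B\<^sup>2" unfolding \<kappa>_def using a N by simp
  define P where "P = N - 2 * \<kappa>"
  have "2 * \<kappa> * (N - a) < N * (N - a)"
  proof -
    have "8 * (N - a) * \<kappa> = 4 * (2 * \<kappa> * (N - a))" by simp
    with e have "2 * \<kappa> * (N - a) \<le> - a * N" using zero_le_power2[of B] by linarith
    also have "\<dots> < N * (N - a)" using N by (simp add: algebra_simps)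
    finally show ?thesis .
  qed
  then have P: "P > 0" using a N by (simp add: P_def)
  have PQ: "4 * P * (- a - 2 * \<kappa>) \<ge> B\<^sup>2"
  proof -
    have "4 * P * (- a - 2 * \<kappa>) = - 4 * a * N - 8 * (N - a) * \<kappa> + 16 * \<kappa>\<^sup>2"
      by (simp add: P_def algebra_simps power2_eq_square)
    then show ?thesis using e by simp
  qed
  show ?thesis
  proof (rule that[OF \<kappa>])
    fix v
    have "4 * P * (P * v\<^sup>2 - B * v + (- a - 2 * \<kappa>)) = (2 * P * v - B)\<^sup>2 + (4 * P * (- a - 2 * \<kappa>) - B\<^sup>2)"
      by (simp add: algebra_simps power2_eq_square)
    then have "4 * P * (P * v\<^sup>2 - B * v + (- a - 2 * \<kappa>)) \<ge> 0" using PQ by simp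
    then have "P * v\<^sup>2 - B * v + (- a - 2 * \<kappa>) \<ge> 0" using P by (simp add: zero_le_mult_iff)
    then show "a + B * v - N * v\<^sup>2 \<le> - (2 * \<kappa> * (1 + v\<^sup>2))"
      by (simp add: P_def algebra_simps)
  qed
qed

text \<open>
  In the blow-up coordinate \<open>v = w / x\<^sup>n\<close>, with \<open>y = x\<^sup>n\<^sup>-\<^sup>1\<close> and \<open>N = n\<close>, the left-hand side is the
  derivative of \<open>v\<close> along the field.
\<close>

lemma blowup_derivative_bound:
  fixes x y v w x1 v1 fx px a B N M K K1 \<kappa> :: real
  assumes w: "w = v * x * y" and x: "x > 0" and y: "y > 0"
    and nonneg: "K \<ge> 0" "N \<ge> 0" "M \<ge> 0"
    and x1: "\<bar>x1 - w\<bar> \<le> K * \<bar>w\<bar> * (x + \<bar>w\<bar>)"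
    and v1: "\<bar>v1 - fx - px * w\<bar> \<le> K * w\<^sup>2"
    and fx: "\<bar>fx - a * (x * y\<^sup>2)\<bar> \<le> M * (x\<^sup>2 * y\<^sup>2)"
    and px: "\<bar>px - B * y\<bar> \<le> M * (x * y)"
    and wx: "\<bar>w\<bar> \<le> K1 * x"
    and quad: "a + B * v - N * v\<^sup>2 \<le> - (2 * \<kappa> * (1 + v\<^sup>2))"
    and small: "(2 * M + K + N * K * (1 + K1)) * x \<le> \<kappa>"
  shows "(v1 - N * v * y * x1) / (x * y) \<le> - (\<kappa> * y * (1 + v\<^sup>2))"
proof -
  have absw: "\<bar>w\<bar> = \<bar>v\<bar> * x * y" using w x y by (simp add: abs_mult)
  have "(px - B * y) * w \<le> M * (x * y) * \<bar>w\<bar>"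
  proof -
    have "(px - B * y) * w \<le> \<bar>px - B * y\<bar> * \<bar>w\<bar>"
      using abs_ge_self[of "(px - B * y) * w"] by (simp add: abs_mult)
    also have "\<dots> \<le> M * (x * y) * \<bar>w\<bar>" using px by (intro mult_right_mono) auto
    finally show ?thesis .
  qed
  then have pw: "px * w \<le> B * y * w + M * (x * y) * \<bar>w\<bar>" by (simp add: algebra_simps)
  have "v1 \<le> a * (x * y\<^sup>2) + M * (x\<^sup>2 * y\<^sup>2) + (B * y * w + M * (x * y) * \<bar>w\<bar>) + K * w\<^sup>2"
    using v1 fx pw by linarith
  also have "\<dots> = x * y\<^sup>2 * (a + B * v + x * (M + M * \<bar>v\<bar> + K * v\<^sup>2))"
    unfolding absw unfolding w by (simp add: algebra_simps power2_eq_square)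
  finally have 1: "v1 \<le> x * y\<^sup>2 * (a + B * v + x * (M + M * \<bar>v\<bar> + K * v\<^sup>2))" .
  \<comment> \<open>The cone condition \<open>wx\<close> turns the relative error
    \<open>x + |w|\<close> of \<open>x1\<close> into a multiple of \<open>x\<close>.\<close>
  have "v * (w - x1) \<le> \<bar>v\<bar> * (K * \<bar>w\<bar> * ((1 + K1) * x))"
  proof -
    have "v * (w - x1) \<le> \<bar>v\<bar> * \<bar>x1 - w\<bar>"
      using abs_ge_self[of "v * (w - x1)"] by (simp add: abs_mult abs_minus_commute)
    also have "\<dots> \<le> \<bar>v\<bar> * (K * \<bar>w\<bar> * (x + \<bar>w\<bar>))"
      using x1 by (intro mult_left_mono) auto
    also have "\<dots> \<le> \<bar>v\<bar> * (K * \<bar>w\<bar> * ((1 + K1) * x))"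
      using wx nonneg by (intro mult_left_mono) (auto simp: algebra_simps)
    finally show ?thesis .
  qed
  then have "N * y * (v * (w - x1)) \<le> N * y * (\<bar>v\<bar> * (K * \<bar>w\<bar> * ((1 + K1) * x)))"
    using nonneg y by (intro mult_left_mono) auto
  also have "\<dots> = x * y\<^sup>2 * (x * (N * K * (1 + K1) * v\<^sup>2))"
    unfolding absw by (simp add: algebra_simps power2_eq_square)
  finally have 2: "N * y * (v * (w - x1)) \<le> x * y\<^sup>2 * (x * (N * K * (1 + K1) * v\<^sup>2))" .
  have 3: "N * y * (v * (w - x1)) = x * y\<^sup>2 * (N * v\<^sup>2) - N * v * y * x1"
    by (simp add: w algebra_simps power2_eq_square)
  have "v1 - N * v * y * x1 \<le> x * y\<^sup>2 * (a + B * v - N * v\<^sup>2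
      + x * (M + M * \<bar>v\<bar> + K * v\<^sup>2 + N * K * (1 + K1) * v\<^sup>2))"
    using 1 2 unfolding 3 by (simp add: algebra_simps)
  \<comment> \<open>Half of the margin \<open>2 \<kappa> (1 + v^2)\<close> in \<open>quad\<close>
    pays for all errors, which together are at most a small multiple of
    \<open>1 + v^2\<close>.\<close>
  also have "\<dots> \<le> x * y\<^sup>2 * (- (\<kappa> * (1 + v\<^sup>2)))"
  proof (rule mult_left_mono)
    have v: "\<bar>v\<bar> \<le> 1 + v\<^sup>2"
      using zero_le_power2[of "\<bar>v\<bar> - 1"] by (simp add: power2_diff)
    have K1: "0 \<le> K1" using wx x by (meson abs_ge_zero order_trans zero_le_mult_iff not_less)
    have "M + M * \<bar>v\<bar> + K * v\<^sup>2 + N * K * (1 + K1) * v\<^sup>2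
      \<le> M * (1 + v\<^sup>2) + M * (1 + v\<^sup>2) + K * (1 + v\<^sup>2) + N * K * (1 + K1) * (1 + v\<^sup>2)"
      using nonneg v K1 by (intro add_mono mult_left_mono) (auto simp: mult_le_cancel_left1)
    also have "\<dots> = (2 * M + K + N * K * (1 + K1)) * (1 + v\<^sup>2)" by (simp add: algebra_simps)
    finally have "x * (M + M * \<bar>v\<bar> + K * v\<^sup>2 + N * K * (1 + K1) * v\<^sup>2)
      \<le> x * ((2 * M + K + N * K * (1 + K1)) * (1 + v\<^sup>2))"
      using x by (intro mult_left_mono) auto
    also have "\<dots> = (2 * M + K + N * K * (1 + K1)) * x * (1 + v\<^sup>2)" by simp
    also have "\<dots> \<le> \<kappa> * (1 + v\<^sup>2)" using small by (intro mult_right_mono) auto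
    finally show "a + B * v - N * v\<^sup>2 + x * (M + M * \<bar>v\<bar> + K * v\<^sup>2 + N * K * (1 + K1) * v\<^sup>2)
      \<le> - (\<kappa> * (1 + v\<^sup>2))" using quad by (simp add: algebra_simps)
  qed (use x in auto)
  finally have "v1 - N * v * y * x1 \<le> - (\<kappa> * y * (1 + v\<^sup>2)) * (x * y)"
    by (simp add: algebra_simps power2_eq_square)
  then show ?thesis using x y by (simp add: pos_divide_le_eq)
qed

context nilpotent_field
begin

text \<open>With \<open>y = x^m\<close>, the bound \<open>v' <= - \<kappa> y (1 + v^2)\<close>
  drives \<open>v\<close> down. If \<open>v\<close> stays above \<open>- A\<close>, then
  \<open>x' / x >= - 2 A y\<close>, so the decrease of \<open>ln x\<close> is at most
  \<open>2 A / \<kappa>\<close> times that of \<open>arctan v\<close>, which is bounded. Once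
  \<open>v\<close> is below \<open>- A\<close> it stays there; then \<open>|w|\<close> changes at
  relative rate at most \<open>y |v| / 4\<close> while \<open>x\<close> decays at relative rate at
  least \<open>y |v| / 2\<close>, so \<open>|w|\<close> dominates a multiple of
  \<open>sqrt x\<close>, against the cone condition.\<close>

lemma no_right_orbit:
  fixes z :: "real \<Rightarrow> real \<times> real" and m :: nat
  assumes M: "M \<ge> 0"
    and f_exp: "\<And>x. 0 < x \<Longrightarrow> x \<le> \<rho> \<Longrightarrow> \<bar>f x - a * x ^ (2 * m + 1)\<bar> \<le> M * x ^ (2 * m + 2)"
    and \<Phi>_exp: "\<And>x. 0 < x \<Longrightarrow> x \<le> \<rho> \<Longrightarrow> \<bar>\<Phi> x - B * x ^ m\<bar> \<le> M * x ^ (m + 1)"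
    and disc: "B\<^sup>2 + 4 * a * real (m + 1) < 0"
    and ball: "\<And>t. t \<ge> t\<^sub>0 \<Longrightarrow> z t \<in> cball 0 \<rho>"
    and curve: "\<And>t. t \<ge> t\<^sub>0 \<Longrightarrow> (z has_vector_derivative X (z t)) (at t)"
    and pos: "\<And>t. t \<ge> t\<^sub>0 \<Longrightarrow> fst (z t) > 0"
    and cone: "\<And>t. t \<ge> t\<^sub>0 \<Longrightarrow> \<bar>W (z t)\<bar> \<le> K1 * fst (z t)"
    and lim: "(z \<longlongrightarrow> 0) at_top"
  shows False
proof -
  define N where "N = real (m + 1)"
  have N: "N \<ge> 1" by (simp add: N_def)
  obtain \<kappa> where \<kappa>: "\<kappa> > 0" and quad: "\<And>v. a + B * v - N * v\<^sup>2 \<le> - (2 * \<kappa> * (1 + v\<^sup>2))"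
    using negative_definite_quadratic[of N B a] disc N by (auto simp: N_def)
  define x where "x t = fst (z t)" for t
  define w where "w t = W (z t)" for t
  define x1 where "x1 t = fst (X (z t))" for t
  define v1 where "v1 t = V (z t)" for t
  define y where "y t = x t ^ m" for t
  define v where "v t = w t / (x t * y t)" for t
  have K1: "K1 \<ge> 0"
    using cone[of t\<^sub>0] pos[of t\<^sub>0] by (smt (verit) mult_neg_pos)
  have x0: "(x \<longlongrightarrow> 0) at_top"
    unfolding x_def using tendsto_fst[OF lim] by simp
  define C where "C = 2 * M + K + N * K * (1 + K1)"
  have C: "C > 0" unfolding C_def using M K N K1 by (intro add_nonneg_pos add_pos_nonneg mult_pos_pos) auto
  \<comment> \<open>The last bound gives \<open>8 K (x + |w|) <= 1\<close> in the cone. This serves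
    \<open>fst_X_near\<close> and also the bound \<open>K x <= 1/8\<close> in the estimate of
    \<open>v1\<close>.\<close>
  define \<epsilon> where "\<epsilon> = min (min 1 (\<kappa> / C)) (1 / (8 * K * (1 + K1)))"
  have \<epsilon>: "\<epsilon> > 0" unfolding \<epsilon>_def using \<kappa> C K K1 by (auto intro!: divide_pos_pos mult_pos_pos)
  have "\<forall>\<^sub>F t in at_top. x t < \<epsilon>"
    using x0 \<epsilon> by (rule order_tendstoD)
  then obtain t\<^sub>1 where t1: "t\<^sub>1 \<ge> t\<^sub>0" "\<And>t. t \<ge> t\<^sub>1 \<Longrightarrow> x t < \<epsilon>"
    unfolding eventually_at_top_linorder by (metis max.bounded_iff nle_le order_refl)
  have pos': "x t > 0" "y t > 0" if "t \<ge> t\<^sub>1" for t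
    using pos[of t] that t1 by (auto simp: x_def y_def)
  have small: "x t \<le> 1" "C * x t \<le> \<kappa>" "8 * K * (x t + \<bar>w t\<bar>) \<le> 1" if "t \<ge> t\<^sub>1" for t
  proof -
    have xe: "x t \<le> 1" "x t \<le> \<kappa> / C" "x t \<le> 1 / (8 * K * (1 + K1))"
      using t1(2)[OF that] by (auto simp: \<epsilon>_def)
    show "x t \<le> 1" by (rule xe)
    show "C * x t \<le> \<kappa>" using xe(2) C by (simp add: pos_le_divide_eq mult.commute)
    have "8 * K * (x t + \<bar>w t\<bar>) \<le> 8 * K * ((1 + K1) * x t)"
      using cone[of t] that t1 K by (intro mult_left_mono) (auto simp: x_def w_def algebra_simps)
    also have "\<dots> \<le> 1" using xe(3) K K1 by (simp add: pos_le_divide_eq mult_ac)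
    finally show "8 * K * (x t + \<bar>w t\<bar>) \<le> 1" .
  qed
  have w: "w t = v t * x t * y t" if "t \<ge> t\<^sub>1" for t
    using pos'[OF that] by (simp add: v_def)
  have xd: "(x has_real_derivative x1 t) (at t)" and wd: "(w has_real_derivative v1 t) (at t)"
    if "t \<ge> t\<^sub>1" for t
    using curve_derivs[of z 1 t UNIV] curve[of t] ball[of t] that t1
    unfolding x_def w_def x1_def v1_def by auto
  have x1_near: "\<bar>x1 t - w t\<bar> \<le> \<bar>w t\<bar> / 2" if "t \<ge> t\<^sub>1" for t
    using fst_X_near[of "z t"] ball[of t] small(3)[OF that] pos'[OF that] that t1 K
    by (auto simp: x1_def w_def x_def)
  define D where "D t = (v1 t - N * v t * y t * x1 t) / (x t * y t)" for t
  have vd: "(v has_real_derivative D t) (at t)" if "t \<ge> t\<^sub>1" for t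
  proof -
    have "((\<lambda>t. x t ^ (m + 1)) has_real_derivative N * y t * x1 t) (at t)"
      using DERIV_power[OF xd[OF that], of "m + 1"] by (simp add: N_def y_def mult_ac)
    then have "((\<lambda>t. x t * y t) has_real_derivative N * y t * x1 t) (at t)"
      by (simp add: y_def)
    then have "(v has_real_derivative (v1 t * (x t * y t) - w t * (N * y t * x1 t))
        / ((x t * y t) * (x t * y t))) (at t)"
      unfolding v_def using pos'[OF that] wd[OF that] by (intro DERIV_divide) auto
    also have "(v1 t * (x t * y t) - w t * (N * y t * x1 t)) / ((x t * y t) * (x t * y t)) = D t"
      using pos'[OF that] by (simp add: D_def w[OF that] field_simps)
    finally show ?thesis .
  qed
  have xr: "x t \<le> \<rho>" if "t \<ge> t\<^sub>1" for t
    using abs_fst_le[OF ball[of t]] that t1 by (simp add: x_def)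
  have f_exp': "\<bar>f (x t) - a * (x t * (y t)\<^sup>2)\<bar> \<le> M * ((x t)\<^sup>2 * (y t)\<^sup>2)"
    and \<Phi>_exp': "\<bar>\<Phi> (x t) - B * y t\<bar> \<le> M * (x t * y t)" if "t \<ge> t\<^sub>1" for t
  proof -
    have "x t ^ (2 * m) = y t * y t" by (simp add: y_def mult_2 power_add)
    note e = this y_def[symmetric] power_add power_one_right power2_eq_square
    show "\<bar>f (x t) - a * (x t * (y t)\<^sup>2)\<bar> \<le> M * ((x t)\<^sup>2 * (y t)\<^sup>2)"
      using f_exp[OF pos'(1)[OF that] xr[OF that]] unfolding e by (simp add: mult_ac)
    show "\<bar>\<Phi> (x t) - B * y t\<bar> \<le> M * (x t * y t)"
      using \<Phi>_exp[OF pos'(1)[OF that] xr[OF that]] unfolding e by (simp add: mult_ac)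
  qed
  have v1_near: "\<bar>v1 t - f (x t) - \<Phi> (x t) * w t\<bar> \<le> K * (w t)\<^sup>2" if "t \<ge> t\<^sub>1" for t
    using V_near[OF ball[of t]] that t1 by (simp add: v1_def x_def w_def)
  have Dle: "D t \<le> - (\<kappa> * y t * (1 + (v t)\<^sup>2))" if "t \<ge> t\<^sub>1" for t
    unfolding D_def
  proof (rule blowup_derivative_bound[OF w[OF that] pos'[OF that] _ _ M _ v1_near[OF that]
        f_exp'[OF that] \<Phi>_exp'[OF that] _ quad])
    show "\<bar>x1 t - w t\<bar> \<le> K * \<bar>w t\<bar> * (x t + \<bar>w t\<bar>)"
      using fst_field[OF ball[of t]] that t1 pos'[OF that] by (simp add: x1_def x_def w_def W_def)
    show "\<bar>w t\<bar> \<le> K1 * x t" using cone[of t] that t1 by (simp add: x_def w_def)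
  qed (use K N small[OF that] C_def in auto)
  \<comment> \<open>For \<open>|v| >= A\<close> the bounds for \<open>f\<close> and
    \<open>\<Phi> w\<close> add up to at most \<open>x y^2 v^2 / 8\<close>, and the quadratic error
    contributes another eighth. The summand 1 gives \<open>|v| >= 1\<close>, which lifts the bound
    for \<open>f\<close> to one with a factor \<open>|v|\<close>.\<close>
  define A where "A = 8 * (\<bar>a\<bar> + \<bar>B\<bar> + 2 * M) + 1"
  have A: "A \<ge> 1" unfolding A_def using M by auto
  show False
  proof (cases "\<forall>t\<ge>t\<^sub>1. v t \<ge> - A")
    case True
    define G where "G t = ln (x t) - 2 * A / \<kappa> * arctan (v t)" for t
    have G: "G t\<^sub>1 \<le> G t" if "t \<ge> t\<^sub>1" for t
    proof (rule DERIV_nonneg_imp_nondecreasing[OF that])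
      fix s assume s: "t\<^sub>1 \<le> s" "s \<le> t"
      note p = pos'[OF s(1)]
      have v2: "1 + (v s)\<^sup>2 > 0" by (simp add: add_pos_nonneg)
      have "(G has_real_derivative x1 s / x s - 2 * A / \<kappa> * (D s / (1 + (v s)\<^sup>2))) (at s)"
        using DERIV_diff[OF DERIV_chain2[OF DERIV_ln_divide[OF p(1)] xd[OF s(1)]]
            DERIV_cmult[OF DERIV_chain2[OF DERIV_arctan vd[OF s(1)]], of "2 * A / \<kappa>"]]
        unfolding G_def by (simp add: divide_inverse mult_ac)
      moreover have "- (2 * A * y s) \<le> x1 s / x s"
      proof -
        have "- (2 * A * y s * x s) \<le> x1 s"
        proof (cases "w s \<ge> 0")
          case True
          then have "x1 s \<ge> 0" using x1_near[OF s(1)] by linarith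
          moreover have "0 \<le> 2 * A * y s * x s" using A p by simp
          ultimately show ?thesis by linarith
        next
          case False
          have "2 * (v s * (x s * y s)) \<ge> 2 * (- A * (x s * y s))"
            using True s p by (intro mult_left_mono mult_right_mono) auto
          then have "2 * w s \<ge> - (2 * A * y s * x s)" unfolding w[OF s(1)] by (simp add: mult_ac)
          then show ?thesis using x1_near[OF s(1)] False by linarith
        qed
        then show ?thesis using p by (simp add: pos_le_divide_eq)
      qed
      moreover have "2 * A / \<kappa> * (D s / (1 + (v s)\<^sup>2)) \<le> - (2 * A * y s)"
      proof -
        have "D s / (1 + (v s)\<^sup>2) \<le> - (\<kappa> * y s)"
          using Dle[OF s(1)] v2 by (simp add: pos_divide_le_eq)
        then have "2 * A / \<kappa> * (D s / (1 + (v s)\<^sup>2)) \<le> 2 * A / \<kappa> * - (\<kappa> * y s)"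
          using A \<kappa> by (intro mult_left_mono) auto
        then show ?thesis using \<kappa> by simp
      qed
      ultimately show "\<exists>d. (G has_real_derivative d) (at s) \<and> d \<ge> 0"
        by (intro exI conjI) (assumption, linarith)
    qed
    have "G t\<^sub>1 - 2 * A / \<kappa> * (pi / 2) \<le> ln (x t)" if "t \<ge> t\<^sub>1" for t
    proof -
      have "2 * A / \<kappa> * arctan (v t) \<ge> 2 * A / \<kappa> * (- (pi / 2))"
        using arctan_lbound[of "v t"] A \<kappa> by (intro mult_left_mono) auto
      with G[OF that] show ?thesis by (simp add: G_def)
    qed
    then show False
      using ln_bounded_below_contradiction[OF x0, of t\<^sub>1] pos' by blast
  next
    case False
    then obtain t\<^sub>2 where t2: "t\<^sub>2 \<ge> t\<^sub>1" "v t\<^sub>2 < - A" by auto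
    have "v t \<le> v t\<^sub>2" if "t \<ge> t\<^sub>2" for t
    proof (rule DERIV_nonpos_imp_nonincreasing[OF that])
      fix s assume "t\<^sub>2 \<le> s"
      then have s: "s \<ge> t\<^sub>1" using t2 by simp
      have "D s \<le> - (\<kappa> * y s * (1 + (v s)\<^sup>2))" by (rule Dle[OF s])
      also have "\<dots> \<le> 0" using \<kappa> pos'[OF s] by (simp add: mult_nonneg_nonneg)
      finally show "\<exists>d. (v has_real_derivative d) (at s) \<and> d \<le> 0" using vd[OF s] by blast
    qed
    then have vA: "v t < - A" if "t \<ge> t\<^sub>2" for t using that t2 by force
    have wneg: "w t < 0" if "t \<ge> t\<^sub>2" for t
      using w[of t] vA[OF that] pos'[of t] that t2 A by (simp add: mult_neg_pos)
    define G where "G t = ln (- w t) - 1 / 2 * ln (x t)" for t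
    have G: "G t\<^sub>2 \<le> G t" if "t \<ge> t\<^sub>2" for t
    proof (rule DERIV_nonneg_imp_nondecreasing[OF that])
      fix s assume "t\<^sub>2 \<le> s"
      then have s: "s \<ge> t\<^sub>1" and s2: "s \<ge> t\<^sub>2" using t2 by auto
      note p = pos'[OF s] and wn = wneg[OF s2]
      have "(G has_real_derivative v1 s / w s - x1 s / (2 * x s)) (at s)"
        using DERIV_diff[OF DERIV_chain2[OF DERIV_ln_divide DERIV_minus[OF wd[OF s]]]
            DERIV_cmult[OF DERIV_chain2[OF DERIV_ln_divide[OF p(1)] xd[OF s]], of "1 / 2"]] wn
        unfolding G_def by simp
      moreover have "\<bar>v1 s\<bar> / \<bar>w s\<bar> \<le> y s * \<bar>v s\<bar> / 4"
      proof -
        define u where "u = \<bar>v s\<bar>"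
        have u: "u \<ge> 1" "8 * (\<bar>a\<bar> + \<bar>B\<bar> + 2 * M) \<le> u" "u > 0"
          using vA[OF s2] A by (auto simp: u_def A_def)
        have aw: "\<bar>w s\<bar> = u * x s * y s" using w[OF s] p by (simp add: abs_mult u_def)
        have "\<bar>f (x s)\<bar> \<le> (\<bar>a\<bar> + M) * (x s * (y s)\<^sup>2) * 1"
        proof -
          have "\<bar>f (x s)\<bar> \<le> \<bar>a * (x s * (y s)\<^sup>2)\<bar> + M * ((x s)\<^sup>2 * (y s)\<^sup>2)"
            using f_exp'[OF s] by linarith
          also have "\<dots> = \<bar>a\<bar> * (x s * (y s)\<^sup>2) + M * (x s * (x s * (y s)\<^sup>2))"
            using p by (simp add: abs_mult power2_eq_square)
          also have "M * (x s * (x s * (y s)\<^sup>2)) \<le> M * (1 * (x s * (y s)\<^sup>2))"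
            using M small(1)[OF s] p by (intro mult_left_mono mult_right_mono) auto
          finally show ?thesis by (simp add: algebra_simps)
        qed
        also have "(\<bar>a\<bar> + M) * (x s * (y s)\<^sup>2) * 1 \<le> (\<bar>a\<bar> + M) * (x s * (y s)\<^sup>2) * u"
          using u M p by (intro mult_left_mono) auto
        finally have 1: "\<bar>f (x s)\<bar> \<le> (\<bar>a\<bar> + M) * (x s * (y s)\<^sup>2) * u" .
        have "\<bar>\<Phi> (x s)\<bar> \<le> (\<bar>B\<bar> + M) * y s"
        proof -
          have "\<bar>\<Phi> (x s)\<bar> \<le> \<bar>B * y s\<bar> + M * (x s * y s)"
            using \<Phi>_exp'[OF s] by linarith
          also have "M * (x s * y s) \<le> M * (1 * y s)"
            using M small(1)[OF s] p by (intro mult_left_mono mult_right_mono) auto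
          finally show ?thesis using p by (simp add: abs_mult algebra_simps)
        qed
        then have "\<bar>\<Phi> (x s)\<bar> * \<bar>w s\<bar> \<le> (\<bar>B\<bar> + M) * y s * \<bar>w s\<bar>"
          by (intro mult_right_mono) auto
        also have "\<dots> = (\<bar>B\<bar> + M) * (x s * (y s)\<^sup>2) * u"
          by (simp add: aw power2_eq_square mult_ac)
        finally have 2: "\<bar>\<Phi> (x s) * w s\<bar> \<le> (\<bar>B\<bar> + M) * (x s * (y s)\<^sup>2) * u" by (simp add: abs_mult)
        have "8 * K * x s \<le> 8 * K * (x s + \<bar>w s\<bar>)" using K by (intro mult_left_mono) auto
        then have Kx: "K * x s \<le> 1 / 8" using small(3)[OF s] by simp
        have "K * (w s)\<^sup>2 = K * x s * (x s * (y s)\<^sup>2 * u\<^sup>2)"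
          using aw power2_abs[of "w s"] by (simp add: power2_eq_square mult_ac)
        also have "\<dots> \<le> 1 / 8 * (x s * (y s)\<^sup>2 * u\<^sup>2)"
          using Kx p by (intro mult_right_mono) auto
        finally have 3: "K * (w s)\<^sup>2 \<le> 1 / 8 * (x s * (y s)\<^sup>2 * u\<^sup>2)" .
        have "(x s * (y s)\<^sup>2 * u) * (8 * (\<bar>a\<bar> + \<bar>B\<bar> + 2 * M)) \<le> (x s * (y s)\<^sup>2 * u) * u"
          using u p by (intro mult_left_mono) auto
        then have "(\<bar>a\<bar> + M) * (x s * (y s)\<^sup>2) * u + (\<bar>B\<bar> + M) * (x s * (y s)\<^sup>2) * u
            \<le> 1 / 8 * (x s * (y s)\<^sup>2 * u\<^sup>2)"
          by (simp add: algebra_simps power2_eq_square)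
        then have "\<bar>v1 s\<bar> \<le> 1 / 4 * (x s * (y s)\<^sup>2 * u\<^sup>2)"
          using 1 2 3 v1_near[OF s] by linarith
        also have "\<dots> = y s * u / 4 * \<bar>w s\<bar>" by (simp add: aw power2_eq_square mult_ac)
        finally have "\<bar>v1 s\<bar> \<le> y s * \<bar>v s\<bar> / 4 * \<bar>w s\<bar>" by (simp only: u_def)
        then show ?thesis
          by (intro iffD2[OF pos_divide_le_eq]) (use wn in auto)
      qed
      moreover have "y s * \<bar>v s\<bar> / 4 \<le> - (x1 s / (2 * x s))"
      proof -
        have "x1 s \<le> w s / 2" using x1_near[OF s] wn by linarith
        then have "- x1 s / (2 * x s) \<ge> - (w s / 2) / (2 * x s)"
          using p by (intro divide_right_mono) auto
        moreover have "- (w s / 2) / (2 * x s) = y s * \<bar>v s\<bar> / 4"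
          using p vA[OF s2] A by (simp add: w[OF s])
        ultimately show ?thesis by simp
      qed
      ultimately show "\<exists>d. (G has_real_derivative d) (at s) \<and> d \<ge> 0"
        using abs_ge_minus_self[of "v1 s / w s", unfolded abs_divide]
        by (intro exI conjI) (assumption, linarith)
    qed
    have "2 * (G t\<^sub>2 - ln K1) \<le> ln (x t)" if "t \<ge> t\<^sub>2" for t
    proof -
      have p: "x t > 0" using pos'(1)[of t] that t2 by simp
      have c: "- w t \<le> K1 * x t" using cone[of t] that t2 t1 by (simp add: w_def x_def)
      with wneg[OF that] p have "K1 > 0" by (smt (verit) mult_nonpos_nonneg)
      with c p wneg[OF that] have "ln (- w t) \<le> ln K1 + ln (x t)"
        by (subst ln_mult_pos[symmetric]) auto
      with G[OF that] show ?thesis by (simp add: G_def)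
    qed
    then show False
      using ln_bounded_below_contradiction[OF x0, of t\<^sub>2] pos' t2 by force
  qed
qed

end

context nilpotent_field
begin

text \<open>For \<open>|x| <= w\<close> both \<open>f\<close> and \<open>\<Phi> w\<close> are
  \<open>O(w^2)\<close>, so \<open>w' / w >= - 3 K w\<close>, while \<open>x' >= w / 2\<close>.
  Hence \<open>ln w + 6 K x\<close> is nondecreasing, and the boundedness of \<open>x\<close> keeps
  \<open>ln w\<close> from tending to minus infinity.\<close>

lemma no_upward_orbit:
  fixes z :: "real \<Rightarrow> real \<times> real"
  assumes ev: "\<forall>\<^sub>F t in at_top. z t \<in> cball 0 \<rho> \<and> (z has_vector_derivative X (z t)) (at t) \<and>
      \<bar>fst (z t)\<bar> \<le> W (z t) \<and> 0 < W (z t)"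
    and lim: "(z \<longlongrightarrow> 0) at_top"
  shows False
proof -
  define x where "x t = fst (z t)" for t
  define w where "w t = W (z t)" for t
  have x0: "(x \<longlongrightarrow> 0) at_top" and y0: "((\<lambda>t. snd (z t)) \<longlongrightarrow> 0) at_top"
    unfolding x_def using tendsto_fst[OF lim] tendsto_snd[OF lim] by simp_all
  have "isCont F 0" using F_deriv[of 0] \<rho> by (auto intro: DERIV_isCont)
  then have "((\<lambda>t. F (x t)) \<longlongrightarrow> F 0) at_top" using x0 by (rule isCont_tendsto_compose)
  from tendsto_diff[OF y0 this] have w0: "(w \<longlongrightarrow> 0) at_top"
    by (simp add: w_def[abs_def] W_def x_def F0)
  have "\<forall>\<^sub>F t in at_top. w t < 1 / (4 * K)"
    using w0 K by (intro order_tendstoD(2)) auto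
  with ev have "\<forall>\<^sub>F t in at_top. z t \<in> cball 0 \<rho> \<and> (z has_vector_derivative X (z t)) (at t) \<and>
      \<bar>x t\<bar> \<le> w t \<and> 0 < w t \<and> w t < 1 / (4 * K)"
    by eventually_elim (auto simp: x_def w_def)
  then obtain t\<^sub>0 where t0: "z t \<in> cball 0 \<rho>" "(z has_vector_derivative X (z t)) (at t)"
      "\<bar>x t\<bar> \<le> w t" "0 < w t" "w t < 1 / (4 * K)" if "t \<ge> t\<^sub>0" for t
    unfolding eventually_at_top_linorder by metis
  define G where "G t = ln (w t) + 6 * K * x t" for t
  have G: "G t\<^sub>0 \<le> G t" if "t \<ge> t\<^sub>0" for t
  proof (rule DERIV_nonneg_imp_nondecreasing[OF that])
    fix s assume s: "t\<^sub>0 \<le> s"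
    note b = t0[OF s]
    have xd: "(x has_real_derivative fst (X (z s))) (at s)" and wd: "(w has_real_derivative V (z s)) (at s)"
      using curve_derivs[of z 1 s UNIV] b unfolding x_def w_def by auto
    have "(G has_real_derivative V (z s) / w s + 6 * K * fst (X (z s))) (at s)"
      using DERIV_add[OF DERIV_chain2[OF DERIV_ln_divide[OF b(4)] wd] DERIV_cmult[OF xd, of "6 * K"]]
      unfolding G_def by simp
    moreover have "w s / 2 \<le> fst (X (z s))"
    proof -
      have "2 * K * (\<bar>x s\<bar> + \<bar>w s\<bar>) \<le> 2 * K * (2 * w s)"
        using b K by (intro mult_left_mono) auto
      also have "\<dots> \<le> 1" using b K by (simp add: pos_less_divide_eq mult_ac)
      finally have "\<bar>fst (X (z s)) - w s\<bar> \<le> \<bar>w s\<bar> / 2"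
        unfolding x_def w_def by (rule fst_X_near[OF b(1)])
      with b show ?thesis by linarith
    qed
    then have "6 * K * (w s / 2) \<le> 6 * K * fst (X (z s))" using K by (intro mult_left_mono) auto
    moreover have "- (3 * K * w s) \<le> V (z s) / w s"
    proof -
      have xr: "\<bar>x s\<bar> \<le> \<rho>" using abs_fst_le[OF b(1)] by (simp add: x_def)
      have "\<bar>f (x s)\<bar> \<le> K * (w s)\<^sup>2"
        using f_bound[OF xr] b K power2_le_iff_abs_le[of "w s" "x s"]
        by (smt (verit) mult_left_mono)
      moreover have "\<bar>\<Phi> (x s) * w s\<bar> \<le> K * (w s)\<^sup>2"
      proof -
        have "\<bar>\<Phi> (x s)\<bar> \<le> K * w s"
          using \<Phi>_bound[OF xr] b K by (smt (verit) mult_left_mono)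
        then have "\<bar>\<Phi> (x s)\<bar> * w s \<le> K * w s * w s" using b by (intro mult_right_mono) auto
        then show ?thesis using b by (simp add: abs_mult power2_eq_square mult.assoc)
      qed
      moreover have "\<bar>V (z s) - f (x s) - \<Phi> (x s) * w s\<bar> \<le> K * (w s)\<^sup>2"
        using V_near[OF b(1)] by (simp add: x_def w_def)
      ultimately have "- (3 * K * w s) * w s \<le> V (z s)"
        by (simp add: power2_eq_square)
      then show ?thesis using b by (simp add: pos_le_divide_eq)
    qed
    ultimately show "\<exists>d. (G has_real_derivative d) (at s) \<and> d \<ge> 0"
      by (intro exI conjI) (assumption, simp)
  qed
  have "G t\<^sub>0 - 6 * K * (1 / (4 * K)) \<le> ln (w t)" if "t \<ge> t\<^sub>0" for t
  proof -
    have "6 * K * x t \<le> 6 * K * (1 / (4 * K))"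
      using t0[OF that] K by (intro mult_left_mono) auto
    with G[OF that] show ?thesis by (simp add: G_def)
  qed
  then show False
    using ln_bounded_below_contradiction[OF w0, of t\<^sub>0] t0 by blast
qed

end

text \<open>\<open>c\<close> carries the direction of time, which the reflection multiplies by
  \<open>s * \<sigma>\<close>.\<close>

lemma curve_flip:
  assumes "(z has_vector_derivative c *\<^sub>R X (z t)) (at t within S)" and s: "\<bar>s\<bar> = 1" "\<bar>\<sigma>\<bar> = 1"
  shows "((\<lambda>t. flip s \<sigma> (z t)) has_vector_derivative
    (c * (s * \<sigma>)) *\<^sub>R flip_field s \<sigma> X (flip s \<sigma> (z t))) (at t within S)"
proof -
  have "(s * \<sigma>) * (s * \<sigma>) = 1"
    using s by (auto dest!: abs_eq_1_cases)
  then have e: "c * (s * \<sigma>) * (s * \<sigma>) = c" by (simp add: mult.assoc)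
  have "bounded_linear (flip s \<sigma>)"
    using linear_flip by (rule linear_conv_bounded_linear[THEN iffD1])
  from bounded_linear.has_vector_derivative[OF this assms(1)]
  show ?thesis
    unfolding flip_field_def scaleR_scaleR e
    by (simp add: flip_flip s linear_cmul[OF linear_flip])
qed

lemma continuous_flip: "continuous (at p within S) (flip s \<sigma>)"
  using linear_flip by (simp add: linear_continuous_within linear_conv_bounded_linear)

lemma tends_with_tangent_flip:
  assumes "tends_with_tangent z 0 T" and s: "\<bar>s\<bar> = 1" "\<bar>\<sigma>\<bar> = 1"
  shows "tends_with_tangent (\<lambda>t. flip s \<sigma> (z t)) 0 T"
proof -
  have sgn: "sgn (flip s \<sigma> p) = flip s \<sigma> (sgn p)" for p
    by (simp add: sgn_div_norm norm_flip s linear_cmul[OF linear_flip])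
  have iso: "isCont (flip s \<sigma>) p" for p
    by (rule continuous_flip)
  have nz: "flip s \<sigma> p = 0 \<longleftrightarrow> p = 0" for p
    using norm_flip[OF s, of p] by (metis norm_eq_zero)
  have f0: "flip s \<sigma> 0 = 0" by (simp add: nz)
  from assms(1) obtain d where "\<forall>\<^sub>F t in T. z t \<noteq> 0" "(z \<longlongrightarrow> 0) T" "((\<lambda>t. sgn (z t)) \<longlongrightarrow> d) T"
    by (auto simp: tends_with_tangent_def)
  with isCont_tendsto_compose[OF iso, of z 0 T] isCont_tendsto_compose[OF iso, of "\<lambda>t. sgn (z t)" d T]
  show ?thesis
    unfolding tends_with_tangent_def
    by (intro conjI exI[of _ "flip s \<sigma> d"]) (simp_all add: nz f0 sgn)
qed

context nilpotent_field
begin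

text \<open>The limit direction decides which exclusion applies: a positive first component confines
  the orbit to a cone around the positive \<open>x\<close>-axis, the upward vertical direction to
  \<open>|x| <= w\<close>.\<close>

lemma no_orbit_half_plane:
  fixes z :: "real \<Rightarrow> real \<times> real" and m :: nat
  assumes M: "M \<ge> 0"
    and f_exp: "\<And>x. 0 < x \<Longrightarrow> x \<le> \<rho> \<Longrightarrow> \<bar>f x - a * x ^ (2 * m + 1)\<bar> \<le> M * x ^ (2 * m + 2)"
    and \<Phi>_exp: "\<And>x. 0 < x \<Longrightarrow> x \<le> \<rho> \<Longrightarrow> \<bar>\<Phi> x - B * x ^ m\<bar> \<le> M * x ^ (m + 1)"
    and disc: "B\<^sup>2 + 4 * a * real (m + 1) < 0"
    and ev: "\<forall>\<^sub>F t in at_top. z t \<in> cball 0 \<rho> \<and> (z has_vector_derivative X (z t)) (at t)"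
    and lim: "(z \<longlongrightarrow> 0) at_top" and dir: "((\<lambda>t. sgn (z t)) \<longlongrightarrow> d) at_top"
    and d: "fst d > 0 \<or> fst d = 0 \<and> snd d > 0"
  shows False
proof (cases "fst d > 0")
  case True
  have "\<forall>\<^sub>F t in at_top. fst d / 2 < fst (sgn (z t))"
    using tendsto_fst[OF dir] True by (intro order_tendstoD(1)) auto
  with ev have "\<forall>\<^sub>F t in at_top. z t \<in> cball 0 \<rho> \<and> (z has_vector_derivative X (z t)) (at t) \<and>
      0 < fst (z t) \<and> \<bar>W (z t)\<bar> \<le> (2 / fst d + K * \<rho>) * fst (z t)"
  proof eventually_elim
    case (elim t)
    define p where "p = z t"
    have pz: "p \<noteq> 0" using elim True by (auto simp: p_def)
    have "fst (sgn p) = fst p / norm p" by (simp add: sgn_div_norm divide_inverse mult.commute)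
    moreover have "fst d / 2 < fst (sgn p)" using elim unfolding p_def by blast
    ultimately have 1: "fst d / 2 * norm p < fst p"
      using pz pos_less_divide_eq[of "norm p" "fst d / 2" "fst p"] by simp
    moreover have "fst d / 2 * norm p > 0" using pz True by simp
    ultimately have pos: "fst p > 0" by linarith
    have n: "norm p \<le> 2 / fst d * fst p" using 1 True by (simp add: field_simps)
    have "\<bar>snd p\<bar> \<le> norm p" using norm_snd_le[of "snd p" "fst p"] by simp
    moreover have "\<bar>F (fst p)\<bar> \<le> K * \<rho> * fst p"
    proof -
      have r: "\<bar>fst p\<bar> \<le> \<rho>" using abs_fst_le elim by (simp add: p_def)
      have "\<bar>F (fst p)\<bar> \<le> K * (fst p * fst p)" using F_bound[OF r] by (simp add: power2_eq_square)
      also have "\<dots> \<le> K * (\<rho> * fst p)" using K r pos by (intro mult_left_mono mult_right_mono) auto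
      finally show ?thesis by simp
    qed
    ultimately have "\<bar>W p\<bar> \<le> (2 / fst d + K * \<rho>) * fst p"
      using n unfolding W_def distrib_right by linarith
    with elim pos show ?case by (simp add: p_def)
  qed
  then obtain t\<^sub>0 where "\<forall>t\<ge>t\<^sub>0. z t \<in> cball 0 \<rho> \<and> (z has_vector_derivative X (z t)) (at t) \<and>
      0 < fst (z t) \<and> \<bar>W (z t)\<bar> \<le> (2 / fst d + K * \<rho>) * fst (z t)"
    unfolding eventually_at_top_linorder by blast
  then show False
    by (intro no_right_orbit[OF M f_exp \<Phi>_exp disc _ _ _ _ lim, of t\<^sub>0]) auto
next
  case False
  with d have d: "fst d = 0" "snd d > 0" by auto
  \<comment> \<open>The thresholds 1/4 and 1/2 yield \<open>2 |x| < y\<close>. Together with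
    \<open>|F x| <= |x|\<close>, a consequence of \<open>K |x| < 1\<close>, this gives
    \<open>|x| < w\<close>.\<close>
  have e1: "\<forall>\<^sub>F t in at_top. \<bar>fst (sgn (z t))\<bar> < snd d / 4"
    using tendsto_rabs[OF tendsto_fst[OF dir]] d by (intro order_tendstoD(2)) auto
  have e2: "\<forall>\<^sub>F t in at_top. snd d / 2 < snd (sgn (z t))"
    using tendsto_snd[OF dir] d by (intro order_tendstoD(1)) auto
  have e3: "\<forall>\<^sub>F t in at_top. \<bar>fst (z t)\<bar> < 1 / K"
    using tendsto_rabs[OF tendsto_fst[OF lim]] K by (intro order_tendstoD(2)) auto
  show False
  proof (rule no_upward_orbit[OF _ lim])
    show "\<forall>\<^sub>F t in at_top. z t \<in> cball 0 \<rho> \<and> (z has_vector_derivative X (z t)) (at t) \<and>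
      \<bar>fst (z t)\<bar> \<le> W (z t) \<and> 0 < W (z t)"
      using ev e1 e2 e3
    proof eventually_elim
      case (elim t)
      define p where "p = z t"
      have pz: "p \<noteq> 0" using elim d by (auto simp: p_def)
      have "fst (sgn p) = fst p / norm p" "snd (sgn p) = snd p / norm p"
        by (simp_all add: sgn_div_norm divide_inverse mult.commute)
      moreover have "\<bar>fst (sgn p)\<bar> < snd d / 4" "snd d / 2 < snd (sgn p)"
        using elim unfolding p_def by blast+
      ultimately have "\<bar>fst p\<bar> / norm p < snd d / 4" "snd d / 2 < snd p / norm p"
        by simp_all
      then have 1: "\<bar>fst p\<bar> < snd d / 4 * norm p" "snd d / 2 * norm p < snd p"
        using pz pos_less_divide_eq[of "norm p" "snd d / 2" "snd p"]
          pos_divide_less_eq[of "norm p" "\<bar>fst p\<bar>" "snd d / 4"] by simp_all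
      have r: "\<bar>fst p\<bar> \<le> \<rho>" using abs_fst_le elim by (simp add: p_def)
      have "\<bar>F (fst p)\<bar> \<le> K * (\<bar>fst p\<bar> * \<bar>fst p\<bar>)" using F_bound[OF r] by (simp add: power2_eq_square)
      also have "\<dots> \<le> K * (1 / K * \<bar>fst p\<bar>)"
        using K elim by (intro mult_left_mono mult_right_mono) (auto simp: p_def)
      finally have "\<bar>F (fst p)\<bar> \<le> \<bar>fst p\<bar>" using K by simp
      then have "\<bar>fst p\<bar> < W p" using 1 unfolding W_def by linarith
      with elim show ?case by (auto simp: p_def)
    qed
  qed
qed

text \<open>A limit of unit vectors is a unit vector, so it lies in one of two half-planes, and the
  rotation by pi exchanges them. That rotation keeps the direction of time and turns
  \<open>B\<close> into \<open>(-1)^m B\<close>, which does not affect the discriminant.\<close>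

lemma no_tangent_orbit:
  fixes z :: "real \<Rightarrow> real \<times> real" and m :: nat
  assumes M: "M \<ge> 0"
    and f_exp: "\<And>x. \<bar>x\<bar> \<le> \<rho> \<Longrightarrow> \<bar>f x - a * x ^ (2 * m + 1)\<bar> \<le> M * \<bar>x\<bar> ^ (2 * m + 2)"
    and \<Phi>_exp: "\<And>x. \<bar>x\<bar> \<le> \<rho> \<Longrightarrow> \<bar>\<Phi> x - B * x ^ m\<bar> \<le> M * \<bar>x\<bar> ^ (m + 1)"
    and disc: "B\<^sup>2 + 4 * a * real (m + 1) < 0"
    and ev: "\<forall>\<^sub>F t in at_top. z t \<in> cball 0 \<rho> \<and> (z has_vector_derivative X (z t)) (at t)"
    and tan: "tends_with_tangent z 0 at_top"
  shows False
proof -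
  from tan obtain d where nz: "\<forall>\<^sub>F t in at_top. z t \<noteq> 0" and lim: "(z \<longlongrightarrow> 0) at_top"
    and dir: "((\<lambda>t. sgn (z t)) \<longlongrightarrow> d) at_top"
    by (auto simp: tends_with_tangent_def)
  have "((\<lambda>t. norm (sgn (z t))) \<longlongrightarrow> norm d) at_top" using dir by (rule tendsto_norm)
  moreover have "((\<lambda>t. norm (sgn (z t))) \<longlongrightarrow> 1) at_top"
    by (rule tendsto_eventually) (use nz in \<open>auto elim!: eventually_mono simp: norm_sgn\<close>)
  ultimately have "norm d = 1" by (rule tendsto_unique[rotated]) simp
  then have "d \<noteq> 0" by auto
  show False
  proof (cases "fst d > 0 \<or> fst d = 0 \<and> snd d > 0")
    case True
    show False
    proof (rule no_orbit_half_plane[OF M _ _ disc ev lim dir True])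
      fix x :: real assume "0 < x" "x \<le> \<rho>"
      with f_exp[of x] \<Phi>_exp[of x]
      show "\<bar>f x - a * x ^ (2 * m + 1)\<bar> \<le> M * x ^ (2 * m + 2)"
        "\<bar>\<Phi> x - B * x ^ m\<bar> \<le> M * x ^ (m + 1)" by simp_all
    qed
  next
    case False
    with \<open>d \<noteq> 0\<close> have "fst d < 0 \<or> fst d = 0 \<and> snd d < 0"
      by (auto simp: prod_eq_iff)
    then have True: "fst (flip (-1) (-1) d) > 0 \<or> fst (flip (-1) (-1) d) = 0 \<and> snd (flip (-1) (-1) d) > 0"
      by (auto simp: flip_def)
    interpret fl: nilpotent_field "flip_field (-1) (-1) X" "\<lambda>x. - 1 * F (- 1 * x)"
      "\<lambda>x. - 1 * - 1 * F' (- 1 * x)" "\<lambda>x. - 1 * f (- 1 * x)" "\<lambda>x. - 1 * - 1 * \<Phi> (- 1 * x)" \<rho> K L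
      by (rule flip) auto
    have sgn: "sgn (flip (-1) (-1) p) = flip (-1) (-1) (sgn p)" for p
      by (simp add: sgn_div_norm norm_flip linear_cmul[OF linear_flip])
    show False
    proof (rule fl.no_orbit_half_plane[OF M, where m = m and a = a and B = "(-1) ^ m * B"
          and z = "\<lambda>t. flip (-1) (-1) (z t)"])
      show "((-1) ^ m * B)\<^sup>2 + 4 * a * real (m + 1) < 0" using disc by (simp add: power_mult_distrib flip: power_mult)
      show "\<forall>\<^sub>F t in at_top. flip (-1) (-1) (z t) \<in> cball 0 \<rho> \<and>
          ((\<lambda>t. flip (-1) (-1) (z t)) has_vector_derivative
            flip_field (-1) (-1) X (flip (-1) (-1) (z t))) (at t)"
        using ev
      proof eventually_elim
        case (elim t)
        with curve_flip[of z 1 X t UNIV "-1" "-1"] show ?case by (simp add: norm_flip)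
      qed
      show "((\<lambda>t. flip (-1) (-1) (z t)) \<longlongrightarrow> 0) at_top"
        using isCont_tendsto_compose[OF continuous_flip lim, of "-1" "-1"]
        by (simp add: linear_0[OF linear_flip])
      show "((\<lambda>t. sgn (flip (-1) (-1) (z t))) \<longlongrightarrow> flip (-1) (-1) d) at_top"
        using isCont_tendsto_compose[OF continuous_flip dir, of "-1" "-1"] by (simp add: sgn)
      fix x :: real assume x: "0 < x" "x \<le> \<rho>"
      show "\<bar>- 1 * f (- 1 * x) - a * x ^ (2 * m + 1)\<bar> \<le> M * x ^ (2 * m + 2)"
        using f_exp[of "- x"] x by (simp add: abs_minus_commute)
      show "\<bar>- 1 * - 1 * \<Phi> (- 1 * x) - (-1) ^ m * B * x ^ m\<bar> \<le> M * x ^ (m + 1)"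
        using \<Phi>_exp[of "- x"] x by (simp add: power_minus[of x] mult_ac)
    qed (rule True)
  qed
qed

end

section \<open>Orbits trapped in a wedge\<close>

lemma first_exit:
  fixes z :: "real \<Rightarrow> 'a::topological_space"
  assumes c: "continuous_on {0..} z" and S: "open S" "z 0 \<in> S" and t: "0 \<le> t" "z t \<notin> S"
  obtains T where "0 < T" "z T \<notin> S" "\<And>s. 0 \<le> s \<Longrightarrow> s < T \<Longrightarrow> z s \<in> S"
proof -
  define A where "A = {0..t} \<inter> z -` (- S)"
  have "closed A" unfolding A_def
    using S by (intro continuous_closed_preimage continuous_on_subset[OF c]) auto
  then have "compact A" unfolding A_def by (simp add: compact_eq_bounded_closed bounded_Int)
  moreover have "A \<noteq> {}" using t by (auto simp: A_def)
  ultimately obtain T where T: "T \<in> A" "\<And>s. s \<in> A \<Longrightarrow> T \<le> s"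
    by (metis compact_attains_inf)
  show ?thesis
  proof (rule that[of T])
    show "0 < T" using T(1) S(2) by (cases "T = 0") (auto simp: A_def)
    show "z T \<notin> S" using T(1) by (simp add: A_def)
    fix s assume "0 \<le> s" "s < T"
    then show "z s \<in> S" using T(1) T(2)[of s] by (auto simp: A_def)
  qed
qed

lemma le_at_right_endpoint:
  fixes f g :: "real \<Rightarrow> real"
  assumes "0 < T" "continuous (at T within {0..T}) f" "continuous (at T within {0..T}) g"
    "\<And>t. 0 \<le> t \<Longrightarrow> t < T \<Longrightarrow> f t \<le> g t"
  shows "f T \<le> g T"
proof (rule tendsto_le)
  have "T islimpt {0..<T}" using assms(1) by (simp add: islimpt_Ico)
  then show "at T within {0..<T} \<noteq> bot" by (simp add: trivial_limit_within)
  show "(f \<longlongrightarrow> f T) (at T within {0..<T})" "(g \<longlongrightarrow> g T) (at T within {0..<T})"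
    by (rule tendsto_within_subset[OF assms(2)[unfolded continuous_within]]
        tendsto_within_subset[OF assms(3)[unfolded continuous_within]]; force)+
  show "\<forall>\<^sub>F t in at T within {0..<T}. f t \<le> g t"
    using assms(4) by (auto simp: eventually_at_filter)
qed

text \<open>Later \<open>k\<close> is the order of \<open>f\<close>, so that \<open>f\<close> is the
  dominating term on the lower edge. In \<open>\<delta>_small\<close> the first part puts the wedge
  into the ball, because \<open>|y| <= w + |F x| <= \<delta> + K \<delta>^2\<close>; the second
  makes \<open>fst_X_near\<close> applicable.\<close>

locale wedge = nilpotent_field +
  fixes \<delta> :: real and k :: nat and u u' :: "real \<Rightarrow> real"
  assumes \<delta>: "0 < \<delta>" and k: "k \<ge> 1"
    and u_deriv: "0 < x \<Longrightarrow> x \<le> \<delta> \<Longrightarrow> (u has_real_derivative u' x) (at x)"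
    and lower_less_u: "0 < x \<Longrightarrow> x \<le> \<delta> \<Longrightarrow> x ^ k < u x"
    and u_le: "0 < x \<Longrightarrow> x \<le> \<delta> \<Longrightarrow> u x \<le> x"
    and u_tangent: "((\<lambda>x. u x / x) \<longlongrightarrow> 0) (at_right 0)"
    and \<delta>_small: "\<delta> * (2 + K * \<delta>) \<le> \<rho>" "4 * K * \<delta> \<le> 1"
begin

definition in_wedge :: "real \<times> real \<Rightarrow> bool" where
  "in_wedge p \<longleftrightarrow> 0 < fst p \<and> fst p \<le> \<delta> \<and> fst p ^ k \<le> W p \<and> W p \<le> u (fst p)"

definition inside_wedge :: "real \<times> real \<Rightarrow> bool" where
  "inside_wedge p \<longleftrightarrow> 0 < fst p \<and> fst p < \<delta> \<and> fst p ^ k < W p \<and> W p < u (fst p)"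

text \<open>The projection onto the ball is nonexpansive, so this field is Lipschitz on the whole
  plane. It agrees with \<open>X\<close> on the ball, hence its solutions are orbits of
  \<open>X\<close> as long as they stay in the wedge.\<close>

definition trunc :: "real \<times> real \<Rightarrow> real \<times> real" where
  "trunc p = X (closest_point (cball 0 \<rho>) p)"

lemma inside_imp_in: "inside_wedge p \<Longrightarrow> in_wedge p"
  by (simp add: inside_wedge_def in_wedge_def)

lemma \<delta>_le_\<rho>: "\<delta> \<le> \<rho>"
proof -
  have "\<delta> * 1 \<le> \<delta> * (2 + K * \<delta>)" using \<delta> K by (intro mult_left_mono) auto
  then show ?thesis using \<delta>_small by simp
qed

lemma in_wedgeD:
  assumes "in_wedge p"
  shows "p \<in> cball 0 \<rho>" "0 < W p" "W p \<le> fst p" "\<bar>fst (X p) - W p\<bar> \<le> W p / 2"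
proof -
  have x: "0 < fst p" "fst p \<le> \<delta>" using assms by (auto simp: in_wedge_def)
  show w0: "0 < W p"
    using assms x zero_less_power[OF x(1), of k] unfolding in_wedge_def by linarith
  show wx: "W p \<le> fst p"
    using assms u_le[OF x] by (simp add: in_wedge_def)
  have "\<bar>F (fst p)\<bar> \<le> K * (fst p * fst p)"
    using F_bound[of "fst p"] x \<delta>_le_\<rho> by (simp add: power2_eq_square)
  also have "\<dots> \<le> K * (\<delta> * \<delta>)"
    using x K by (intro mult_left_mono mult_mono) auto
  finally have "\<bar>snd p\<bar> \<le> \<delta> + K * (\<delta> * \<delta>)"
    using w0 wx x by (simp add: W_def)
  then have "norm p \<le> \<delta> * (2 + K * \<delta>)"
    using norm_Pair_le[of "fst p" "snd p"] x by (simp add: algebra_simps)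
  then show p: "p \<in> cball 0 \<rho>" using \<delta>_small by simp
  have "2 * K * (\<bar>fst p\<bar> + \<bar>W p\<bar>) \<le> 2 * K * (2 * \<delta>)"
    using w0 wx x K by (intro mult_left_mono) auto
  then have "2 * K * (\<bar>fst p\<bar> + \<bar>W p\<bar>) \<le> 1" using \<delta>_small(2) by simp
  from fst_X_near[OF p this] show "\<bar>fst (X p) - W p\<bar> \<le> W p / 2" using w0 by simp
qed

lemma lipschitz_trunc: "\<bar>c\<bar> = 1 \<Longrightarrow> L-lipschitz_on UNIV (\<lambda>p. c *\<^sub>R trunc p)"
proof (rule lipschitz_onI)
  show "0 \<le> L" using lip by (rule lipschitz_on_nonneg)
  fix p q :: "real \<times> real" assume c: "\<bar>c\<bar> = 1"
  have ne: "cball (0 :: real \<times> real) \<rho> \<noteq> {}" using \<rho> by simp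
  have "dist (trunc p) (trunc q) \<le> L * dist (closest_point (cball 0 \<rho>) p) (closest_point (cball 0 \<rho>) q)"
    unfolding trunc_def using ne by (intro lipschitz_onD[OF lip] closest_point_in_set) auto
  also have "\<dots> \<le> L * dist p q"
    using ne lip by (intro mult_left_mono closest_point_lipschitz)
      (auto intro: lipschitz_on_nonneg)
  finally show "dist (c *\<^sub>R trunc p) (c *\<^sub>R trunc q) \<le> L * dist p q"
    using c by (simp add: dist_norm flip: scaleR_diff_right)
qed

lemma trunc_eq: "p \<in> cball 0 \<rho> \<Longrightarrow> trunc p = X p"
  unfolding trunc_def by (subst closest_point_self) auto

lemma trunc_0: "trunc 0 = 0"
  using trunc_eq[of 0] \<rho> X0 by simp

lemma isCont_F: "\<bar>x\<bar> \<le> \<rho> \<Longrightarrow> isCont F x"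
  using F_deriv DERIV_isCont by blast

lemma isCont_u: "0 < x \<Longrightarrow> x \<le> \<delta> \<Longrightarrow> isCont u x"
  using u_deriv DERIV_isCont by blast

lemma open_inside_wedge: "open (Collect inside_wedge)"
proof -
  define S where "S = {p :: real \<times> real. 0 < fst p \<and> fst p < \<delta>}"
  have S: "open S" unfolding S_def
    by (intro open_Collect_conj open_Collect_less continuous_intros)
  have Fc: "continuous_on {0<..<\<delta>} F" and uc: "continuous_on {0<..<\<delta>} u"
    using isCont_F isCont_u \<delta>_le_\<rho> by (auto intro!: continuous_at_imp_continuous_on)
  have "continuous_on S (\<lambda>p. F (fst p))" "continuous_on S (\<lambda>p. u (fst p))"
    by (rule continuous_on_compose2[OF Fc] continuous_on_compose2[OF uc];
        force simp: S_def intro!: continuous_intros)+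
  then have "continuous_on S (\<lambda>p. min (W p - fst p ^ k) (u (fst p) - W p))"
    unfolding W_def by (intro continuous_intros)
  from continuous_open_preimage[OF this S open_greaterThan[of 0]]
  show ?thesis
    by (rule back_subst[where P = "open"]) (auto simp: S_def inside_wedge_def)
qed

text \<open>\<open>c\<close> is the direction of time. At an exit through a curved edge, the
  function that vanishes on this edge would have a positive derivative at \<open>T\<close>, hence be
  negative just before, where the curve is still inside. The tip is excluded by \<open>pos\<close>,
  so only the right edge remains.\<close>

lemma exit_point:
  assumes c: "\<bar>c\<bar> = 1"
    and low: "\<And>p. in_wedge p \<Longrightarrow> W p = fst p ^ k \<Longrightarrow> 0 < c * (V p - real k * fst p ^ (k - 1) * fst (X p))"
    and upp: "\<And>p. in_wedge p \<Longrightarrow> W p = u (fst p) \<Longrightarrow> 0 < c * (u' (fst p) * fst (X p) - V p)"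
    and curve: "\<And>t. 0 \<le> t \<Longrightarrow> (z has_vector_derivative c *\<^sub>R trunc (z t)) (at t within {0..})"
    and T: "0 < T" and before: "\<And>t. 0 \<le> t \<Longrightarrow> t < T \<Longrightarrow> inside_wedge (z t)"
    and exit: "\<not> inside_wedge (z T)" and pos: "fst (z T) > 0"
  shows "fst (z T) = \<delta>" "in_wedge (z T)"
proof -
  have curve': "(z has_vector_derivative c *\<^sub>R trunc (z t)) (at t within {0..T})" if "0 \<le> t" for t
    using curve[OF that] by (rule has_vector_derivative_within_subset) auto
  have zc: "continuous (at T within {0..T}) z"
    using curve'[of T] T by (auto intro: has_vector_derivative_continuous)
  have "norm (z T) \<le> \<rho>"
    by (rule le_at_right_endpoint[where f = "\<lambda>t. norm (z t)" and g = "\<lambda>_. \<rho>", OF T])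
      (use zc in_wedgeD(1)[OF inside_imp_in[OF before]] in \<open>auto intro: continuous_intros\<close>)
  then have ball: "z T \<in> cball 0 \<rho>" by simp
  define x where "x t = fst (z t)" for t
  define w where "w t = W (z t)" for t
  have bf: "x t \<le> \<delta>" "x t ^ k < w t" "w t < u (x t)" if "0 \<le> t" "t < T" for t
    using before[OF that] by (simp_all add: inside_wedge_def x_def w_def)
  have "(z has_vector_derivative c *\<^sub>R X (z T)) (at T within {0..T})"
    using curve'[of T] T by (simp add: trunc_eq[OF ball])
  from curve_derivs[OF this ball]
  have xd: "(x has_real_derivative c * fst (X (z T))) (at T within {0..T})"
    and wd: "(w has_real_derivative c * V (z T)) (at T within {0..T})"
    by (simp_all add: x_def[abs_def] w_def[abs_def])
  note xc = DERIV_continuous[OF xd] and wc = DERIV_continuous[OF wd]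
  have xT: "0 < x T" using pos by (simp add: x_def)
  have x\<delta>: "x T \<le> \<delta>"
    by (rule le_at_right_endpoint[where f = x and g = "\<lambda>_. \<delta>", OF T xc])
      (use bf in auto)
  have ud: "((\<lambda>t. u (x t)) has_real_derivative u' (x T) * (c * fst (X (z T)))) (at T within {0..T})"
    by (rule DERIV_chain2[OF u_deriv[OF xT x\<delta>] xd])
  have ld: "((\<lambda>t. x t ^ k) has_real_derivative real k * x T ^ (k - 1) * (c * fst (X (z T)))) (at T within {0..T})"
    using DERIV_power[OF xd, of k] by (simp add: mult_ac)
  have "x T ^ k \<le> w T" "w T \<le> u (x T)"
    by (rule le_at_right_endpoint[OF T DERIV_continuous[OF ld] wc]
        le_at_right_endpoint[OF T wc DERIV_continuous[OF ud]],
        use bf in force)+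
  then show R: "in_wedge (z T)"
    using xT x\<delta> by (simp add: in_wedge_def x_def w_def)
  show "fst (z T) = \<delta>"
  proof (rule ccontr)
    assume "fst (z T) \<noteq> \<delta>"
    then consider "w T = x T ^ k" | "w T = u (x T)"
      using R exit by (force simp: in_wedge_def inside_wedge_def x_def w_def)
    then obtain g g' where g: "(g has_real_derivative g') (at T within {0..T})" "g' > 0"
      "g T = 0" "\<And>t. 0 \<le> t \<Longrightarrow> t < T \<Longrightarrow> g t > 0"
    proof cases
      case 1
      show ?thesis
      proof (rule that[of "\<lambda>t. w t - x t ^ k"])
        show "((\<lambda>t. w t - x t ^ k) has_real_derivative
            c * V (z T) - real k * x T ^ (k - 1) * (c * fst (X (z T)))) (at T within {0..T})"
          by (rule DERIV_diff[OF wd ld])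
        show "c * V (z T) - real k * x T ^ (k - 1) * (c * fst (X (z T))) > 0"
          using low[OF R] 1 by (simp add: x_def w_def algebra_simps)
      qed (use 1 bf in auto)
    next
      case 2
      show ?thesis
      proof (rule that[of "\<lambda>t. u (x t) - w t"])
        show "((\<lambda>t. u (x t) - w t) has_real_derivative
            u' (x T) * (c * fst (X (z T))) - c * V (z T)) (at T within {0..T})"
          by (rule DERIV_diff[OF ud wd])
        show "u' (x T) * (c * fst (X (z T))) - c * V (z T) > 0"
          using upp[OF R] 2 by (simp add: x_def w_def algebra_simps)
      qed (use 2 bf in auto)
    qed
    from has_real_derivative_pos_inc_left[OF g(1,2)]
    obtain d where d: "d > 0" "\<And>h. 0 < h \<Longrightarrow> T - h \<in> {0..T} \<Longrightarrow> h < d \<Longrightarrow> g (T - h) < g T"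
      by blast
    define h where "h = min T d / 2"
    have "0 < h" "h < d" "T - h \<in> {0..T}" "T - h < T" using T d by (auto simp: h_def min_def)
    with d(2)[of h] g(3) g(4)[of "T - h"] show False by auto
  qed
qed

text \<open>Backwards in time \<open>x\<close> decreases at rate at least \<open>x^k / 2\<close>, so
  it has no positive lower bound. The slope \<open>|y| / x\<close> is at most
  \<open>|u x / x| + K x\<close>, so the limit direction is \<open>(1, 0)\<close>.\<close>

lemma tends_with_tangent_in_wedge:
  assumes curve: "\<And>t. 0 \<le> t \<Longrightarrow> (\<eta> has_vector_derivative - X (\<eta> t)) (at t within {0..})"
    and R: "\<And>t. 0 \<le> t \<Longrightarrow> in_wedge (\<eta> t)"
  shows "tends_with_tangent \<eta> 0 at_top"
proof -
  define x where "x t = fst (\<eta> t)" for t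
  have xd: "(x has_real_derivative - fst (X (\<eta> t))) (at t within {0..s})" if "0 \<le> t" for s t
  proof -
    have "(\<eta> has_vector_derivative (- 1) *\<^sub>R X (\<eta> t)) (at t within {0..s})"
      using has_vector_derivative_within_subset[OF curve[OF that], of "{0..s}"] by auto
    from curve_derivs(1)[OF this in_wedgeD(1)[OF R[OF that]]] show ?thesis
      by (simp add: x_def[abs_def])
  qed
  have x1: "fst (X (\<eta> t)) \<ge> x t ^ k / 2" if "0 \<le> t" for t
  proof -
    have "fst (\<eta> t) ^ k \<le> W (\<eta> t)" using R[OF that] by (simp add: in_wedge_def)
    with in_wedgeD(4)[OF R[OF that]] show ?thesis unfolding x_def by linarith
  qed
  have pos: "x t > 0" and x\<delta>: "x t \<le> \<delta>" if "0 \<le> t" for t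
    using R[OF that] by (auto simp: in_wedge_def x_def)
  have nz: "x t \<noteq> 0" if "0 \<le> t" for t
    using pos[OF that] by simp
  have anti: "x t \<le> x s" if st: "0 \<le> s" "s \<le> t" for s t
  proof -
    have "- x s \<le> - x t"
    proof (rule nondecreasing_within[where f = "\<lambda>t. - x t", OF st(2)])
      fix r assume "r \<in> {s..t}"
      then have r: "0 \<le> r" using st by auto
      show "((\<lambda>t. - x t) has_real_derivative fst (X (\<eta> r))) (at r within {s..t})"
        using DERIV_minus[OF DERIV_subset[OF xd[OF r, of t], of "{s..t}"]] st by auto
      show "0 \<le> fst (X (\<eta> r))"
        using x1[OF r] zero_less_power[OF pos[OF r], of k] by linarith
    qed
    then show ?thesis by simp
  qed
  have x0: "(x \<longlongrightarrow> 0) at_top"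
  proof (rule order_tendstoI)
    fix a :: real assume "a < 0"
    then show "\<forall>\<^sub>F t in at_top. a < x t"
      by (intro eventually_at_top_linorderI[of 0]) (use pos in force)
  next
    fix a :: real assume a: "0 < a"
    have "\<exists>T\<ge>0. x T < a"
    proof (rule ccontr)
      assume "\<not> (\<exists>T\<ge>0. x T < a)"
      then have ge: "x t \<ge> a" if "0 \<le> t" for t using that by force
      \<comment> \<open>The time needed to cover the width \<delta> at speed
        \<open>a ^ k / 2\<close>.\<close>
      define T where "T = 2 * \<delta> / a ^ k"
      have T: "T > 0" using a \<delta> by (simp add: T_def)
      have "- x 0 + a ^ k / 2 * 0 \<le> - x T - a ^ k / 2 * T"
      proof (rule nondecreasing_within[where f = "\<lambda>t. - x t - a ^ k / 2 * t", THEN order_trans[rotated]])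
        fix r assume "r \<in> {0..T}"
        then have r: "0 \<le> r" by auto
        show "((\<lambda>t. - x t - a ^ k / 2 * t) has_real_derivative fst (X (\<eta> r)) - a ^ k / 2) (at r within {0..T})"
          by (auto intro!: derivative_eq_intros xd[OF r])
        have "a ^ k \<le> x r ^ k" using ge[OF r] a by (intro power_mono) auto
        then show "0 \<le> fst (X (\<eta> r)) - a ^ k / 2" using x1[OF r] by linarith
      qed (use T in auto)
      then have "x T + a ^ k / 2 * T \<le> x 0" by simp
      moreover have "a ^ k / 2 * T = \<delta>" using a by (simp add: T_def)
      ultimately show False using pos[of T] x\<delta>[of 0] T by simp
    qed
    then obtain T where T: "T \<ge> 0" "x T < a" by blast
    show "\<forall>\<^sub>F t in at_top. x t < a"
      by (rule eventually_at_top_linorderI[of T]) (use anti[OF T(1)] T(2) in force)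
  qed
  have ev: "\<forall>\<^sub>F t in at_top. 0 \<le> (t :: real)" by (rule eventually_ge_at_top)
  have xr: "filterlim x (at_right 0) at_top"
    unfolding filterlim_at
    by (intro conjI x0 eventually_at_top_linorderI[of 0]) (simp_all add: pos nz)
  define q where "q t = snd (\<eta> t) / x t" for t
  have ux: "((\<lambda>t. u (x t) / x t) \<longlongrightarrow> 0) at_top"
    using u_tangent xr by (rule filterlim_compose)
  have "((\<lambda>t. \<bar>u (x t) / x t\<bar> + K * x t) \<longlongrightarrow> \<bar>0\<bar> + K * 0) at_top"
    by (intro tendsto_intros ux x0)
  then have g0: "((\<lambda>t. \<bar>u (x t) / x t\<bar> + K * x t) \<longlongrightarrow> 0) at_top" by simp
  have q0: "(q \<longlongrightarrow> 0) at_top"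
  proof (rule Lim_null_comparison[OF _ g0])
    show "\<forall>\<^sub>F t in at_top. norm (q t) \<le> \<bar>u (x t) / x t\<bar> + K * x t"
      using ev
    proof eventually_elim
      case (elim t)
      note p = pos[OF elim]
      have "\<bar>F (x t)\<bar> \<le> K * (x t)\<^sup>2"
        using F_bound[of "x t"] p x\<delta>[OF elim] \<delta>_le_\<rho> by auto
      moreover have "0 < W (\<eta> t)" "W (\<eta> t) \<le> u (x t)"
        using in_wedgeD[OF R[OF elim]] R[OF elim] by (auto simp: in_wedge_def x_def)
      ultimately have "\<bar>snd (\<eta> t)\<bar> \<le> \<bar>u (x t)\<bar> + K * (x t)\<^sup>2"
        by (simp add: W_def x_def)
      then have "\<bar>snd (\<eta> t)\<bar> / x t \<le> (\<bar>u (x t)\<bar> + K * (x t)\<^sup>2) / x t"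
        using p by (intro divide_right_mono) auto
      then show ?case using p by (simp add: q_def add_divide_distrib power2_eq_square)
    qed
  qed
  have \<eta>: "\<eta> t = x t *\<^sub>R (1 :: real, q t)" if "0 \<le> t" for t
    using pos[OF that] by (simp add: q_def x_def prod_eq_iff)
  have 1: "((\<lambda>t. (1 :: real, q t)) \<longlongrightarrow> (1 :: real, 0 :: real)) at_top"
    by (intro tendsto_intros q0)
  have "((\<lambda>t. x t *\<^sub>R (1 :: real, q t)) \<longlongrightarrow> 0 *\<^sub>R (1 :: real, 0 :: real)) at_top"
    by (intro tendsto_scaleR x0 1)
  then have "(\<eta> \<longlongrightarrow> 0 *\<^sub>R (1 :: real, 0 :: real)) at_top"
    by (rule Lim_transform_eventually) (rule eventually_at_top_linorderI[of 0], simp only: \<eta>)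
  then have "(\<eta> \<longlongrightarrow> 0) at_top" by (simp add: zero_prod_def)
  moreover have "((\<lambda>t. sgn (\<eta> t)) \<longlongrightarrow> sgn (1 :: real, 0 :: real)) at_top"
  proof (rule Lim_transform_eventually)
    show "((\<lambda>t. sgn (1 :: real, q t)) \<longlongrightarrow> sgn (1 :: real, 0 :: real)) at_top"
      by (rule tendsto_sgn[OF 1]) (simp add: zero_prod_def)
    show "\<forall>\<^sub>F t in at_top. sgn (1 :: real, q t) = sgn (\<eta> t)"
      using ev by eventually_elim (simp only: \<eta> pos sgn_scaleR sgn_pos scaleR_one)
  qed
  moreover have "\<forall>\<^sub>F t in at_top. \<eta> t \<noteq> 0"
    using ev by eventually_elim (metis fst_zero nz x_def)
  ultimately show ?thesis
    unfolding tends_with_tangent_def diff_0_right by blast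
qed

end

section \<open>Orbits in backward and in forward invariant wedges\<close>

context wedge
begin

lemma inside_wedge_midpoint:
  assumes "0 < x" "x < \<delta>"
  shows "inside_wedge (x, F x + (x ^ k + u x) / 2)"
  using lower_less_u[of x] assms by (simp add: inside_wedge_def W_def)

lemma trunc_solution_norm:
  assumes c: "\<bar>c\<bar> = 1" and T: "0 \<le> T"
    and curve: "\<And>t. 0 \<le> t \<Longrightarrow> (z has_vector_derivative c *\<^sub>R trunc (z t)) (at t within {0..})"
  shows "norm (z T) \<le> exp (L * T) * norm (z 0)" "norm (z 0) \<le> exp (L * T) * norm (z T)"
proof -
  have g: "(z has_vector_derivative c *\<^sub>R trunc (z t)) (at t within {0..T})" if "0 \<le> t" for t
    using curve[OF that] by (rule has_vector_derivative_within_subset) auto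
  have z: "((\<lambda>_. 0) has_vector_derivative c *\<^sub>R trunc 0) (at t within {0..T})" for t
    by (simp add: trunc_0)
  show "norm (z T) \<le> exp (L * T) * norm (z 0)" "norm (z 0) \<le> exp (L * T) * norm (z T)"
    using lipschitz_field_solutions_dist[OF lipschitz_trunc[OF c] T g z] by simp_all
qed

lemma norm_ge_fst: "\<bar>fst p\<bar> \<le> norm (p :: real \<times> real)"
  using norm_fst_le[of "fst p" "snd p"] by simp

text \<open>Under \<open>- X\<close> the abscissa decreases, which rules out the right edge; the
  hypotheses rule out the curved edges, and Gronwall rules out an arrival at the origin in finite
  time. Hence the curve never leaves.\<close>

lemma orbit_in_backward_invariant_wedge:
  assumes low: "\<And>p. in_wedge p \<Longrightarrow> W p = fst p ^ k \<Longrightarrow> V p < real k * fst p ^ (k - 1) * fst (X p)"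
    and upp: "\<And>p. in_wedge p \<Longrightarrow> W p = u (fst p) \<Longrightarrow> u' (fst p) * fst (X p) < V p"
  obtains \<eta> where "reverse_orbit \<eta>"
proof -
  define p where "p = (\<delta> / 2, F (\<delta> / 2) + ((\<delta> / 2) ^ k + u (\<delta> / 2)) / 2)"
  have p: "inside_wedge p" unfolding p_def by (rule inside_wedge_midpoint) (use \<delta> in auto)
  obtain \<eta> where \<eta>0: "\<eta> 0 = p"
    and curve: "\<And>t. 0 \<le> t \<Longrightarrow> (\<eta> has_vector_derivative (- 1) *\<^sub>R trunc (\<eta> t)) (at t within {0..})"
    by (rule lipschitz_field_forward_solution[OF lipschitz_trunc[of "- 1"], of p]) auto
  have c: "continuous_on {0..} \<eta>"
    using has_vector_derivative_continuous[OF curve] by (simp add: continuous_on_eq_continuous_within)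
  have inside: "inside_wedge (\<eta> t)" if "0 \<le> t" for t
  proof (rule ccontr)
    assume "\<not> inside_wedge (\<eta> t)"
    then have "\<eta> 0 \<in> Collect inside_wedge" "\<eta> t \<notin> Collect inside_wedge"
      using p \<eta>0 by simp_all
    from first_exit[OF c open_inside_wedge this(1) that this(2)]
    obtain T where T: "0 < T" "\<not> inside_wedge (\<eta> T)"
      "\<And>s. 0 \<le> s \<Longrightarrow> s < T \<Longrightarrow> inside_wedge (\<eta> s)"
      by (metis mem_Collect_eq)
    define x where "x t = fst (\<eta> t)" for t
    define w where "w t = W (\<eta> t)" for t
    note I = inside_imp_in[OF T(3)]
    have \<eta>c: "continuous (at T within {0..T}) \<eta>"
      using has_vector_derivative_continuous[OF has_vector_derivative_within_subset[OF curve,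
          of T "{0..T}"]] T(1) by simp
    then have xc: "continuous (at T within {0..T}) x"
      unfolding x_def[abs_def] by (intro continuous_intros)
    have x_anti: "x s \<le> x 0" if "0 \<le> s" "s < T" for s
    proof -
      have "- x 0 \<le> - x s"
      proof (rule nondecreasing_within[where f = "\<lambda>t. - x t", OF that(1)])
        fix r assume "r \<in> {0..s}"
        then have r: "0 \<le> r" "r < T" using that by auto
        note R = in_wedgeD[OF I[OF r]]
        have "(\<eta> has_vector_derivative (- 1) *\<^sub>R X (\<eta> r)) (at r within {0..s})"
          using has_vector_derivative_within_subset[OF curve[OF r(1)], of "{0..s}"]
          by (auto simp: trunc_eq[OF R(1)])
        from DERIV_minus[OF curve_derivs(1)[OF this R(1)]]
        show "((\<lambda>t. - x t) has_real_derivative fst (X (\<eta> r))) (at r within {0..s})"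
          by (simp add: x_def)
        show "0 \<le> fst (X (\<eta> r))" using R(2,4) by linarith
      qed
      then show ?thesis by simp
    qed
    have bf: "0 \<le> x s" "0 \<le> w s" "w s \<le> x s" if "0 \<le> s" "s < T" for s
      using in_wedgeD[OF I[OF that]] T(3)[OF that] by (auto simp: x_def w_def inside_wedge_def)
    have xT: "x T \<le> x 0" "0 \<le> x T"
      using le_at_right_endpoint[OF T(1) xc, of "\<lambda>_. x 0"]
        le_at_right_endpoint[OF T(1) _ xc, of "\<lambda>_. 0"] x_anti bf by auto
    have x0: "x 0 < \<delta>" using p by (simp add: x_def \<eta>0 inside_wedge_def)
    have "isCont F (x T)" using xT x0 \<delta>_le_\<rho> by (intro isCont_F) auto
    then have wc: "continuous (at T within {0..T}) w"
      unfolding w_def[abs_def] W_def using \<eta>c xc unfolding x_def[abs_def]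
      by (auto intro!: continuous_intros continuous_within_compose3[where g = F] simp: x_def)
    have wT: "0 \<le> w T" "w T \<le> x T"
      using le_at_right_endpoint[OF T(1) wc xc]
        le_at_right_endpoint[OF T(1) _ wc, of "\<lambda>_. 0"] bf by auto
    \<comment> \<open>By \<open>wT\<close> the only limit point with abscissa zero is the origin, an
      equilibrium.\<close>
    have "x T \<noteq> 0"
    proof
      assume "x T = 0"
      with wT have "\<eta> T = 0" by (auto simp: x_def w_def W_def F0 prod_eq_iff)
      then have "norm p \<le> 0" using trunc_solution_norm(2)[OF _ less_imp_le[OF T(1)] curve] \<eta>0 by simp
      then show False using norm_ge_fst[of p] \<delta> by (simp add: p_def zero_prod_def)
    qed
    with xT have pos: "fst (\<eta> T) > 0" by (simp add: x_def)
    have "fst (\<eta> T) = \<delta>"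
      by (rule exit_point(1)[of "- 1", OF _ _ _ curve T(1,3,2) pos]) (use low upp in auto)
    with xT x0 show False by (simp add: x_def)
  qed
  note R = inside_imp_in[OF inside]
  have curve': "(\<eta> has_vector_derivative - X (\<eta> t)) (at t within {0..})" if "0 \<le> t" for t
    using curve[OF that] by (simp add: trunc_eq[OF in_wedgeD(1)[OF R[OF that]]])
  show ?thesis
    using in_wedgeD(1)[OF R] curve' tends_with_tangent_in_wedge[OF curve' R]
    by (intro that[of \<eta>]) (simp add: reverse_orbit_def)
qed

text \<open>As long as the curve is inside, \<open>x' >= (x 0)^k / 2\<close>, so it has to leave,
  and \<open>x = \<delta>\<close> is the only way out.\<close>

lemma forward_orbit_reaches_end:
  assumes low: "\<And>p. in_wedge p \<Longrightarrow> W p = fst p ^ k \<Longrightarrow> real k * fst p ^ (k - 1) * fst (X p) < V p"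
    and upp: "\<And>p. in_wedge p \<Longrightarrow> W p = u (fst p) \<Longrightarrow> V p < u' (fst p) * fst (X p)"
    and p: "inside_wedge p"
  obtains z T where "z 0 = p" "0 < T" "fst (z T) = \<delta>"
    "\<And>t. 0 \<le> t \<Longrightarrow> (z has_vector_derivative 1 *\<^sub>R trunc (z t)) (at t within {0..})"
    "\<And>t. 0 \<le> t \<Longrightarrow> t \<le> T \<Longrightarrow> in_wedge (z t)"
proof -
  obtain z where z0: "z 0 = p"
    and curve: "\<And>t. 0 \<le> t \<Longrightarrow> (z has_vector_derivative 1 *\<^sub>R trunc (z t)) (at t within {0..})"
    by (rule lipschitz_field_forward_solution[OF lipschitz_trunc[of 1], of p]) auto
  have c: "continuous_on {0..} z"
    using has_vector_derivative_continuous[OF curve] by (simp add: continuous_on_eq_continuous_within)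
  define x where "x t = fst (z t)" for t
  have x0: "x 0 > 0" using p by (simp add: x_def z0 inside_wedge_def)
  have grow: "x 0 + x 0 ^ k / 2 * s \<le> x s"
    if s: "0 \<le> s" and I: "\<And>r. 0 \<le> r \<Longrightarrow> r \<le> s \<Longrightarrow> inside_wedge (z r)" for s
  proof -
    have xd: "(x has_real_derivative fst (X (z r))) (at r within {0..s})"
      and x1: "x r ^ k / 2 \<le> fst (X (z r))" and xp: "0 < x r" if r: "0 \<le> r" "r \<le> s" for r
    proof -
      have iw: "in_wedge (z r)" by (rule inside_imp_in[OF I[OF r]])
      note R = in_wedgeD[OF iw]
      have "(z has_vector_derivative 1 *\<^sub>R X (z r)) (at r within {0..s})"
        using has_vector_derivative_within_subset[OF curve[OF r(1)], of "{0..s}"]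
        by (auto simp: trunc_eq[OF R(1)])
      from curve_derivs(1)[OF this R(1)] show "(x has_real_derivative fst (X (z r))) (at r within {0..s})"
        by (simp add: x_def[abs_def])
      have "x r ^ k \<le> W (z r)" using iw by (simp add: x_def in_wedge_def)
      then show "x r ^ k / 2 \<le> fst (X (z r))" using R(4) by linarith
      show "0 < x r" using iw by (simp add: x_def in_wedge_def)
    qed
    have mono: "x 0 \<le> x r" if r: "0 \<le> r" "r \<le> s" for r
    proof (rule nondecreasing_within[OF r(1)])
      fix q assume "q \<in> {0..r}"
      then have q: "0 \<le> q" "q \<le> s" using r by auto
      show "(x has_real_derivative fst (X (z q))) (at q within {0..r})"
        using DERIV_subset[OF xd[OF q], of "{0..r}"] r by auto
      show "0 \<le> fst (X (z q))"
        using x1[OF q] zero_less_power[OF xp[OF q], of k] by linarith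
    qed
    have "x 0 - x 0 ^ k / 2 * 0 \<le> x s - x 0 ^ k / 2 * s"
    proof (rule nondecreasing_within[where f = "\<lambda>t. x t - x 0 ^ k / 2 * t", OF s])
      fix r assume "r \<in> {0..s}"
      then have r: "0 \<le> r" "r \<le> s" by auto
      show "((\<lambda>t. x t - x 0 ^ k / 2 * t) has_real_derivative fst (X (z r)) - x 0 ^ k / 2) (at r within {0..s})"
        by (auto intro!: derivative_eq_intros xd[OF r])
      have "x 0 ^ k \<le> x r ^ k" using mono[OF r] x0 by (intro power_mono) auto
      then show "0 \<le> fst (X (z r)) - x 0 ^ k / 2" using x1[OF r] by linarith
    qed
    then show ?thesis by simp
  qed
  have "\<exists>t\<ge>0. \<not> inside_wedge (z t)"
  proof (rule ccontr)
    assume "\<not> (\<exists>t\<ge>0. \<not> inside_wedge (z t))"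
    then have I: "inside_wedge (z t)" if "0 \<le> t" for t using that by blast
    define s where "s = 2 * \<delta> / x 0 ^ k"
    have s: "0 \<le> s" "x 0 ^ k / 2 * s = \<delta>" using x0 \<delta> by (auto simp: s_def)
    have "x 0 + \<delta> \<le> x s" using grow[OF s(1) I] s(2) by simp
    then show False using I[OF s(1)] x0 by (simp add: x_def inside_wedge_def)
  qed
  then obtain t where t: "0 \<le> t" "z t \<notin> Collect inside_wedge" by blast
  have "z 0 \<in> Collect inside_wedge" using p z0 by simp
  from first_exit[OF c open_inside_wedge this t]
  obtain T where T: "0 < T" "\<not> inside_wedge (z T)"
    "\<And>s. 0 \<le> s \<Longrightarrow> s < T \<Longrightarrow> inside_wedge (z s)"
    by (metis mem_Collect_eq)
  have "continuous (at T within {0..T}) z"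
    using has_vector_derivative_continuous[OF has_vector_derivative_within_subset[OF curve,
          of T "{0..T}"]] T(1) by simp
  then have xc: "continuous (at T within {0..T}) x"
    unfolding x_def[abs_def] by (intro continuous_intros)
  have "x 0 \<le> x T"
  proof (rule le_at_right_endpoint[OF T(1) _ xc])
    fix s assume s: "0 \<le> s" "s < T"
    have "0 \<le> x 0 ^ k / 2 * s" using x0 s by simp
    with grow[OF s(1)] T(3) s show "x 0 \<le> x s" by force
  qed simp
  with x0 have pos: "fst (z T) > 0" by (simp add: x_def)
  note ex = exit_point[of 1, OF _ _ _ curve T(1,3,2) pos]
  have zT: "fst (z T) = \<delta>" "in_wedge (z T)"
    by (rule ex; use low upp in simp)+
  have "in_wedge (z t)" if t: "0 \<le> t" "t \<le> T" for t
  proof (cases "t = T")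
    case False
    with t show ?thesis by (intro inside_imp_in T(3)) auto
  qed (simp add: zT(2))
  then show ?thesis using that[OF z0 T(1) zT(1) curve] by blast
qed

text \<open>The origin is the only point that the closure could add: the inequalities
  \<open>0 <= w <= x\<close> pass to the limit and force \<open>w = 0\<close> where
  \<open>x = 0\<close>.\<close>

lemma in_wedge_limit:
  assumes "\<And>j. in_wedge (p j)" "p \<longlonglongrightarrow> q" "q \<noteq> 0"
  shows "in_wedge q"
proof -
  have x: "(\<lambda>j. fst (p j)) \<longlonglongrightarrow> fst q" and y: "(\<lambda>j. snd (p j)) \<longlonglongrightarrow> snd q"
    using assms(2) by (auto intro: tendsto_intros)
  have x\<delta>: "0 \<le> fst q" "fst q \<le> \<delta>"
    using LIMSEQ_le_const[OF x, of 0] LIMSEQ_le_const2[OF x, of \<delta>] assms(1)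
    by (auto simp: in_wedge_def less_imp_le)
  have "isCont F (fst q)" using x\<delta> \<delta>_le_\<rho> by (intro isCont_F) auto
  from tendsto_diff[OF y isCont_tendsto_compose[OF this x]]
  have w: "(\<lambda>j. W (p j)) \<longlonglongrightarrow> W q" by (simp add: W_def)
  have "fst q \<noteq> 0"
  proof
    assume "fst q = 0"
    moreover have "0 \<le> W q" "W q \<le> fst q"
      using LIMSEQ_le_const[OF w, of 0] LIMSEQ_le[OF w x] in_wedgeD(2,3)[OF assms(1)]
      by (auto simp: less_imp_le)
    ultimately have "q = 0" by (simp add: W_def F0 prod_eq_iff)
    with assms(3) show False ..
  qed
  with x\<delta> have pos: "0 < fst q" by simp
  have uq: "(\<lambda>j. u (fst (p j))) \<longlonglongrightarrow> u (fst q)"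
    by (rule isCont_tendsto_compose[OF isCont_u[OF pos x\<delta>(2)] x])
  have "fst q ^ k \<le> W q" "W q \<le> u (fst q)"
    using LIMSEQ_le[OF tendsto_power[OF x] w] LIMSEQ_le[OF w uq] assms(1)
    by (auto simp: in_wedge_def)
  with pos x\<delta> show ?thesis by (simp add: in_wedge_def)
qed

text \<open>
  The orbit sought is a limit of orbit segments that start ever closer to the origin and end on
  \<open>x = \<delta>\<close>: their durations tend to infinity because the origin is an equilibrium.
\<close>

lemma orbit_in_forward_invariant_wedge:
  assumes low: "\<And>p. in_wedge p \<Longrightarrow> W p = fst p ^ k \<Longrightarrow> real k * fst p ^ (k - 1) * fst (X p) < V p"
    and upp: "\<And>p. in_wedge p \<Longrightarrow> W p = u (fst p) \<Longrightarrow> V p < u' (fst p) * fst (X p)"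
  obtains \<eta> where "reverse_orbit \<eta>"
proof -
  \<comment> \<open>The shift by 2 keeps all abscissas strictly below \<delta>.\<close>
  define x where "x j = \<delta> / real (j + 2)" for j :: nat
  define p where "p j = (x j, F (x j) + (x j ^ k + u (x j)) / 2)" for j
  have xj: "0 < x j" "x j < \<delta>" for j
    using \<delta> by (auto simp: x_def divide_less_eq mult_less_cancel_left1)
  have x0: "x \<longlonglongrightarrow> 0" unfolding x_def[abs_def]
    by (rule LIMSEQ_ignore_initial_segment[OF lim_const_over_n])
  have "(\<lambda>j. F (x j)) \<longlonglongrightarrow> F 0"
    by (rule isCont_tendsto_compose[OF isCont_F x0]) (use \<rho> in auto)
  moreover have "(\<lambda>j. (x j ^ k + u (x j)) / 2) \<longlonglongrightarrow> 0"
  proof (rule tendsto_sandwich[OF _ _ tendsto_const x0])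
    show "\<forall>\<^sub>F j in sequentially. 0 \<le> (x j ^ k + u (x j)) / 2"
      using xj lower_less_u by (auto intro!: always_eventually simp: less_imp_le)
        (smt (verit) zero_less_power)
    show "\<forall>\<^sub>F j in sequentially. (x j ^ k + u (x j)) / 2 \<le> x j"
    proof (intro always_eventually allI)
      fix j show "(x j ^ k + u (x j)) / 2 \<le> x j"
        using lower_less_u[of "x j"] u_le[of "x j"] xj[of j] by simp
    qed
  qed
  ultimately have p0: "p \<longlonglongrightarrow> 0"
    unfolding p_def[abs_def] zero_prod_def using tendsto_Pair[OF x0 tendsto_add] by (force simp: F0)
  have "\<forall>j. \<exists>z T. z 0 = p j \<and> 0 < T \<and> fst (z T) = \<delta> \<and>
    (\<forall>t. 0 \<le> t \<longrightarrow> (z has_vector_derivative 1 *\<^sub>R trunc (z t)) (at t within {0..})) \<and>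
    (\<forall>t. 0 \<le> t \<longrightarrow> t \<le> T \<longrightarrow> in_wedge (z t))"
  proof
    fix j
    have "inside_wedge (p j)" unfolding p_def using xj by (rule inside_wedge_midpoint)
    from forward_orbit_reaches_end[OF low upp this]
    show "\<exists>z T. z 0 = p j \<and> 0 < T \<and> fst (z T) = \<delta> \<and>
      (\<forall>t. 0 \<le> t \<longrightarrow> (z has_vector_derivative 1 *\<^sub>R trunc (z t)) (at t within {0..})) \<and>
      (\<forall>t. 0 \<le> t \<longrightarrow> t \<le> T \<longrightarrow> in_wedge (z t))" by metis
  qed
  then obtain z T where z0: "\<And>j. z j 0 = p j" and T: "\<And>j. 0 < T j" "\<And>j. fst (z j (T j)) = \<delta>"
    and z: "\<And>j t. 0 \<le> t \<Longrightarrow> (z j has_vector_derivative 1 *\<^sub>R trunc (z j t)) (at t within {0..})"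
    and R: "\<And>j t. 0 \<le> t \<Longrightarrow> t \<le> T j \<Longrightarrow> in_wedge (z j t)"
    by metis
  have "\<And>j. z j (T j) \<in> cball 0 \<rho>" using in_wedgeD(1)[OF R] T(1) by (simp add: less_imp_le)
  then obtain q r where q: "strict_mono r" "(\<lambda>j. z (r j) (T (r j))) \<longlonglongrightarrow> q"
    using compact_cball[unfolded compact_def, rule_format, of "\<lambda>j. z j (T j)" 0 \<rho>]
    by (auto simp: o_def)
  have "(\<lambda>j. fst (z (r j) (T (r j)))) \<longlonglongrightarrow> fst q" using q(2) by (rule tendsto_fst)
  then have "fst q = \<delta>" by (simp add: T(2) LIMSEQ_const_iff)
  then have nq: "norm q > 0" using \<delta> norm_ge_fst[of q] by linarith
  obtain \<eta> where \<eta>0: "\<eta> 0 = q"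
    and curve: "\<And>t. 0 \<le> t \<Longrightarrow> (\<eta> has_vector_derivative (- 1) *\<^sub>R trunc (\<eta> t)) (at t within {0..})"
    by (rule lipschitz_field_forward_solution[OF lipschitz_trunc[of "- 1"], of q]) auto
  have in_w: "in_wedge (\<eta> t)" if t: "0 \<le> t" for t
  proof -
    have "(\<lambda>j. exp (L * t) * norm (p (r j))) \<longlonglongrightarrow> exp (L * t) * norm (0 :: real \<times> real)"
      by (intro tendsto_intros LIMSEQ_subseq_LIMSEQ[OF p0 q(1), unfolded o_def])
    then have "\<forall>\<^sub>F j in sequentially. exp (L * t) * norm (p (r j)) < \<delta>"
      using \<delta> by (intro order_tendstoD(2)) auto
    then obtain J where J: "\<And>j. J \<le> j \<Longrightarrow> exp (L * t) * norm (p (r j)) < \<delta>"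
      unfolding eventually_sequentially by blast
    have L0: "0 \<le> L" using lip by (rule lipschitz_on_nonneg)
    \<comment> \<open>The end point has norm at least \<delta>, whereas Gronwall allows at most
      \<open>exp (L * T)\<close> times the norm of the starting point. A duration below
      \<open>t\<close> is thus impossible once the start is close enough to the origin.\<close>
    have Tt: "t \<le> T (r j)" if "J \<le> j" for j
    proof (rule ccontr)
      assume "\<not> t \<le> T (r j)"
      then have "exp (L * T (r j)) * norm (p (r j)) \<le> exp (L * t) * norm (p (r j))"
        using L0 by (intro mult_right_mono) (auto intro: mult_left_mono)
      moreover have "norm (z (r j) (T (r j))) \<le> exp (L * T (r j)) * norm (p (r j))"
        using trunc_solution_norm(1)[of 1 "T (r j)" "z (r j)"] z T(1)[of "r j"] z0 by simp
      moreover have "\<delta> \<le> norm (z (r j) (T (r j)))"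
        using norm_ge_fst[of "z (r j) (T (r j))"] T(2) \<delta> by simp
      ultimately show False using J[OF that] by linarith
    qed
    \<comment> \<open>The segment traversed backwards from its end point. The end points converge to
      \<open>q\<close>, so by Gronwall on the fixed interval up to \<open>t\<close> these curves
      converge to \<eta>, and \<eta> inherits membership in the wedge.\<close>
    define \<beta> where "\<beta> j s = z (r j) (T (r j) - s)" for j s
    have close: "norm (\<beta> j t - \<eta> t) \<le> exp (L * t) * norm (z (r j) (T (r j)) - q)" if j: "J \<le> j" for j
    proof -
      have "norm (\<beta> j t - \<eta> t) \<le> exp (L * t) * norm (\<beta> j 0 - \<eta> 0)"
      proof (rule lipschitz_field_solutions_dist(1)[OF lipschitz_trunc[of "- 1"] t])
        fix s assume s: "0 \<le> s" "s \<le> t"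
        show "(\<eta> has_vector_derivative (- 1) *\<^sub>R trunc (\<eta> s)) (at s within {0..t})"
          using curve[OF s(1)] by (rule has_vector_derivative_within_subset) auto
        have "((\<lambda>s. T (r j) - s) has_vector_derivative - 1) (at s within {0..t})"
          by (auto intro!: derivative_eq_intros)
        moreover have "(z (r j) has_vector_derivative 1 *\<^sub>R trunc (\<beta> j s))
            (at (T (r j) - s) within (\<lambda>s. T (r j) - s) ` {0..t})"
          unfolding \<beta>_def using Tt[OF j] s
          by (intro has_vector_derivative_within_subset[OF z]) auto
        ultimately show "(\<beta> j has_vector_derivative (- 1) *\<^sub>R trunc (\<beta> j s)) (at s within {0..t})"
          using vector_diff_chain_within[of "\<lambda>s. T (r j) - s" "- 1" s "{0..t}" "z (r j)"]
          by (simp add: \<beta>_def[abs_def] o_def)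
      qed simp
      then show ?thesis by (simp add: \<beta>_def \<eta>0)
    qed
    have "(\<lambda>j. exp (L * t) * norm (z (r j) (T (r j)) - q)) \<longlonglongrightarrow> exp (L * t) * norm (q - q)"
      by (intro tendsto_intros q(2))
    then have e0: "(\<lambda>j. exp (L * t) * norm (z (r j) (T (r j)) - q)) \<longlonglongrightarrow> 0" by simp
    have "(\<lambda>j. \<beta> j t - \<eta> t) \<longlonglongrightarrow> 0"
      by (rule Lim_null_comparison[OF _ e0]) (use close in \<open>auto simp: eventually_sequentially\<close>)
    then have "(\<lambda>j. \<beta> j t) \<longlonglongrightarrow> \<eta> t" by (simp add: Lim_null[symmetric])
    then have lim: "(\<lambda>j. \<beta> (j + J) t) \<longlonglongrightarrow> \<eta> t" by (rule LIMSEQ_ignore_initial_segment)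
    have "norm q \<le> exp (L * t) * norm (\<eta> t)"
      using trunc_solution_norm(2)[OF _ t curve] by (simp add: \<eta>0)
    with nq have nz: "\<eta> t \<noteq> 0" by auto
    have "in_wedge (\<beta> (j + J) t)" for j
      unfolding \<beta>_def using t Tt[of "j + J"] by (intro R) auto
    then show ?thesis using lim nz by (rule in_wedge_limit)
  qed
  have curve': "(\<eta> has_vector_derivative - X (\<eta> t)) (at t within {0..})" if "0 \<le> t" for t
    using curve[OF that] by (simp add: trunc_eq[OF in_wedgeD(1)[OF in_w[OF that]]])
  show ?thesis
    using in_wedgeD(1)[OF in_w] curve' tends_with_tangent_in_wedge[OF curve' in_w]
    by (intro that[of \<eta>]) (simp add: reverse_orbit_def)
qed

end

section \<open>Barriers\<close>

lemma eventually_less_at_right_0: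
  fixes g :: "real \<Rightarrow> real"
  assumes "isCont g 0" "g 0 < e"
  shows "\<forall>\<^sub>F x in at_right 0. g x < e"
proof -
  have "(g \<longlongrightarrow> g 0) (at_right 0)"
    using assms(1) by (auto simp: isCont_def intro: filterlim_at_split[THEN iffD1, THEN conjunct2])
  then show ?thesis using assms(2) by (rule order_tendstoD(2))
qed

lemma eventually_at_right_0_obtain:
  assumes "\<forall>\<^sub>F x in at_right (0 :: real). P x"
  obtains \<delta> where "0 < \<delta>" "\<And>x. 0 < x \<Longrightarrow> x \<le> \<delta> \<Longrightarrow> P x"
proof -
  obtain b where "b > 0" "\<And>x. 0 < x \<Longrightarrow> x < b \<Longrightarrow> P x"
    using assms unfolding eventually_at_right_field by auto
  then show ?thesis by (intro that[of "b / 2"]) auto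
qed

text \<open>On \<open>w = x^k\<close> the term \<open>\<Phi> w\<close> has order
  \<open>k + 1\<close>, the error \<open>w^2\<close> order \<open>2 k\<close>, and the motion
  \<open>k x^(k-1) x'\<close> of the edge order \<open>2 k - 1\<close>. For \<open>k >= 2\<close>
  all are at least \<open>k + 1\<close>, so the sign of \<open>a\<close> decides in which direction
  the edge is crossed.\<close>

lemma (in wedge) lower_barrier:
  assumes k2: "k \<ge> 2" and \<delta>1: "\<delta> \<le> 1" and M: "M \<ge> 0"
    and f_exp: "\<And>x. 0 < x \<Longrightarrow> x \<le> \<delta> \<Longrightarrow> \<bar>f x - a * x ^ k\<bar> \<le> M * x ^ (k + 1)"
    and p: "in_wedge p" "W p = fst p ^ k"
  shows "\<bar>V p - real k * fst p ^ (k - 1) * fst (X p) - a * fst p ^ k\<bar>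
    \<le> (M + 2 * K + 2 * real k) * fst p ^ (k + 1)"
proof -
  define x where "x = fst p"
  have x: "0 < x" "x \<le> \<delta>" "x \<le> 1" "\<bar>x\<bar> \<le> \<rho>"
    using p \<delta>1 \<delta>_le_\<rho> by (auto simp: in_wedge_def x_def)
  note R = in_wedgeD[OF p(1)]
  have f: "\<bar>f x - a * x ^ k\<bar> \<le> M * x ^ (k + 1)" using f_exp x by blast
  have "\<bar>\<Phi> x * W p\<bar> = \<bar>\<Phi> x\<bar> * x ^ k" using x by (simp add: abs_mult p(2) x_def)
  also have "\<dots> \<le> K * x * x ^ k" using \<Phi>_bound[OF x(4)] x by (intro mult_right_mono) auto
  finally have \<Phi>: "\<bar>\<Phi> x * W p\<bar> \<le> K * x ^ (k + 1)" by simp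
  have "(W p)\<^sup>2 = x ^ (2 * k)" by (simp add: p(2) x_def power_mult power2_eq_square mult_2 power_add)
  also have "\<dots> \<le> x ^ (k + 1)" using x k2 by (intro power_decreasing) auto
  finally have "K * (W p)\<^sup>2 \<le> K * x ^ (k + 1)" using K by (intro mult_left_mono) auto
  then have V: "\<bar>V p - f x - \<Phi> x * W p\<bar> \<le> K * x ^ (k + 1)"
    using V_near[OF R(1)] by (simp add: x_def)
  have X1: "\<bar>fst (X p)\<bar> \<le> 2 * x ^ k"
    using R(2,4) unfolding x_def p(2)[symmetric] by linarith
  have "\<bar>real k * x ^ (k - 1) * fst (X p)\<bar> = real k * (x ^ (k - 1) * \<bar>fst (X p)\<bar>)"
    using x by (simp add: abs_mult)
  also have "\<dots> \<le> real k * (x ^ (k - 1) * (2 * x ^ k))"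
    using X1 x by (intro mult_left_mono) auto
  also have "x ^ (k - 1) * (2 * x ^ k) = 2 * x ^ (2 * k - 1)"
  proof -
    have "k - 1 + k = 2 * k - 1" using k2 by simp
    then have "x ^ (k - 1) * x ^ k = x ^ (2 * k - 1)" by (simp only: power_add[symmetric])
    then show ?thesis by (simp only: mult.left_commute)
  qed
  also have "real k * (2 * x ^ (2 * k - 1)) \<le> real k * (2 * x ^ (k + 1))"
    using x k2 by (intro mult_left_mono power_decreasing) auto
  finally have "\<bar>real k * x ^ (k - 1) * fst (X p)\<bar> \<le> 2 * real k * x ^ (k + 1)"
    by (simp only: mult.assoc mult.left_commute mult_left_mono of_nat_0_le_iff)
  with f \<Phi> V show ?thesis unfolding x_def[symmetric] distrib_right by linarith
qed

context nilpotent_field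
begin

text \<open>On \<open>u = sqrt (c x^3)\<close> one has \<open>u u' = 3 c x^2 / 2\<close>, so the
  edge rises at rate at least \<open>3 c x^2 / 4\<close>, which beats the bound
  \<open>3 K x^2\<close> for \<open>w'\<close> once \<open>c > 4 K\<close>. The power 3/2 lies
  strictly between 1, for tangency, and \<open>k >= 2\<close>, for the lower edge. There
  \<open>a > 0\<close> pushes inwards, so the wedge is forward invariant.\<close>

lemma orbit_if_positive:
  fixes k :: nat
  assumes k2: "k \<ge> 2" and a: "a > 0" and M: "M \<ge> 0" and \<delta>0: "\<delta>\<^sub>0 > 0"
    and f_exp: "\<And>x. 0 < x \<Longrightarrow> x \<le> \<delta>\<^sub>0 \<Longrightarrow> \<bar>f x - a * x ^ k\<bar> \<le> M * x ^ (k + 1)"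
  obtains \<eta> where "reverse_orbit \<eta>"
proof -
  define c where "c = 4 * K + 1"
  define C where "C = M + 2 * K + 2 * real k"
  define u where "u x = sqrt (c * x ^ 3)" for x
  define u' where "u' x = 3 * c * x\<^sup>2 / (2 * sqrt (c * x ^ 3))" for x
  have c: "c \<ge> 5" "c > 0" using K by (auto simp: c_def)
  have C: "C > 0" using K M by (auto simp: C_def intro!: add_nonneg_pos)
  have "\<forall>\<^sub>F x in at_right 0. x * (2 + K * x) < \<rho> \<and> c * x < 1 \<and> C * x < a \<and> x < \<delta>\<^sub>0"
    using \<rho> a \<delta>0 by (intro eventually_conj eventually_less_at_right_0) auto
  then obtain \<delta> where \<delta>: "\<delta> > 0" and \<delta>': "\<And>x. 0 < x \<Longrightarrow> x \<le> \<delta> \<Longrightarrow>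
      x * (2 + K * x) < \<rho> \<and> c * x < 1 \<and> C * x < a \<and> x < \<delta>\<^sub>0"
    using eventually_at_right_0_obtain by blast
  have small: "x * (2 + K * x) < \<rho>" "c * x < 1" "C * x < a" "x < \<delta>\<^sub>0" "x \<le> 1"
    if "0 < x" "x \<le> \<delta>" for x
  proof -
    show *: "x * (2 + K * x) < \<rho>" "c * x < 1" "C * x < a" "x < \<delta>\<^sub>0"
      using \<delta>'[OF that] by auto
    have "1 * x \<le> c * x" using c that by (intro mult_right_mono) auto
    with * show "x \<le> 1" by simp
  qed
  interpret wedge X F F' f \<Phi> \<rho> K L \<delta> k u u'
  proof
    show "0 < \<delta>" "1 \<le> k" using \<delta> k2 by auto
    show "\<delta> * (2 + K * \<delta>) \<le> \<rho>" "4 * K * \<delta> \<le> 1"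
      using small[of \<delta>] \<delta> by (auto simp: c_def algebra_simps)
    fix x :: real assume x: "0 < x" "x \<le> \<delta>"
    note s = small[OF x]
    have "c * x ^ 3 > 0" using c x by simp
    from DERIV_chain2[OF DERIV_real_sqrt[OF this] DERIV_cmult[OF DERIV_pow]]
    show "(u has_real_derivative u' x) (at x)"
      unfolding u_def[abs_def] u'_def by (simp add: field_simps)
    have "x ^ k \<le> x ^ 2" using x s k2 by (intro power_decreasing) auto
    also have "x ^ 2 < u x" unfolding u_def
    proof (rule real_less_rsqrt)
      have "x * x ^ 3 < c * x ^ 3" using s c x by (intro mult_strict_right_mono) auto
      then show "(x ^ 2)\<^sup>2 < c * x ^ 3" by (simp add: power_numeral_reduce)
    qed
    finally show "x ^ k < u x" .
    show "u x \<le> x" unfolding u_def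
    proof (rule real_le_lsqrt)
      have "(c * x) * x\<^sup>2 \<le> 1 * x\<^sup>2" using s by (intro mult_right_mono) auto
      then show "c * x ^ 3 \<le> x\<^sup>2" by (simp add: power_numeral_reduce)
    qed (use x in auto)
  next
    have "((\<lambda>x. sqrt (c * x)) \<longlongrightarrow> sqrt (c * 0)) (at_right 0)"
      by (intro tendsto_intros)
    moreover have "\<forall>\<^sub>F x in at_right 0. sqrt (c * x) = u x / x"
    proof (rule eventually_at_right_less[THEN eventually_mono])
      fix x :: real assume x: "0 < x"
      have "sqrt (c * x) = sqrt (c * x ^ 3 / x\<^sup>2)" using x by (simp add: power_numeral_reduce)
      then show "sqrt (c * x) = u x / x" using x by (simp add: u_def real_sqrt_divide)
    qed
    ultimately show "((\<lambda>x. u x / x) \<longlongrightarrow> 0) (at_right 0)"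
      by (auto intro: Lim_transform_eventually)
  qed
  show ?thesis
  proof (rule orbit_in_forward_invariant_wedge)
    fix p assume p: "in_wedge p"
    define x where "x = fst p"
    have x: "0 < x" "x \<le> \<delta>" using p by (auto simp: in_wedge_def x_def)
    note s = small[OF x]
    have xr: "\<bar>x\<bar> \<le> \<rho>" using x \<delta>_le_\<rho> by auto
    note R = in_wedgeD[OF p]
    {
      assume "W p = fst p ^ k"
      then have "\<bar>V p - real k * x ^ (k - 1) * fst (X p) - a * x ^ k\<bar> \<le> C * x ^ (k + 1)"
        unfolding x_def C_def using small \<delta> f_exp
        by (intro lower_barrier[OF k2 _ M _ p]) (auto simp: less_imp_le)
      also have "\<dots> = C * x * x ^ k" by simp
      also have "\<dots> < a * x ^ k" using s x by (intro mult_strict_right_mono) auto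
      finally show "real k * fst p ^ (k - 1) * fst (X p) < V p" unfolding x_def by linarith
    next
      assume "W p = u (fst p)"
      then have w: "W p = sqrt (c * x ^ 3)" by (simp add: u_def x_def)
      have "\<bar>f x\<bar> \<le> K * x\<^sup>2" by (rule f_bound[OF xr])
      moreover have "\<bar>\<Phi> x * W p\<bar> \<le> K * x\<^sup>2"
      proof -
        have "\<bar>\<Phi> x\<bar> * W p \<le> K * x * x"
          using \<Phi>_bound[OF xr] R(2,3) x K by (intro mult_mono) (auto simp: x_def)
        then show ?thesis using R(2) by (simp add: abs_mult power2_eq_square mult.assoc)
      qed
      moreover have "K * (W p)\<^sup>2 \<le> K * x\<^sup>2"
        using R(2,3) K by (intro mult_left_mono power_mono) (auto simp: x_def)
      moreover have "\<bar>V p - f x - \<Phi> x * W p\<bar> \<le> K * (W p)\<^sup>2"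
        using V_near[OF R(1)] by (simp add: x_def)
      ultimately have "V p \<le> 3 * K * x\<^sup>2" by linarith
      also have "\<dots> < 3 * c * x\<^sup>2 / 4" using x by (simp add: c_def)
      also have "\<dots> = u' x * (W p / 2)" using x c by (simp add: u'_def w)
      also have "\<dots> \<le> u' x * fst (X p)"
      proof (rule mult_left_mono)
        show "W p / 2 \<le> fst (X p)" using R(4) by linarith
        show "0 \<le> u' x" using x c by (simp add: u'_def)
      qed
      finally show "V p < u' (fst p) * fst (X p)" by (simp add: x_def)
    }
  qed (rule that)
qed

text \<open>
  With \<open>B\<^sup>2 + 4 a n = 0\<close> the curve \<open>w = c\<^sub>0 x\<^sup>n\<close>, \<open>c\<^sub>0 = B / (2 n)\<close>, is only critical at leading order. The
  logarithmic correction in the upper barrier \<open>w = x\<^sup>n (c\<^sub>0 + \<eta> / ln x)\<close> gains a term of order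
  \<open>1 / (ln x)\<^sup>2\<close>, which beats every error of order \<open>x\<close>.
\<close>

lemma orbit_if_real_roots:
  fixes m :: nat
  assumes m: "m \<ge> 1" and a: "a < 0" and B: "B > 0" and disc: "B\<^sup>2 + 4 * a * real (m + 1) \<ge> 0"
    and M: "M \<ge> 0" and \<delta>0: "\<delta>\<^sub>0 > 0"
    and f_exp: "\<And>x. 0 < x \<Longrightarrow> x \<le> \<delta>\<^sub>0 \<Longrightarrow> \<bar>f x - a * x ^ (2 * m + 1)\<bar> \<le> M * x ^ (2 * m + 2)"
    and \<Phi>_lower: "\<And>x. 0 < x \<Longrightarrow> x \<le> \<delta>\<^sub>0 \<Longrightarrow> B * x ^ m - M * x ^ (m + 1) \<le> \<Phi> x"
  obtains \<eta> where "reverse_orbit \<eta>"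
proof -
  define N where "N = real (m + 1)"
  have N: "N \<ge> 2" using m by (simp add: N_def)
  \<comment> \<open>\<open>c\<close> is the vertex of the parabola \<open>a + B v - N v^2\<close>,
    whose value there is \<open>a + N c^2 >= 0\<close>. The choice of \<open>e\<close> makes the
    loss \<open>N (v x - c)^2\<close> equal to \<open>l c / 2\<close> for
    \<open>l = e / (ln x)^2\<close>, whereas the bent edge gains \<open>l * v x\<close>, at least
    \<open>3 l c / 4\<close>.\<close>
  define c where "c = B / (2 * N)"
  define e where "e = c / (2 * N)"
  define k where "k = 2 * m + 1"
  define C where "C = M + 2 * K + 2 * real k"
  \<comment> \<open>Collects the coefficients of all errors of relative order \<open>x\<close>,
    using \<open>v x <= c\<close>. The bound imposed on \<open>x * (ln x)^2\<close> below says that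
    \<open>x * D\<close> is less than the net gain \<open>e c / (4 (ln x)^2)\<close>.\<close>
  define D where "D = M + M * c + (K + 2 * N * K) * c\<^sup>2"
  define v where "v x = c + e / ln x" for x
  define u where "u x = x ^ (m + 1) * v x" for x
  define u' where "u' x = x ^ m * (N * v x - e / (ln x)\<^sup>2)" for x
  have c: "c > 0" and e: "e > 0" using B N by (simp_all add: c_def e_def)
  have C: "C > 0" using K M by (auto simp: C_def intro!: add_nonneg_pos)
  have D: "D > 0" using K M N c unfolding D_def by (intro add_nonneg_pos mult_pos_pos add_pos_pos) auto
  have "((\<lambda>x::real. x * (ln x)\<^sup>2) \<longlongrightarrow> 0) (at_right 0)" by real_asymp
  then have "\<forall>\<^sub>F x in at_right 0. x * (ln x)\<^sup>2 < e * c / (4 * D)"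
    by (rule order_tendstoD(2)) (use e c D in simp)
  moreover have "\<forall>\<^sub>F x in at_right 0. x * (2 + K * x) < \<rho> \<and> 4 * K * x < 1 \<and> C * x < - a \<and>
      x < \<delta>\<^sub>0 \<and> x < exp (- 1) \<and> x < c / 2 \<and> c * x < 1"
    using \<rho> a \<delta>0 c by (intro eventually_conj eventually_less_at_right_0) auto
  ultimately obtain \<delta> where \<delta>: "\<delta> > 0" and \<delta>': "\<And>x. 0 < x \<Longrightarrow> x \<le> \<delta> \<Longrightarrow>
      x * (ln x)\<^sup>2 < e * c / (4 * D) \<and> x * (2 + K * x) < \<rho> \<and> 4 * K * x < 1 \<and> C * x < - a \<and>
      x < \<delta>\<^sub>0 \<and> x < exp (- 1) \<and> x < c / 2 \<and> c * x < 1"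
    using eventually_at_right_0_obtain[OF eventually_conj] by blast
  have small: "x * (ln x)\<^sup>2 * (4 * D) < e * c" "x * (2 + K * x) < \<rho>" "4 * K * x < 1" "C * x < - a"
      "x < \<delta>\<^sub>0" "ln x \<le> - 1" "x < c / 2" "c * x < 1" "x \<le> 1"
    if "0 < x" "x \<le> \<delta>" for x
  proof -
    have *: "x * (ln x)\<^sup>2 < e * c / (4 * D)" "x * (2 + K * x) < \<rho>" "4 * K * x < 1" "C * x < - a"
      "x < \<delta>\<^sub>0" "x < exp (- 1)" "x < c / 2" "c * x < 1"
      using \<delta>'[OF that] by auto
    then show "x * (2 + K * x) < \<rho>" "4 * K * x < 1" "C * x < - a" "x < \<delta>\<^sub>0" "x < c / 2" "c * x < 1"
      by auto
    show "x * (ln x)\<^sup>2 * (4 * D) < e * c" using *(1) D by (simp add: pos_less_divide_eq)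
    have "ln x < ln (exp (- 1))" using *(6) that by (subst ln_less_cancel_iff) auto
    then show "ln x \<le> - 1" by simp
    have "exp (- 1 :: real) \<le> 1" by simp
    with *(6) show "x \<le> 1" by linarith
  qed
  have v: "c / 2 \<le> v x - c / 4" "v x \<le> c" if "0 < x" "x \<le> \<delta>" for x
  proof -
    note l = small(6)[OF that]
    have "e / ln x \<le> 0" using e l by (simp add: divide_le_0_iff)
    then show "v x \<le> c" by (simp add: v_def)
    have "- (e / ln x) = e / (- ln x)" by simp
    also have "\<dots> \<le> e / 1" using e l by (intro divide_left_mono) auto
    also have "\<dots> \<le> c / 4"
    proof -
      have "e * 4 \<le> e * (2 * N)" using e N by (intro mult_left_mono) auto
      also have "e * (2 * N) = c" using N by (simp add: e_def)
      finally show ?thesis by simp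
    qed
    finally show "c / 2 \<le> v x - c / 4" by (simp add: v_def)
  qed
  interpret wedge X F F' f \<Phi> \<rho> K L \<delta> k u u'
  proof
    show "0 < \<delta>" "1 \<le> k" using \<delta> by (auto simp: k_def)
    show "\<delta> * (2 + K * \<delta>) \<le> \<rho>" "4 * K * \<delta> \<le> 1"
      using small[of \<delta>] \<delta> by auto
    fix x :: real assume x: "0 < x" "x \<le> \<delta>"
    note s = small[OF x] and vx = v[OF x]
    have lnz: "ln x \<noteq> 0" using s(6) by auto
    have vd: "(v has_real_derivative - (e / (x * (ln x)\<^sup>2))) (at x)"
      unfolding v_def[abs_def] using x lnz
      by (auto intro!: derivative_eq_intros simp: power2_eq_square)
    have "((\<lambda>x. x ^ (m + 1)) has_real_derivative N * x ^ m) (at x)"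
      using DERIV_pow[of "m + 1" x] by (simp add: N_def)
    from DERIV_mult[OF this vd]
    have "(u has_real_derivative N * x ^ m * v x + - (e / (x * (ln x)\<^sup>2)) * x ^ (m + 1)) (at x)"
      by (simp add: u_def[abs_def])
    also have "N * x ^ m * v x + - (e / (x * (ln x)\<^sup>2)) * x ^ (m + 1) = u' x"
      using x by (simp add: u'_def algebra_simps)
    finally show "(u has_real_derivative u' x) (at x)" .
    have xm: "x ^ m \<le> x" using power_decreasing[OF m, of x] x s by simp
    have "x ^ k = x ^ (m + 1) * x ^ m" by (simp add: k_def mult_2 power_add)
    also have "\<dots> < x ^ (m + 1) * v x"
      using xm s(7) vx c x by (intro mult_strict_left_mono) auto
    finally show "x ^ k < u x" by (simp add: u_def)
    have "x ^ m * v x \<le> x * c" using xm vx c x by (intro mult_mono) auto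
    also have "\<dots> \<le> 1" using s by (simp add: mult.commute)
    finally have "x * (x ^ m * v x) \<le> x * 1" using x by (intro mult_left_mono) auto
    then show "u x \<le> x" by (simp add: u_def)
  next
    have z: "((\<lambda>x. c * x) \<longlongrightarrow> 0) (at_right 0)"
      by (rule tendsto_eq_intros refl | simp)+
    show "((\<lambda>x. u x / x) \<longlongrightarrow> 0) (at_right 0)"
    proof (rule Lim_null_comparison[OF _ z])
      have "\<forall>\<^sub>F x in at_right 0. x \<in> {0<..<\<delta>}"
        using \<delta> by (intro eventually_at_right_real)
      then show "\<forall>\<^sub>F x in at_right 0. norm (u x / x) \<le> c * x"
      proof eventually_elim
        case (elim x)
        then have x: "0 < x" "x \<le> \<delta>" by auto
        note s = small[OF x] and vx = v[OF x]
        have xm: "x ^ m \<le> x" using power_decreasing[OF m, of x] x s by simp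
        have "u x / x = x ^ m * v x" using x by (simp add: u_def)
        moreover have "x ^ m * v x \<le> x * c" using xm vx c x by (intro mult_mono) auto
        moreover have "0 \<le> x ^ m * v x" using x vx c by simp
        ultimately show ?case by (simp add: mult.commute)
      qed
    qed
  qed
  \<comment> \<open>The field leaves through both curved edges: \<open>a < 0\<close> pushes down on
    the lower one, and the lower bound for \<Phi> lifts orbits across the upper one.\<close>
  show ?thesis
  proof (rule orbit_in_backward_invariant_wedge)
    fix p assume p: "in_wedge p"
    define x where "x = fst p"
    have x: "0 < x" "x \<le> \<delta>" using p by (auto simp: in_wedge_def x_def)
    note s = small[OF x] and vx = v[OF x]
    have xr: "\<bar>x\<bar> \<le> \<rho>" using x \<delta>_le_\<rho> by auto
    note R = in_wedgeD[OF p]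
    {
      assume "W p = fst p ^ k"
      then have "\<bar>V p - real k * x ^ (k - 1) * fst (X p) - a * x ^ k\<bar> \<le> C * x ^ (k + 1)"
        unfolding x_def C_def using small \<delta> f_exp m
        by (intro lower_barrier[OF _ _ M _ p]) (auto simp: less_imp_le k_def)
      also have "\<dots> = C * x * x ^ k" by simp
      also have "\<dots> < - a * x ^ k" using s x by (intro mult_strict_right_mono) auto
      finally show "V p < real k * fst p ^ (k - 1) * fst (X p)" unfolding x_def by simp
    next
      assume Wp: "W p = u (fst p)"
      define w where "w = W p"
      define y where "y = x ^ m"
      define z where "z = v x"
      define l where "l = e / (ln x)\<^sup>2"
      have y: "y > 0" using x by (simp add: y_def)
      have z: "z > 0" "z \<le> c" "z \<ge> c / 2 + c / 4" using vx c by (auto simp: z_def)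
      have w: "w = x * y * z" using Wp by (simp add: w_def u_def x_def y_def z_def)
      have l: "0 < l" "l \<le> e"
      proof -
        have 1: "1 \<le> (ln x)\<^sup>2" using s(6) power_mono[of 1 "- ln x" 2] by simp
        then show "0 < l" using e unfolding l_def by (intro divide_pos_pos) auto
        have "e / (ln x)\<^sup>2 \<le> e / 1" using 1 e by (intro divide_left_mono) auto
        then show "l \<le> e" by (simp add: l_def)
      qed
      have u': "u' (fst p) = y * (N * z - l)" by (simp add: u'_def x_def y_def z_def l_def)
      have fx: "x * y\<^sup>2 * (a - M * x) \<le> f x"
      proof -
        have "x ^ (2 * m) = y\<^sup>2" by (simp add: y_def mult.commute flip: power_mult)
        then have "x ^ (2 * m + 1) = x * y\<^sup>2" "x ^ (2 * m + 2) = x * y\<^sup>2 * x" by simp_all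
        with f_exp[of x] x s show ?thesis by (simp add: algebra_simps abs_le_iff)
      qed
      have \<Phi>x: "x * y\<^sup>2 * (B * z - M * x * z) \<le> \<Phi> x * w"
      proof -
        have "(B * y - M * (x * y)) * w \<le> \<Phi> x * w"
          using \<Phi>_lower[of x] x s y z by (intro mult_right_mono) (auto simp: y_def w)
        then show ?thesis by (simp add: w power2_eq_square algebra_simps)
      qed
      have Kw: "K * w\<^sup>2 \<le> x * y\<^sup>2 * (x * (K * z\<^sup>2))"
        by (simp add: w power2_eq_square mult_ac)
      have V: "x * y\<^sup>2 * (a + B * z - x * (M + M * z + K * z\<^sup>2)) \<le> V p"
      proof -
        have "f x + \<Phi> x * w - K * w\<^sup>2 \<le> V p"
          using V_near[OF R(1)] by (simp add: x_def w_def)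
        then show ?thesis using fx \<Phi>x Kw by (simp add: algebra_simps)
      qed
      have X1: "fst (X p) \<le> w * (1 + 2 * K * x)"
      proof -
        have "\<bar>fst (X p) - w\<bar> \<le> K * w * (x + w)"
          using fst_field[OF R(1)] R(2) x by (simp add: W_def w_def x_def)
        also have "\<dots> \<le> K * w * (2 * x)"
          using R(2,3) K by (intro mult_left_mono) (auto simp: w_def x_def)
        finally show ?thesis by (simp add: algebra_simps)
      qed
      have Nz: "0 \<le> N * z - l"
      proof -
        have "e \<le> c" unfolding e_def using c N by (simp add: pos_divide_le_eq)
        moreover have "2 * (c / 2) \<le> N * z" using N z c by (intro mult_mono) auto
        ultimately show ?thesis using l by simp
      qed
      have "u' (fst p) * fst (X p) \<le> u' (fst p) * (w * (1 + 2 * K * x))"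
        using X1 Nz y by (intro mult_left_mono) (auto simp: u')
      also have "\<dots> = x * y\<^sup>2 * ((N * z - l) * z + (N * z - l) * (z * (2 * K * x)))"
        by (simp add: u' w power2_eq_square algebra_simps)
      also have "\<dots> \<le> x * y\<^sup>2 * ((N * z - l) * z + N * z * (z * (2 * K * x)))"
        using x y z l K by (intro mult_left_mono add_left_mono mult_right_mono) auto
      also have "\<dots> < x * y\<^sup>2 * (a + B * z - x * (M + M * z + K * z\<^sup>2))"
      proof (rule mult_strict_left_mono)
        have "x * (M + M * z + (K + 2 * N * K) * z\<^sup>2) \<le> x * D"
          unfolding D_def using x M K N z
          by (intro mult_left_mono add_mono power_mono) (auto intro: mult_left_mono)
        also have "x * D < l * c / 4"
        proof -
          have "0 < (ln x)\<^sup>2" using s(6) by simp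
          then show ?thesis using s(1) by (simp add: l_def pos_less_divide_eq mult_ac)
        qed
        also have "l * c / 4 \<le> l * (z - c / 2)" using l z by (simp add: algebra_simps)
        also have "\<dots> \<le> a + B * z - N * z\<^sup>2 + l * z"
        proof -
          have B: "B = 2 * N * c" using N by (simp add: c_def)
          have aN: "a + N * c\<^sup>2 \<ge> 0"
          proof -
            have "N * (a + N * c\<^sup>2) \<ge> 0" using disc unfolding B N_def[symmetric]
              by (simp add: power2_eq_square algebra_simps)
            then show ?thesis using N by (simp add: zero_le_mult_iff)
          qed
          have "N * (z - c)\<^sup>2 = l * (c / 2)"
            using N by (simp add: z_def v_def l_def power2_eq_square) (simp add: e_def)
          moreover have "B * z - N * z\<^sup>2 = N * c\<^sup>2 - N * (z - c)\<^sup>2"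
            unfolding B by (simp add: power2_eq_square algebra_simps)
          ultimately show ?thesis using aN by (simp add: algebra_simps)
        qed
        finally show "(N * z - l) * z + N * z * (z * (2 * K * x)) < a + B * z - x * (M + M * z + K * z\<^sup>2)"
          by (simp add: power2_eq_square algebra_simps)
      qed (use x y in simp)
      also note V
      finally show "u' (fst p) * fst (X p) < V p" .
    }
  qed (rule that)
qed

end

section \<open>Reduction to the normal form\<close>

lemma tends_with_tangent_mirror:
  "tends_with_tangent (\<lambda>t. z (- t)) p at_bot \<longleftrightarrow> tends_with_tangent z p at_top"
  by (simp add: tends_with_tangent_def at_bot_mirror filterlim_filtermap eventually_filtermap)

lemma has_vector_derivative_mirror:
  fixes z :: "real \<Rightarrow> 'a::real_normed_vector"
  assumes "(z has_vector_derivative D) (at (- t) within uminus ` S)"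
  shows "((\<lambda>t. z (- t)) has_vector_derivative - D) (at t within S)"
proof -
  have "(uminus has_vector_derivative - 1) (at t within S)"
    by (auto intro!: derivative_eq_intros)
  from vector_diff_chain_within[OF this assms] show ?thesis by (simp add: o_def)
qed

lemma uminus_atLeast_0: "uminus ` {0..} = {..0 :: real}" "uminus ` {..0} = {0 :: real..}"
  by (simp_all add: image_uminus_atLeast image_uminus_atMost)

lemma flip_field_flip_field:
  assumes "\<bar>s\<bar> = 1" "\<bar>\<sigma>\<bar> = 1"
  shows "flip_field s \<sigma> (flip_field s \<sigma> X) = X"
proof
  fix p
  have "(s * \<sigma>) * (s * \<sigma>) = 1" using assms by (auto dest!: abs_eq_1_cases)
  then show "flip_field s \<sigma> (flip_field s \<sigma> X) p = X p"
    by (simp add: flip_field_def flip_flip assms linear_cmul[OF linear_flip])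
qed

context nilpotent_field
begin

lemma shrink:
  assumes "0 < \<rho>'" "\<rho>' \<le> \<rho>"
  shows "nilpotent_field X F F' f \<Phi> \<rho>' K L"
proof -
  have sub: "cball 0 \<rho>' \<subseteq> cball (0 :: real \<times> real) \<rho>" using assms by auto
  show ?thesis
  proof
    show "L-lipschitz_on (cball 0 \<rho>') X" using lip sub by (rule lipschitz_on_subset)
  qed (use assms K X0 F0 F_deriv F'_bound fst_field[OF subsetD[OF sub]]
      snd_field[OF subsetD[OF sub]] f_bound \<Phi>_bound in auto)
qed

text \<open>The reflected curve solves \<open>X\<close> with time factor
  \<open>- (s * \<sigma>)\<close>. It is a forward orbit if \<open>s * \<sigma> = - 1\<close> and,
  after mirroring time, a backward orbit otherwise; both kinds are characteristic.\<close>

lemma characteristic_orbit_of_flip: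
  assumes s: "\<bar>s\<bar> = 1" "\<bar>\<sigma>\<bar> = 1" and U: "cball 0 \<rho> \<subseteq> U"
    and orbit: "nilpotent_field.reverse_orbit (flip_field s \<sigma> X) \<rho> \<eta>"
  shows "\<exists>z. characteristic_orbit X U 0 z"
proof -
  note fl = nilpotent_field.reverse_orbit_def[OF flip[OF s]]
  have ball: "\<eta> t \<in> cball 0 \<rho>"
    and curve: "(\<eta> has_vector_derivative - flip_field s \<sigma> X (\<eta> t)) (at t within {0..})"
    if "0 \<le> t" for t
    using orbit that by (auto simp: fl)
  have tan: "tends_with_tangent \<eta> 0 at_top" using orbit by (simp add: fl)
  define z where "z t = flip s \<sigma> (\<eta> t)" for t
  have zt: "tends_with_tangent z 0 at_top"
    unfolding z_def by (rule tends_with_tangent_flip[OF tan s])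
  have zU: "z t \<in> U" if "0 \<le> t" for t
    using ball[OF that] U by (auto simp: z_def norm_flip s)
  have z: "(z has_vector_derivative (- 1 * (s * \<sigma>)) *\<^sub>R X (z t)) (at t within {0..})" if "0 \<le> t" for t
    using curve_flip[of \<eta> "- 1" "flip_field s \<sigma> X" t "{0..}", OF _ s] curve[OF that]
    by (simp add: z_def[abs_def] flip_field_flip_field s)
  consider "s * \<sigma> = 1" | "s * \<sigma> = - 1"
    using s by (auto dest!: abs_eq_1_cases)
  then show ?thesis
  proof cases
    case 1
    have "((\<lambda>t. z (- t)) has_vector_derivative X (z (- t))) (at t within {..0})" if "t \<le> 0" for t
      using has_vector_derivative_mirror[of z "- X (z (- t))" t "{..0}"] z[of "- t"] that 1
      by (simp add: uminus_atLeast_0)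
    then have "integral_curve_on X U {..0} (\<lambda>t. z (- t))"
      using zU by (simp add: integral_curve_on_def)
    with zt show ?thesis unfolding characteristic_orbit_def
      by (intro exI[of _ "\<lambda>t. z (- t)"]) (simp add: tends_with_tangent_mirror)
  next
    case 2
    have "integral_curve_on X U {0..} z"
      using zU z 2 by (simp add: integral_curve_on_def)
    with zt show ?thesis by (auto simp: characteristic_orbit_def)
  qed
qed

text \<open>An orbit arriving in backward time becomes a forward one under the reflection of
  \<open>y\<close>, which reverses time. This keeps \<open>a\<close> and turns \<open>B\<close> into
  \<open>- B\<close>, so the discriminant is unchanged.\<close>

lemma no_characteristic_orbit:
  fixes m :: nat
  assumes M: "M \<ge> 0"
    and f_exp: "\<And>x. \<bar>x\<bar> \<le> \<rho> \<Longrightarrow> \<bar>f x - a * x ^ (2 * m + 1)\<bar> \<le> M * \<bar>x\<bar> ^ (2 * m + 2)"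
    and \<Phi>_exp: "\<And>x. \<bar>x\<bar> \<le> \<rho> \<Longrightarrow> \<bar>\<Phi> x - B * x ^ m\<bar> \<le> M * \<bar>x\<bar> ^ (m + 1)"
    and disc: "B\<^sup>2 + 4 * a * real (m + 1) < 0"
  shows "\<not> characteristic_orbit X U 0 z"
proof
  assume "characteristic_orbit X U 0 z"
  then consider
    "integral_curve_on X U {0..} z" "tends_with_tangent z 0 at_top" |
    "integral_curve_on X U {..0} z" "tends_with_tangent z 0 at_bot"
    by (auto simp: characteristic_orbit_def)
  then show False
  proof cases
    case 1
    have "\<forall>\<^sub>F t in at_top. norm (z t) < \<rho>"
      using 1(2) \<rho> by (intro order_tendstoD(2)[OF tendsto_norm_zero])
        (auto simp: tends_with_tangent_def)
    with eventually_gt_at_top[of 0]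
    have "\<forall>\<^sub>F t in at_top. z t \<in> cball 0 \<rho> \<and> (z has_vector_derivative X (z t)) (at t)"
    proof eventually_elim
      case (elim t)
      have "at t within {0..} = at t" using elim by (intro at_within_interior) simp
      moreover have "(z has_vector_derivative X (z t)) (at t within {0..})"
        using 1(1) elim by (simp add: integral_curve_on_def)
      ultimately show ?case using elim by simp
    qed
    from no_tangent_orbit[OF M f_exp \<Phi>_exp disc this 1(2)] show False .
  next
    case 2
    define \<eta> where "\<eta> t = flip 1 (- 1) (z (- t))" for t
    have tan: "tends_with_tangent (\<lambda>t. z (- t)) 0 at_top"
      using tends_with_tangent_mirror[of "\<lambda>t. z (- t)" 0] 2(2) by simp
    then have \<eta>t: "tends_with_tangent \<eta> 0 at_top"
      unfolding \<eta>_def by (intro tends_with_tangent_flip) auto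
    interpret fl: nilpotent_field "flip_field 1 (-1) X" "\<lambda>x. - 1 * F (1 * x)"
      "\<lambda>x. - 1 * 1 * F' (1 * x)" "\<lambda>x. 1 * f (1 * x)" "\<lambda>x. 1 * - 1 * \<Phi> (1 * x)" \<rho> K L
      by (rule flip) auto
    have "\<forall>\<^sub>F t in at_top. norm (\<eta> t) < \<rho>"
      using \<eta>t \<rho> by (intro order_tendstoD(2)[OF tendsto_norm_zero])
        (auto simp: tends_with_tangent_def)
    with eventually_gt_at_top[of 0]
    have "\<forall>\<^sub>F t in at_top. \<eta> t \<in> cball 0 \<rho> \<and>
      (\<eta> has_vector_derivative flip_field 1 (-1) X (\<eta> t)) (at t)"
    proof eventually_elim
      case (elim t)
      have "at (- t) within {..0} = at (- t)" using elim by (intro at_within_interior) simp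
      moreover have "(z has_vector_derivative X (z (- t))) (at (- t) within {..0})"
        using 2(1) elim by (simp add: integral_curve_on_def)
      ultimately have "(z has_vector_derivative X (z (- t))) (at (- t))" by simp
      from has_vector_derivative_mirror[of z _ t UNIV, simplified, OF this]
      have "((\<lambda>t. z (- t)) has_vector_derivative (- 1) *\<^sub>R X (z (- t))) (at t)" by simp
      from curve_flip[where X = X and c = "- 1" and z = "\<lambda>t. z (- t)" and t = t and s = 1 and \<sigma> = "- 1", OF this]
      have "(\<eta> has_vector_derivative flip_field 1 (-1) X (\<eta> t)) (at t)"
        by (simp add: \<eta>_def[abs_def])
      with elim show ?case by simp
    qed
    then show False
    proof (rule fl.no_tangent_orbit[OF M, where m = m and a = a and B = "- B", rotated 3])
      show "(- B)\<^sup>2 + 4 * a * real (m + 1) < 0" using disc by simp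
      fix x :: real assume x: "\<bar>x\<bar> \<le> \<rho>"
      show "\<bar>1 * f (1 * x) - a * x ^ (2 * m + 1)\<bar> \<le> M * \<bar>x\<bar> ^ (2 * m + 2)"
        using f_exp[OF x] by simp
      show "\<bar>1 * - 1 * \<Phi> (1 * x) - - B * x ^ m\<bar> \<le> M * \<bar>x\<bar> ^ (m + 1)"
        using \<Phi>_exp[OF x] by (simp add: abs_minus_commute)
    qed (rule \<eta>t)
  qed
qed

end

section \<open>Vanishing 1-jets and regularity of the implicit curve\<close>

lemma jet_1_zero:
  fixes G :: "real \<times> real \<Rightarrow> real"
  assumes jet: "jet 1 G = (\<lambda>_. 0)" and G: "G differentiable (at 0)"
  shows "G 0 = 0" "frechet_derivative G (at 0) v = 0"
proof -
  have j: "G 0 + deriv (\<lambda>t. G (t *\<^sub>R v)) 0 = 0" for v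
    using fun_cong[OF jet, of v] by (simp add: jet_def)
  from j[of 0] show G0: "G 0 = 0" by simp
  have "((\<lambda>t. t *\<^sub>R v) has_derivative (\<lambda>t. t *\<^sub>R v)) (at (0 :: real))"
    by (auto intro!: derivative_eq_intros)
  moreover have D: "(G has_derivative frechet_derivative G (at 0)) (at 0)"
    using G by (simp add: frechet_derivative_works)
  ultimately have "((\<lambda>t. G (t *\<^sub>R v)) has_derivative (\<lambda>t. frechet_derivative G (at 0) (t *\<^sub>R v))) (at 0)"
    using has_derivative_compose[of "\<lambda>t. t *\<^sub>R v" "\<lambda>t. t *\<^sub>R v" 0 UNIV G] by simp
  then have "((\<lambda>t. G (t *\<^sub>R v)) has_real_derivative frechet_derivative G (at 0) v) (at 0)"
    unfolding has_field_derivative_def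
    by (rule has_derivative_eq_rhs)
      (simp add: linear_cmul[OF has_derivative_linear[OF D]] fun_eq_iff)
  from DERIV_imp_deriv[OF this] j[of v] G0 show "frechet_derivative G (at 0) v = 0" by simp
qed

definition partial_fst :: "(real \<times> real \<Rightarrow> real) \<Rightarrow> real \<times> real \<Rightarrow> real" where
  "partial_fst h p = frechet_derivative h (at p) (1, 0)"

definition partial_snd :: "(real \<times> real \<Rightarrow> real) \<Rightarrow> real \<times> real \<Rightarrow> real" where
  "partial_snd h p = frechet_derivative h (at p) (0, 1)"

lemma C_diff_on_partials:
  assumes "C_diff_on (Suc k) h U"
  shows "C_diff_on k (partial_fst h) U" "C_diff_on k (partial_snd h) U"
  using assms by (auto simp: partial_fst_def[abs_def] partial_snd_def[abs_def] Basis_prod_def)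

lemma has_derivative_partials:
  "C_diff_on (Suc k) h U \<Longrightarrow> p \<in> U \<Longrightarrow>
    (h has_derivative (\<lambda>v. fst v * partial_fst h p + snd v * partial_snd h p)) (at p)"
  unfolding partial_fst_def partial_snd_def by (rule C_diff_on_Suc_has_derivative)

text \<open>What class \<open>C^2\<close> and a vanishing 1-jet provide for \<open>X\<^sub>2\<close>
  and \<open>Y\<^sub>2\<close> alike. \<open>K\<close> is a parameter so that both can share one
  constant.\<close>

locale flat_function =
  fixes h :: "real \<times> real \<Rightarrow> real" and R K :: real
  assumes R: "0 < R" and K: "1 \<le> K" and h0: "h 0 = 0"
    and deriv: "p \<in> cball 0 R \<Longrightarrow>
      (h has_derivative (\<lambda>v. fst v * partial_fst h p + snd v * partial_snd h p)) (at p)"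
    and lip: "K-lipschitz_on (cball 0 R) h"
      "K-lipschitz_on (cball 0 R) (partial_fst h)" "K-lipschitz_on (cball 0 R) (partial_snd h)"
    and partials_0: "partial_fst h 0 = 0" "partial_snd h 0 = 0"
begin

lemma partials_bound:
  assumes "p \<in> cball 0 R"
  shows "\<bar>partial_fst h p\<bar> \<le> K * norm p" "\<bar>partial_snd h p\<bar> \<le> K * norm p"
  using lipschitz_onD[OF lip(2) assms, of 0] lipschitz_onD[OF lip(3) assms, of 0] R
  by (simp_all add: partials_0 dist_norm)

lemma remainder:
  "p \<in> cball 0 R \<Longrightarrow> q \<in> cball 0 R \<Longrightarrow>
    \<bar>h q - h p - (fst q - fst p) * partial_fst h p - (snd q - snd p) * partial_snd h p\<bar>
    \<le> 2 * K * (norm (q - p))\<^sup>2"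
  by (rule quadratic_remainder[where S = "cball 0 R", OF deriv convex_cball lip(2,3)])

lemma bound: "p \<in> cball 0 R \<Longrightarrow> \<bar>h p\<bar> \<le> 2 * K * (norm p)\<^sup>2"
  using remainder[of 0 p] R by (simp add: h0 partials_0)

end

lemma flat_function_on_cball:
  assumes h: "C_diff_on (Suc (Suc k)) h U" and jet: "jet 1 h = (\<lambda>_. 0)"
    and R: "0 < R" "cball 0 R \<subseteq> U"
  obtains K where "\<And>K'. K \<le> K' \<Longrightarrow> flat_function h R K'"
proof -
  note h1 = C_diff_on_Suc_imp[OF h] and part = C_diff_on_partials[OF h]
  obtain L1 L2 L3 where L: "L1-lipschitz_on (cball 0 R) h"
    "L2-lipschitz_on (cball 0 R) (partial_fst h)" "L3-lipschitz_on (cball 0 R) (partial_snd h)"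
    using C_diff_on_Suc_lipschitz_on_cball[OF h1 R(2)]
      C_diff_on_Suc_lipschitz_on_cball[OF part(1) R(2)]
      C_diff_on_Suc_lipschitz_on_cball[OF part(2) R(2)] by metis
  have "0 \<in> U" using subsetD[OF R(2), of 0] R(1) by simp
  then have "h differentiable (at 0)" using h by simp
  note j = jet_1_zero[OF jet this]
  show ?thesis
  proof (rule that[of "Max {1, L1, L2, L3}"])
    fix K assume "Max {1, L1, L2, L3} \<le> K"
    then have K: "1 \<le> K" "L1 \<le> K" "L2 \<le> K" "L3 \<le> K" by auto
    show "flat_function h R K"
      using R(1) K j has_derivative_partials[OF h subsetD[OF R(2)]] L[THEN lipschitz_on_le]
      by unfold_locales (auto simp: partial_fst_def partial_snd_def)
  qed
qed

text \<open>Of \<open>F\<close> only continuity at 0 is given. Where the partial derivatives are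
  small, the remainder estimate between two points of the graph shows that \<open>F\<close> is
  1-Lipschitz; with this, the same estimate identifies the limit of the difference
  quotients.\<close>

lemma (in flat_function) implicit_graph:
  assumes F: "implicit_solution (\<lambda>(x, y). y + h (x, y)) F"
  obtains \<delta> where "0 < \<delta>" "2 * \<delta> \<le> R"
    "\<And>x. \<bar>x\<bar> \<le> \<delta> \<Longrightarrow> F x + h (x, F x) = 0"
    "\<And>x. \<bar>x\<bar> \<le> \<delta> \<Longrightarrow> \<bar>F x\<bar> \<le> \<bar>x\<bar>"
    "\<And>x. \<bar>x\<bar> \<le> \<delta> \<Longrightarrow> (x, F x) \<in> cball 0 R"
    "\<And>x. \<bar>x\<bar> \<le> \<delta> \<Longrightarrow> \<bar>partial_snd h (x, F x)\<bar> \<le> 1 / 2"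
    "\<And>x. \<bar>x\<bar> \<le> \<delta> \<Longrightarrow> (F has_real_derivative
      - (partial_fst h (x, F x) / (1 + partial_snd h (x, F x)))) (at x)"
proof -
  \<comment> \<open>In \<open>contr\<close> the remainder contributes \<open>4 K r\<close> and the
    linear terms \<open>K r\<close>. The bound 1/10 makes the total at most 1/2, so that
    \<open>F y - F x\<close> can be absorbed into the left-hand side.\<close>
  define r where "r = min R (1 / (10 * K))"
  have r: "0 < r" "r \<le> R" using R K by (auto simp: r_def)
  have "K * r \<le> K * (1 / (10 * K))" using K by (intro mult_left_mono) (auto simp: r_def)
  then have Kr: "K * r \<le> 1 / 10" using K by simp
  have F0: "F 0 = 0" using F by (simp add: implicit_solution_def)
  have "(F \<longlongrightarrow> 0) (at 0)" using F F0 by (simp add: implicit_solution_def isCont_def)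
  then have "\<forall>\<^sub>F x in at 0. \<bar>F x\<bar> < r / 2"
    using r by (intro order_tendstoD(2)[OF tendsto_rabs_zero]) auto
  then have "\<forall>\<^sub>F x in nhds 0. \<bar>F x\<bar> < r / 2"
    using r by (simp add: eventually_nhds_conv_at F0)
  moreover have "\<forall>\<^sub>F x in nhds 0. F x + h (x, F x) = 0"
    using F by (simp add: implicit_solution_def)
  ultimately have "\<forall>\<^sub>F x in nhds 0. \<bar>F x\<bar> < r / 2 \<and> F x + h (x, F x) = 0"
    by (rule eventually_conj)
  then obtain d where d: "d > 0" "\<And>x. \<bar>x\<bar> < d \<Longrightarrow> \<bar>F x\<bar> < r / 2 \<and> F x + h (x, F x) = 0"
    unfolding eventually_nhds_metric by auto
  define \<delta>' where "\<delta>' = min d (r / 2)"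
  have \<delta>': "\<delta>' > 0" using d r by (simp add: \<delta>'_def)
  have Fx: "\<bar>F x\<bar> < r / 2" "F x + h (x, F x) = 0" and mem: "norm (x, F x) \<le> r"
    "(x, F x) \<in> cball 0 R" if "\<bar>x\<bar> < \<delta>'" for x
  proof -
    show 1: "\<bar>F x\<bar> < r / 2" "F x + h (x, F x) = 0" using d(2)[of x] that by (auto simp: \<delta>'_def)
    show "norm (x, F x) \<le> r" using norm_Pair_le[of x "F x"] 1 that by (simp add: \<delta>'_def)
    with r show "(x, F x) \<in> cball 0 R" by simp
  qed
  have p1: "\<bar>partial_fst h (x, F x)\<bar> \<le> K * r" and p2: "\<bar>partial_snd h (x, F x)\<bar> \<le> K * r"
    if "\<bar>x\<bar> < \<delta>'" for x
  proof -
    have "K * norm (x, F x) \<le> K * r" using mem(1)[OF that] K by (intro mult_left_mono) auto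
    then show "\<bar>partial_fst h (x, F x)\<bar> \<le> K * r" "\<bar>partial_snd h (x, F x)\<bar> \<le> K * r"
      using partials_bound[OF mem(2)[OF that]] by linarith+
  qed
  have contr: "\<bar>F y - F x\<bar> \<le> \<bar>y - x\<bar>" if x: "\<bar>x\<bar> < \<delta>'" and y: "\<bar>y\<bar> < \<delta>'" for x y
  proof -
    define D where "D = norm ((y, F y) - (x, F x))"
    have D: "D \<le> \<bar>y - x\<bar> + \<bar>F y - F x\<bar>" "D \<le> 2 * r"
      using norm_Pair_le[of "y - x" "F y - F x"] norm_triangle_ineq4[of "(y, F y)" "(x, F x)"]
        mem(1)[OF x] mem(1)[OF y] by (auto simp: D_def)
    have "D\<^sup>2 = D * D" by (simp add: power2_eq_square)
    also have "\<dots> \<le> 2 * r * (\<bar>y - x\<bar> + \<bar>F y - F x\<bar>)"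
      using D r by (intro mult_mono) (auto simp: D_def)
    finally have "2 * K * D\<^sup>2 \<le> 2 * K * (2 * r * (\<bar>y - x\<bar> + \<bar>F y - F x\<bar>))"
      using K by (intro mult_left_mono) auto
    moreover have "\<bar>(y - x) * partial_fst h (x, F x)\<bar> \<le> \<bar>y - x\<bar> * (K * r)"
      "\<bar>(F y - F x) * partial_snd h (x, F x)\<bar> \<le> \<bar>F y - F x\<bar> * (K * r)"
      using p1[OF x] p2[OF x] by (auto simp: abs_mult intro: mult_left_mono)
    moreover have "\<bar>h (y, F y) - h (x, F x) - (y - x) * partial_fst h (x, F x)
        - (F y - F x) * partial_snd h (x, F x)\<bar> \<le> 2 * K * D\<^sup>2"
      using remainder[OF mem(2)[OF x] mem(2)[OF y]] by (simp add: D_def)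
    moreover have "h (y, F y) - h (x, F x) = - (F y - F x)"
      using Fx(2)[OF x] Fx(2)[OF y] by linarith
    moreover have "2 * K * (2 * r * (\<bar>y - x\<bar> + \<bar>F y - F x\<bar>)) + \<bar>y - x\<bar> * (K * r) + \<bar>F y - F x\<bar> * (K * r)
      = 5 * (K * r) * (\<bar>y - x\<bar> + \<bar>F y - F x\<bar>)" by (simp add: algebra_simps)
    moreover have "5 * (K * r) * (\<bar>y - x\<bar> + \<bar>F y - F x\<bar>) \<le> 1 / 2 * (\<bar>y - x\<bar> + \<bar>F y - F x\<bar>)"
      using Kr by (intro mult_right_mono) auto
    ultimately show ?thesis by (simp add: abs_le_iff) linarith
  qed
  have der: "(F has_real_derivative - (partial_fst h (x, F x) / (1 + partial_snd h (x, F x)))) (at x)"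
    if x: "\<bar>x\<bar> < \<delta>'" for x
  proof -
    define A where "A = partial_fst h (x, F x)"
    define B where "B = 1 + partial_snd h (x, F x)"
    have B: "B \<ge> 1 / 2" using p2[OF x] Kr by (simp add: B_def abs_le_iff)
    have "((\<lambda>t. (F (x + t) - F x) / t - - (A / B)) \<longlongrightarrow> 0) (at 0)"
    proof (rule Lim_null_comparison)
      have "((\<lambda>t. 16 * K * \<bar>t\<bar>) \<longlongrightarrow> 16 * K * \<bar>0\<bar>) (at 0)" by (intro tendsto_intros)
      then show "((\<lambda>t. 16 * K * \<bar>t\<bar>) \<longlongrightarrow> 0) (at 0)" by simp
      show "\<forall>\<^sub>F t in at 0. norm ((F (x + t) - F x) / t - - (A / B)) \<le> 16 * K * \<bar>t\<bar>"
        unfolding eventually_at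
      proof (intro exI conjI ballI impI)
        show "0 < \<delta>' - \<bar>x\<bar>" using x by simp
        fix t :: real assume t: "t \<noteq> 0 \<and> dist t 0 < \<delta>' - \<bar>x\<bar>"
        then have t0: "t \<noteq> 0" and y: "\<bar>x + t\<bar> < \<delta>'" by auto
        define e where "e = F (x + t) - F x"
        have e: "\<bar>e\<bar> \<le> \<bar>t\<bar>" using contr[OF x y] by (simp add: e_def)
        have "norm ((x + t, F (x + t)) - (x, F x)) \<le> 2 * \<bar>t\<bar>"
          using norm_Pair_le[of t e] e by (simp add: e_def)
        then have "(norm ((x + t, F (x + t)) - (x, F x)))\<^sup>2 \<le> (2 * \<bar>t\<bar>)\<^sup>2"
          by (intro power_mono) auto
        then have "2 * K * (norm ((x + t, F (x + t)) - (x, F x)))\<^sup>2 \<le> 2 * K * (2 * \<bar>t\<bar>)\<^sup>2"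
          using K by (intro mult_left_mono) auto
        with remainder[OF mem(2)[OF x] mem(2)[OF y]]
        have "\<bar>h (x + t, F (x + t)) - h (x, F x) - t * A - e * (B - 1)\<bar> \<le> 8 * K * t\<^sup>2"
          by (simp add: A_def B_def e_def power_mult_distrib)
        moreover have "h (x + t, F (x + t)) - h (x, F x) = - e"
          using Fx(2)[OF x] Fx(2)[OF y] by (simp add: e_def)
        ultimately have "\<bar>- (e * B + t * A)\<bar> \<le> 8 * K * t\<^sup>2" by (simp add: algebra_simps)
        then have 1: "\<bar>e * B + t * A\<bar> \<le> 8 * K * t\<^sup>2" by (simp only: abs_minus_cancel)
        have "e / t - - (A / B) = (e * B + t * A) / (t * B)"
          using t0 B by (simp add: field_simps)
        then have "\<bar>e / t - - (A / B)\<bar> = \<bar>e * B + t * A\<bar> / (\<bar>t\<bar> * B)"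
          using B by (simp add: abs_mult)
        also have "\<dots> \<le> 8 * K * t\<^sup>2 / (\<bar>t\<bar> * (1 / 2))"
          using 1 B t0 K by (intro frac_le mult_left_mono) auto
        also have "\<dots> = 16 * K * \<bar>t\<bar>" using t0 by (simp add: field_simps power2_eq_square)
        finally show "norm ((F (x + t) - F x) / t - - (A / B)) \<le> 16 * K * \<bar>t\<bar>"
          by (simp add: e_def)
      qed
    qed
    then have "((\<lambda>t. (F (x + t) - F x) / t) \<longlongrightarrow> - (A / B)) (at 0)"
      by (simp only: LIM_zero_iff)
    then show ?thesis by (simp add: DERIV_def A_def B_def)
  qed
  show ?thesis
  proof (rule that[of "\<delta>' / 2"])
    show "0 < \<delta>' / 2" "2 * (\<delta>' / 2) \<le> R" using \<delta>' r by (auto simp: \<delta>'_def)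
    fix x assume "\<bar>x\<bar> \<le> \<delta>' / 2"
    then have x: "\<bar>x\<bar> < \<delta>'" using \<delta>' by simp
    show "F x + h (x, F x) = 0" by (rule Fx(2)[OF x])
    show "\<bar>F x\<bar> \<le> \<bar>x\<bar>" using contr[of 0 x] x \<delta>' by (simp add: F0)
    show "(x, F x) \<in> cball 0 R" by (rule mem(2)[OF x])
    show "\<bar>partial_snd h (x, F x)\<bar> \<le> 1 / 2" using p2[OF x] Kr by linarith
    show "(F has_real_derivative - (partial_fst h (x, F x) / (1 + partial_snd h (x, F x)))) (at x)"
      by (rule der[OF x])
  qed
qed

lemma divergence_planar:
  assumes X: "X = (\<lambda>(x, y). (y + X\<^sub>2 (x, y), Y\<^sub>2 (x, y)))"
    and h: "C_diff_on (Suc k) X\<^sub>2 U" "C_diff_on (Suc k) Y\<^sub>2 U" "p \<in> U"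
  shows "divergence X p = partial_fst X\<^sub>2 p + partial_snd Y\<^sub>2 p"
proof -
  note D = has_derivative_partials[OF h(1,3)] has_derivative_partials[OF h(2,3)]
  have "X = (\<lambda>p. (snd p + X\<^sub>2 p, Y\<^sub>2 p))" by (auto simp: X)
  then have "(X has_derivative (\<lambda>v. (snd v + (fst v * partial_fst X\<^sub>2 p + snd v * partial_snd X\<^sub>2 p),
      fst v * partial_fst Y\<^sub>2 p + snd v * partial_snd Y\<^sub>2 p))) (at p)"
    by (auto intro!: derivative_intros D)
  from frechet_derivative_at[OF this, symmetric] show ?thesis
    by (simp add: divergence_def Basis_prod_def)
qed

lemma Ck_on_cong:
  assumes "Ck_on k g I" "open I" "\<And>x. x \<in> I \<Longrightarrow> h x = g x"
  shows "Ck_on k h I"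
proof (cases k)
  case 0
  with assms show ?thesis by (simp cong: continuous_on_cong)
next
  case (Suc j)
  with assms(1) obtain g' where "\<forall>x\<in>I. (g has_real_derivative g' x) (at x)" "Ck_on j g' I" by auto
  moreover have "(h has_real_derivative g' x) (at x)"
    if "(g has_real_derivative g' x) (at x)" "x \<in> I" for x
    using that(1) assms(2) that(2) by (rule has_field_derivative_transform_within_open) (simp add: assms(3))
  ultimately show ?thesis
    unfolding Suc Ck_on.simps by blast
qed

text \<open>Bootstrapping: the derivative of \<open>F\<close> is a rational expression in partial
  derivatives of \<open>h\<close> along the graph, so each class gained for \<open>F\<close> yields
  the next one.\<close>

lemma Ck_on_implicit:
  assumes h: "C_diff_on (Suc k) h U" and U: "\<And>x. x \<in> I \<Longrightarrow> (x, F x) \<in> U"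
    and F: "\<And>x. x \<in> I \<Longrightarrow> (F has_real_derivative
      - (partial_fst h (x, F x) / (1 + partial_snd h (x, F x)))) (at x)"
    and nz: "\<And>x. x \<in> I \<Longrightarrow> 1 + partial_snd h (x, F x) \<noteq> 0"
  shows "j \<le> Suc k \<Longrightarrow> Ck_on j F I"
proof (induction j)
  case 0
  then show ?case
    using F by (auto intro!: continuous_at_imp_continuous_on DERIV_isCont)
next
  case (Suc j)
  then have j: "j \<le> k" and F': "Ck_on j F I" by auto
  have "C_diff_on j (partial_fst h) U" "C_diff_on j (partial_snd h) U"
    using C_diff_on_partials[OF h] j C_diff_on_le by blast+
  then have "Ck_on j (\<lambda>x. (- 1) * (partial_fst h (x, F x) * inverse (1 + partial_snd h (x, F x)))) I"
    using U F' nz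
    by (intro Ck_on_mult Ck_on_inverse Ck_on_add Ck_on_const Ck_on_compose_graph) auto
  moreover have "\<forall>x\<in>I. (F has_real_derivative
      (- 1) * (partial_fst h (x, F x) * inverse (1 + partial_snd h (x, F x)))) (at x)"
    using F by (simp add: divide_inverse)
  ultimately show ?case
    unfolding Ck_on.simps by (intro exI conjI)
qed

text \<open>All estimates at a point come from first-order Taylor expansion in the vertical
  direction, based at the point of the graph with the same abscissa. The divergence costs one
  derivative, whence class \<open>Suc k\<close>, that is \<open>r - 1\<close>, for \<Phi>.\<close>

lemma nilpotent_normal_form:
  assumes U: "open U" "0 \<in> U"
    and smooth: "C_diff_on (Suc (Suc k)) X\<^sub>2 U" "C_diff_on (Suc (Suc k)) Y\<^sub>2 U"
    and jets: "jet 1 X\<^sub>2 = (\<lambda>_. 0)" "jet 1 Y\<^sub>2 = (\<lambda>_. 0)"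
    and X: "X = (\<lambda>(x, y). (y + X\<^sub>2 (x, y), Y\<^sub>2 (x, y)))"
    and F: "implicit_solution (\<lambda>(x, y). y + X\<^sub>2 (x, y)) F"
    and f: "f = (\<lambda>x. Y\<^sub>2 (x, F x))"
    and \<Phi>: "\<Phi> = (\<lambda>x. divergence X (x, F x))"
  obtains \<rho> K L F' where "nilpotent_field X F F' f \<Phi> \<rho> K L" "cball 0 \<rho> \<subseteq> U"
    "Ck_on (Suc k) \<Phi> {-\<rho><..<\<rho>}"
proof -
  obtain R where R: "0 < R" "cball 0 R \<subseteq> U" using U by (auto simp: open_contains_cball)
  obtain K1 K2 where "\<And>K'. K1 \<le> K' \<Longrightarrow> flat_function X\<^sub>2 R K'"
    "\<And>K'. K2 \<le> K' \<Longrightarrow> flat_function Y\<^sub>2 R K'"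
    using flat_function_on_cball[OF smooth(1) jets(1) R] flat_function_on_cball[OF smooth(2) jets(2) R]
    by metis
  then obtain K where "flat_function X\<^sub>2 R K" "flat_function Y\<^sub>2 R K"
    by (metis max.cobounded1 max.cobounded2)
  then interpret x: flat_function X\<^sub>2 R K + y: flat_function Y\<^sub>2 R K .
  note K = x.K
  obtain \<delta> where \<delta>: "0 < \<delta>" "2 * \<delta> \<le> R"
    and graph: "\<And>x. \<bar>x\<bar> \<le> \<delta> \<Longrightarrow> F x + X\<^sub>2 (x, F x) = 0"
    and F_le: "\<And>x. \<bar>x\<bar> \<le> \<delta> \<Longrightarrow> \<bar>F x\<bar> \<le> \<bar>x\<bar>"
    and mem: "\<And>x. \<bar>x\<bar> \<le> \<delta> \<Longrightarrow> (x, F x) \<in> cball 0 R"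
    and half: "\<And>x. \<bar>x\<bar> \<le> \<delta> \<Longrightarrow> \<bar>partial_snd X\<^sub>2 (x, F x)\<bar> \<le> 1 / 2"
    and F_der: "\<And>x. \<bar>x\<bar> \<le> \<delta> \<Longrightarrow> (F has_real_derivative
      - (partial_fst X\<^sub>2 (x, F x) / (1 + partial_snd X\<^sub>2 (x, F x)))) (at x)"
    using x.implicit_graph[OF F] by blast
  define F' where "F' x = - (partial_fst X\<^sub>2 (x, F x) / (1 + partial_snd X\<^sub>2 (x, F x)))" for x
  \<comment> \<open>The second bound gives \<open>|F' x| <= 4 K |x| <= 1\<close>, so that a
    remainder multiplied by \<open>F' x\<close> does not grow.\<close>
  define \<rho> where "\<rho> = min \<delta> (1 / (4 * K))"
  have \<rho>: "0 < \<rho>" "\<rho> \<le> \<delta>" "2 * \<rho> \<le> R" using \<delta> K by (auto simp: \<rho>_def)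
  have "4 * K * \<rho> \<le> 4 * K * (1 / (4 * K))" using K by (intro mult_left_mono) (auto simp: \<rho>_def)
  then have K\<rho>: "4 * K * \<rho> \<le> 1" using K by simp
  have norm_graph: "norm (x, F x) \<le> 2 * \<bar>x\<bar>" if "\<bar>x\<bar> \<le> \<delta>" for x
    using norm_Pair_le[of x "F x"] F_le[OF that] by simp
  have \<Phi>_eq: "\<Phi> x = partial_fst X\<^sub>2 (x, F x) + partial_snd Y\<^sub>2 (x, F x)" if "\<bar>x\<bar> \<le> \<delta>" for x
    unfolding \<Phi> by (rule divergence_planar[OF X smooth subsetD[OF R(2) mem[OF that]]])
  have K_norm: "K * norm (x, F x) \<le> 2 * K * \<bar>x\<bar>" if "\<bar>x\<bar> \<le> \<delta>" for x
    using mult_left_mono[OF norm_graph[OF that], of K] K by simp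
  have F'_le: "\<bar>F' x\<bar> \<le> 4 * K * \<bar>x\<bar>" if "\<bar>x\<bar> \<le> \<delta>" for x
  proof -
    have h: "1 / 2 \<le> 1 + partial_snd X\<^sub>2 (x, F x)" using half[OF that] by (simp add: abs_le_iff)
    then have "\<bar>F' x\<bar> = \<bar>partial_fst X\<^sub>2 (x, F x)\<bar> / (1 + partial_snd X\<^sub>2 (x, F x))"
      by (simp add: F'_def abs_divide)
    also have "\<dots> \<le> (2 * K * \<bar>x\<bar>) / (1 / 2)"
      using order_trans[OF x.partials_bound(1)[OF mem[OF that]] K_norm[OF that]] h K
      by (intro frac_le) auto
    finally show ?thesis by simp
  qed
  have "nilpotent_field X F F' f \<Phi> \<rho> (8 * K) (1 + 2 * K)"
  proof
    show "0 < \<rho>" "1 \<le> 8 * K" using \<rho> K by auto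
    have sub: "cball 0 \<rho> \<subseteq> cball (0 :: real \<times> real) R" using \<rho> by auto
    show "(1 + 2 * K)-lipschitz_on (cball 0 \<rho>) X"
    proof (rule lipschitz_onI)
      fix p q :: "real \<times> real" assume "p \<in> cball 0 \<rho>" "q \<in> cball 0 \<rho>"
      then have pq: "p \<in> cball 0 R" "q \<in> cball 0 R" using sub by blast+
      have "X p - X q = (snd (p - q) + (X\<^sub>2 p - X\<^sub>2 q), Y\<^sub>2 p - Y\<^sub>2 q)"
        by (cases p; cases q) (simp add: X)
      then have "norm (X p - X q) \<le> \<bar>snd (p - q) + (X\<^sub>2 p - X\<^sub>2 q)\<bar> + \<bar>Y\<^sub>2 p - Y\<^sub>2 q\<bar>"
        using norm_Pair_le by (metis real_norm_def)
      also have "\<dots> \<le> (norm (p - q) + K * norm (p - q)) + K * norm (p - q)"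
        using lipschitz_onD[OF x.lip(1) pq] lipschitz_onD[OF y.lip(1) pq]
          norm_snd_le[of "snd (p - q)" "fst (p - q)"]
        unfolding dist_norm real_norm_def prod.collapse by linarith
      finally show "dist (X p) (X q) \<le> (1 + 2 * K) * dist p q" by (simp add: dist_norm algebra_simps)
    qed (use K in simp)
    show "X 0 = 0" using x.h0 y.h0 by (simp add: X zero_prod_def)
    show "F 0 = 0" using F by (simp add: implicit_solution_def)
  next
    fix x :: real assume "\<bar>x\<bar> \<le> \<rho>"
    then have x: "\<bar>x\<bar> \<le> \<delta>" using \<rho> by simp
    show "(F has_real_derivative F' x) (at x)" unfolding F'_def by (rule F_der[OF x])
    show "\<bar>F' x\<bar> \<le> 8 * K * \<bar>x\<bar>" using F'_le[OF x] K by (smt (verit) mult_right_mono abs_ge_zero)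
    have "(norm (x, F x))\<^sup>2 \<le> (2 * \<bar>x\<bar>)\<^sup>2" using norm_graph[OF x] by (intro power_mono) auto
    then have "2 * K * (norm (x, F x))\<^sup>2 \<le> 2 * K * (4 * x\<^sup>2)"
      using K by (intro mult_left_mono) (auto simp: power_mult_distrib)
    then show "\<bar>f x\<bar> \<le> 8 * K * x\<^sup>2" using y.bound[OF mem[OF x]] by (simp add: f)
    have "\<bar>\<Phi> x\<bar> \<le> 4 * K * \<bar>x\<bar>"
      using x.partials_bound(1)[OF mem[OF x]] y.partials_bound(2)[OF mem[OF x]] K_norm[OF x]
      unfolding \<Phi>_eq[OF x] by linarith
    then show "\<bar>\<Phi> x\<bar> \<le> 8 * K * \<bar>x\<bar>" using K by (smt (verit) mult_right_mono abs_ge_zero)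
  next
    fix p :: "real \<times> real" assume p\<rho>: "p \<in> cball 0 \<rho>"
    define x where "x = fst p"
    define w where "w = snd p - F x"
    have xr: "\<bar>x\<bar> \<le> \<rho>" using p\<rho> norm_fst_le[of "fst p" "snd p"] by (simp add: x_def)
    then have x: "\<bar>x\<bar> \<le> \<delta>" using \<rho> by simp
    have p: "p \<in> cball 0 R" using p\<rho> \<rho> by simp
    note q = mem[OF x]
    have "p - (x, F x) = (0, w)" by (simp add: x_def w_def prod_eq_iff)
    then have n: "norm (p - (x, F x)) = \<bar>w\<bar>" by simp
    define A1 where "A1 = partial_fst X\<^sub>2 (x, F x)"
    define A2 where "A2 = partial_snd X\<^sub>2 (x, F x)"
    define B2 where "B2 = partial_snd Y\<^sub>2 (x, F x)"
    have X2: "\<bar>X\<^sub>2 p + F x - w * A2\<bar> \<le> 2 * K * w\<^sup>2"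
      using x.remainder[OF q p] graph[OF x] unfolding n
      by (simp add: x_def[symmetric] w_def[symmetric] A2_def eq_neg_iff_add_eq_0[symmetric] add.commute)
    have Y2: "\<bar>Y\<^sub>2 p - f x - w * B2\<bar> \<le> 2 * K * w\<^sup>2"
      using y.remainder[OF q p] unfolding n f
      by (simp add: x_def[symmetric] w_def[symmetric] B2_def)
    have Xp: "fst (X p) = w + (X\<^sub>2 p + F x)" "snd (X p) = Y\<^sub>2 p"
      by (cases p; simp add: X w_def x_def)+
    have A2: "\<bar>A2\<bar> \<le> 2 * K * \<bar>x\<bar>"
      unfolding A2_def by (rule order_trans[OF x.partials_bound(2)[OF q] K_norm[OF x]])
    have "\<bar>fst (X p) - w\<bar> \<le> \<bar>w\<bar> * (2 * K * \<bar>x\<bar>) + 2 * K * w\<^sup>2"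
    proof -
      have "\<bar>w * A2\<bar> \<le> \<bar>w\<bar> * (2 * K * \<bar>x\<bar>)"
        using A2 by (auto simp: abs_mult intro: mult_left_mono)
      with X2 Xp show ?thesis by linarith
    qed
    also have "\<dots> = 2 * (K * \<bar>w\<bar> * (\<bar>x\<bar> + \<bar>w\<bar>))"
      by (simp add: algebra_simps power2_eq_square flip: abs_mult)
    also have "\<dots> \<le> 8 * (K * \<bar>w\<bar> * (\<bar>x\<bar> + \<bar>w\<bar>))"
      using K by (intro mult_right_mono) auto
    finally show "\<bar>fst (X p) - (snd p - F (fst p))\<bar>
        \<le> 8 * K * \<bar>snd p - F (fst p)\<bar> * (\<bar>fst p\<bar> + \<bar>snd p - F (fst p)\<bar>)"
      by (simp add: w_def x_def mult.assoc)
    have F'A: "F' x * (1 + A2) = - A1"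
      using half[OF x] by (simp add: F'_def A1_def A2_def abs_le_iff)
    \<comment> \<open>The coefficient of \<open>w\<close> in \<open>w'\<close> is
      \<open>B2 - F' x * (1 + A2)\<close>, and \<open>F'A\<close> turns it into
      \<open>A1 + B2\<close>, the divergence on the graph. The last product therefore vanishes and
      only remainders are left.\<close>
    have "snd (X p) - F' x * fst (X p) - f x - \<Phi> x * w =
        (Y\<^sub>2 p - f x - w * B2) - F' x * (X\<^sub>2 p + F x - w * A2) - w * (F' x * (1 + A2) + A1)"
      unfolding Xp \<Phi>_eq[OF x] A1_def[symmetric] B2_def[symmetric] by (simp add: algebra_simps)
    also have "\<bar>\<dots>\<bar> \<le> 2 * K * w\<^sup>2 + 1 * (2 * K * w\<^sup>2)"
    proof -
      have "\<bar>F' x\<bar> \<le> 4 * K * \<rho>"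
        by (rule order_trans[OF F'_le[OF x] mult_left_mono[OF xr]]) (use K in simp)
      then have "\<bar>F' x * (X\<^sub>2 p + F x - w * A2)\<bar> \<le> 1 * (2 * K * w\<^sup>2)"
        unfolding abs_mult using X2 K\<rho> by (intro mult_mono) auto
      with Y2 show ?thesis unfolding F'A left_minus mult_zero_right by linarith
    qed
    also have "\<dots> \<le> 8 * K * w\<^sup>2" using K by simp
    finally show "\<bar>snd (X p) - F' (fst p) * fst (X p) - f (fst p) - \<Phi> (fst p) * (snd p - F (fst p))\<bar>
        \<le> 8 * K * (snd p - F (fst p))\<^sup>2"
      by (simp add: w_def x_def)
  qed
  moreover have "cball 0 \<rho> \<subseteq> U" using R \<rho> by (intro subset_trans[OF _ R(2)]) auto
  moreover have "Ck_on (Suc k) \<Phi> {-\<rho><..<\<rho>}"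
  proof -
    have I: "\<bar>x\<bar> \<le> \<delta>" if "x \<in> {-\<rho><..<\<rho>}" for x using that \<rho> by auto
    have gU: "(x, F x) \<in> U" if "x \<in> {-\<rho><..<\<rho>}" for x
      using subsetD[OF R(2) mem[OF I[OF that]]] .
    have "Ck_on (Suc k) F {-\<rho><..<\<rho>}"
      by (rule Ck_on_implicit[OF smooth(1) gU F_der[OF I]]) (use half[OF I] in force)+
    then have C: "Ck_on (Suc k) (\<lambda>x. partial_fst X\<^sub>2 (x, F x) + partial_snd Y\<^sub>2 (x, F x)) {-\<rho><..<\<rho>}"
      using C_diff_on_partials(1)[OF smooth(1)] C_diff_on_partials(2)[OF smooth(2)] gU
      by (intro Ck_on_add Ck_on_compose_graph)
    show ?thesis
      by (rule Ck_on_cong[OF C]) (use \<Phi>_eq[OF I] in auto)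
  qed
  ultimately show ?thesis by (rule that)
qed

lemma bigo_expansion_bound:
  fixes g :: "real \<Rightarrow> real"
  assumes "(\<lambda>x. g x - c * x ^ k) \<in> O[at 0](\<lambda>x. x ^ (k + 1))"
  obtains M d where "M \<ge> 0" "d > 0"
    "\<And>x. x \<noteq> 0 \<Longrightarrow> \<bar>x\<bar> \<le> d \<Longrightarrow> \<bar>g x - c * x ^ k\<bar> \<le> M * \<bar>x\<bar> ^ (k + 1)"
proof -
  from assms obtain M where M: "M > 0"
    "\<forall>\<^sub>F x in at 0. norm (g x - c * x ^ k) \<le> M * norm (x ^ (k + 1))"
    by (auto elim!: landau_o.bigE)
  then obtain d where d: "d > 0"
    "\<And>x. x \<noteq> 0 \<Longrightarrow> \<bar>x\<bar> < d \<Longrightarrow> norm (g x - c * x ^ k) \<le> M * norm (x ^ (k + 1))"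
    by (auto simp: eventually_at dist_norm)
  show ?thesis
  proof (rule that[of M "d / 2"])
    fix x :: real assume "x \<noteq> 0" "\<bar>x\<bar> \<le> d / 2"
    with d(1) d(2)[of x] show "\<bar>g x - c * x ^ k\<bar> \<le> M * \<bar>x\<bar> ^ (k + 1)"
      by (simp add: power_abs abs_mult)
  qed (use M d in auto)
qed

section \<open>Order of \<open>f\<close> and proof of the criterion\<close>

context nilpotent_field
begin

text \<open>Vanishing 1-jets make \<open>f\<close> of size \<open>O(x^2)\<close>. The resulting
  bound gives \<open>m >= 1\<close> for \<open>\<alpha> = 2 * m + 1\<close>, on which the barriers
  rely.\<close>

lemma order_ge_2:
  assumes a: "a \<noteq> 0" and d: "d > 0"
    and f_exp: "\<And>x. x \<noteq> 0 \<Longrightarrow> \<bar>x\<bar> \<le> d \<Longrightarrow> \<bar>f x - a * x ^ \<alpha>\<bar> \<le> M * \<bar>x\<bar> ^ (\<alpha> + 1)"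
  shows "\<alpha> \<ge> 2"
proof (rule ccontr)
  assume "\<not> \<alpha> \<ge> 2"
  then have \<alpha>: "\<alpha> + 1 \<le> 2" by simp
  have "\<forall>\<^sub>F x in at_right 0. x < d \<and> x < \<rho> \<and> x < 1 \<and> (K + M) * x < \<bar>a\<bar>"
    using a d \<rho> by (intro eventually_conj eventually_less_at_right_0) auto
  with eventually_at_right_less[of 0]
  have "\<forall>\<^sub>F x in at_right (0 :: real). False"
  proof eventually_elim
    case (elim x)
    have "\<bar>a\<bar> * x ^ \<alpha> = \<bar>a * x ^ \<alpha>\<bar>" using elim by (simp add: abs_mult)
    also have "\<dots> \<le> \<bar>f x\<bar> + M * x ^ (\<alpha> + 1)" using f_exp[of x] elim by auto
    also have "\<bar>f x\<bar> \<le> K * x\<^sup>2" using f_bound[of x] elim by simp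
    also have "K * x\<^sup>2 \<le> K * x ^ (\<alpha> + 1)"
      using elim \<alpha> K by (intro mult_left_mono power_decreasing) auto
    finally have "\<bar>a\<bar> * x ^ \<alpha> \<le> (K + M) * x * x ^ \<alpha>" by (simp add: algebra_simps)
    then have "\<bar>a\<bar> \<le> (K + M) * x" using elim by simp
    with elim show False by simp
  qed
  then show False by simp
qed

end

theorem theorem3:
  fixes r :: nat
    and U :: "(real \<times> real) set"
    and X\<^sub>2 Y\<^sub>2 :: "real \<times> real \<Rightarrow> real"
    and X :: "real \<times> real \<Rightarrow> real \<times> real"
    and F f \<Phi> :: "real \<Rightarrow> real"
    and a b :: real
    and \<alpha> \<beta> :: nat
  assumes r: "r \<ge> 3"
    and U: "open U" "(0, 0) \<in> U"
    and smooth: "C_diff_on r X\<^sub>2 U" "C_diff_on r Y\<^sub>2 U"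
    and jets: "jet 1 X\<^sub>2 = (\<lambda>_. 0)" "jet 1 Y\<^sub>2 = (\<lambda>_. 0)"
    and X: "X = (\<lambda>(x, y). (y + X\<^sub>2 (x, y), Y\<^sub>2 (x, y)))"
    and isolated: "isolated_singular_point X (0, 0)"
    and F: "implicit_solution (\<lambda>(x, y). y + X\<^sub>2 (x, y)) F"
    and f: "f = (\<lambda>x. Y\<^sub>2 (x, F x))"
    and \<Phi>: "\<Phi> = (\<lambda>x. divergence X (x, F x))"
    and f_expansion: "(\<lambda>x. f x - a * x ^ \<alpha>) \<in> O[at 0](\<lambda>x. x ^ (\<alpha> + 1))"
    and \<Phi>_expansion: "(\<lambda>x. \<Phi> x - b * x ^ \<beta>) \<in> O[at 0](\<lambda>x. x ^ (\<beta> + 1))"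
    and \<alpha>: "\<alpha> < r"
    and a: "a \<noteq> 0"
    and b: "jet (r - 1) \<Phi> \<noteq> (\<lambda>_. 0) \<Longrightarrow> b \<noteq> 0"
  shows "monodromic X U (0, 0) \<longleftrightarrow>
    a < 0 \<and>
    (\<exists>n::nat. n \<ge> 1 \<and> \<alpha> = 2 * n - 1 \<and>
      ((\<beta> > n - 1 \<or> jet (r - 1) \<Phi> = (\<lambda>_. 0)) \<or>
       (\<beta> = n - 1 \<and> b\<^sup>2 + 4 * a * real n < 0)))"
proof -
  have z: "(0, 0) = (0 :: real \<times> real)" by (simp add: zero_prod_def)
  define k where "k = r - 2"
  have k: "r = Suc (Suc k)" using r by (simp add: k_def)
  obtain \<rho> K L F' where nf: "nilpotent_field X F F' f \<Phi> \<rho> K L"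
    and \<rho>U: "cball 0 \<rho> \<subseteq> U" and smooth_\<Phi>: "Ck_on (Suc k) \<Phi> {-\<rho><..<\<rho>}"
    using nilpotent_normal_form[OF U(1) U(2)[unfolded z] smooth[unfolded k] jets X F f \<Phi>] .
  interpret nilpotent_field X F F' f \<Phi> \<rho> K L by (rule nf)
  obtain M1 d1 where M1: "M1 \<ge> 0" "d1 > 0" and f_exp:
    "\<And>x. x \<noteq> 0 \<Longrightarrow> \<bar>x\<bar> \<le> d1 \<Longrightarrow> \<bar>f x - a * x ^ \<alpha>\<bar> \<le> M1 * \<bar>x\<bar> ^ (\<alpha> + 1)"
    using bigo_expansion_bound[OF f_expansion] by metis
  obtain M2 d2 where M2: "M2 \<ge> 0" "d2 > 0" and \<Phi>_exp:
    "\<And>x. x \<noteq> 0 \<Longrightarrow> \<bar>x\<bar> \<le> d2 \<Longrightarrow> \<bar>\<Phi> x - b * x ^ \<beta>\<bar> \<le> M2 * \<bar>x\<bar> ^ (\<beta> + 1)"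
    using bigo_expansion_bound[OF \<Phi>_expansion] by metis
  have \<alpha>2: "\<alpha> \<ge> 2" by (rule order_ge_2[OF a M1(2) f_exp])
  have mono: "monodromic X U (0, 0) \<longleftrightarrow> (\<nexists>z. characteristic_orbit X U 0 z)"
    using isolated by (simp add: monodromic_def z)
  let ?cond = "\<lambda>n::nat. (\<beta> > n - 1 \<or> jet (r - 1) \<Phi> = (\<lambda>_. 0)) \<or>
       (\<beta> = n - 1 \<and> b\<^sup>2 + 4 * a * real n < 0)"
  have no_orbit: "\<not> characteristic_orbit X U 0 z"
    if a: "a < 0" and n: "n \<ge> 1" "\<alpha> = 2 * n - 1" and cond: "?cond n" for n z
  proof -
    obtain m where m: "n = Suc m" using n by (cases n) auto
    have \<alpha>m: "\<alpha> = 2 * m + 1" using n m by simp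
    \<comment> \<open>Both alternatives become one expansion with negative discriminant:
      \<open>B = 0\<close> under (i), \<open>B = b\<close> under (ii).\<close>
    have "\<exists>B M d. B\<^sup>2 + 4 * a * real (m + 1) < 0 \<and> M \<ge> 0 \<and> d > 0 \<and>
      (\<forall>x. x \<noteq> 0 \<longrightarrow> \<bar>x\<bar> \<le> d \<longrightarrow> \<bar>\<Phi> x - B * x ^ m\<bar> \<le> M * \<bar>x\<bar> ^ (m + 1))"
    proof -
      have disc: "0\<^sup>2 + 4 * a * real (m + 1) < 0" using a by (simp add: mult_neg_pos)
      consider "\<beta> > m" | "jet (Suc k) \<Phi> = (\<lambda>_. 0)" | "\<beta> = m" "b\<^sup>2 + 4 * a * real (m + 1) < 0"
        using cond m k by auto
      then show ?thesis
      proof cases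
        case 1
        have "\<bar>\<Phi> x - 0 * x ^ m\<bar> \<le> (\<bar>b\<bar> + M2) * \<bar>x\<bar> ^ (m + 1)"
          if x: "x \<noteq> 0" "\<bar>x\<bar> \<le> min d2 1" for x
        proof -
          have "\<bar>\<Phi> x\<bar> \<le> \<bar>b * x ^ \<beta>\<bar> + M2 * \<bar>x\<bar> ^ (\<beta> + 1)" using \<Phi>_exp[of x] x by auto
          also have "\<bar>b * x ^ \<beta>\<bar> = \<bar>b\<bar> * \<bar>x\<bar> ^ \<beta>" by (simp add: abs_mult power_abs)
          also have "\<bar>b\<bar> * \<bar>x\<bar> ^ \<beta> \<le> \<bar>b\<bar> * \<bar>x\<bar> ^ (m + 1)"
            using 1 x by (intro mult_left_mono power_decreasing) auto
          also have "M2 * \<bar>x\<bar> ^ (\<beta> + 1) \<le> M2 * \<bar>x\<bar> ^ (m + 1)"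
            using 1 x M2 by (intro mult_left_mono power_decreasing) auto
          finally show ?thesis by (simp add: algebra_simps)
        qed
        with disc M2 show ?thesis
          by (intro exI[of _ 0] exI[of _ "\<bar>b\<bar> + M2"] exI[of _ "min d2 1"]) auto
      next
        case 2
        obtain C where C: "C \<ge> 0" "\<And>x. \<bar>x\<bar> \<le> \<rho> / 2 \<Longrightarrow> \<bar>\<Phi> x\<bar> \<le> C * \<bar>x\<bar> ^ Suc k"
          using jet_zero_imp_bound[OF smooth_\<Phi> \<rho> 2] by metis
        have "\<bar>\<Phi> x - 0 * x ^ m\<bar> \<le> C * \<bar>x\<bar> ^ (m + 1)" if x: "\<bar>x\<bar> \<le> min (\<rho> / 2) 1" for x
        proof -
          \<comment> \<open>The hypothesis \<open>\<alpha> < r\<close> enters here: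
            \<open>m + 1 <= 2 * m + 1 <= r - 1 = Suc k\<close>.\<close>
          have "C * \<bar>x\<bar> ^ Suc k \<le> C * \<bar>x\<bar> ^ (m + 1)"
            using x C(1) \<alpha> \<alpha>m k by (intro mult_left_mono power_decreasing) auto
          with C(2)[of x] x show ?thesis by simp
        qed
        with disc C(1) \<rho> show ?thesis
          by (intro exI[of _ 0] exI[of _ C] exI[of _ "min (\<rho> / 2) 1"]) auto
      next
        case 3
        with \<Phi>_exp M2 show ?thesis
          by (intro exI[of _ b] exI[of _ M2] exI[of _ d2]) auto
      qed
    qed
    then obtain B M3 d3 where B: "B\<^sup>2 + 4 * a * real (m + 1) < 0" "M3 \<ge> 0" "d3 > 0"
      "\<And>x. x \<noteq> 0 \<Longrightarrow> \<bar>x\<bar> \<le> d3 \<Longrightarrow> \<bar>\<Phi> x - B * x ^ m\<bar> \<le> M3 * \<bar>x\<bar> ^ (m + 1)" by blast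
    define \<rho>' where "\<rho>' = min \<rho> (min d1 d3)"
    have \<rho>': "0 < \<rho>'" "\<rho>' \<le> \<rho>" using \<rho> M1 B by (auto simp: \<rho>'_def)
    have m1: "m \<ge> 1" using \<alpha>2 \<alpha>m by simp
    \<comment> \<open>The asymptotic expansions say nothing at \<open>x = 0\<close> itself, so the
      values there come from the normal form.\<close>
    have f00: "f 0 = 0" "\<Phi> 0 = 0" using f_bound[of 0] \<Phi>_bound[of 0] \<rho> by auto
    have 1: "\<bar>f x - a * x ^ (2 * m + 1)\<bar> \<le> max M1 M3 * \<bar>x\<bar> ^ (2 * m + 2)" if "\<bar>x\<bar> \<le> \<rho>'" for x
    proof (cases "x = 0")
      case False
      then have "\<bar>f x - a * x ^ (2 * m + 1)\<bar> \<le> M1 * \<bar>x\<bar> ^ (2 * m + 2)"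
        using f_exp[of x] that by (simp add: \<alpha>m \<rho>'_def)
      also have "\<dots> \<le> max M1 M3 * \<bar>x\<bar> ^ (2 * m + 2)" by (intro mult_right_mono) auto
      finally show ?thesis .
    qed (simp add: f00)
    have 2: "\<bar>\<Phi> x - B * x ^ m\<bar> \<le> max M1 M3 * \<bar>x\<bar> ^ (m + 1)" if "\<bar>x\<bar> \<le> \<rho>'" for x
    proof (cases "x = 0")
      case False
      then have "\<bar>\<Phi> x - B * x ^ m\<bar> \<le> M3 * \<bar>x\<bar> ^ (m + 1)"
        using B(4)[of x] that by (simp add: \<rho>'_def)
      also have "\<dots> \<le> max M1 M3 * \<bar>x\<bar> ^ (m + 1)" by (intro mult_right_mono) auto
      finally show ?thesis .
    qed (use m1 in \<open>simp add: f00\<close>)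
    show ?thesis
      by (rule nilpotent_field.no_characteristic_orbit[OF shrink[OF \<rho>'] _ 1 2 B(1)])
        (use M1 in auto)
  qed
  have orbit: "\<exists>z. characteristic_orbit X U 0 z"
    if not_cond: "\<not> (a < 0 \<and> (\<exists>n. n \<ge> 1 \<and> \<alpha> = 2 * n - 1 \<and> ?cond n))"
  proof -
    consider "a > 0" | "a < 0" "even \<alpha>" | "a < 0" "odd \<alpha>" using a by linarith
    then show ?thesis
    proof cases
      case 1
      show ?thesis
      proof (rule orbit_if_positive[OF \<alpha>2 1 M1])
        fix x :: real assume "0 < x" "x \<le> d1"
        then show "\<bar>f x - a * x ^ \<alpha>\<bar> \<le> M1 * x ^ (\<alpha> + 1)" using f_exp[of x] by simp
      next
        fix \<eta> assume "reverse_orbit \<eta>"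
        moreover have "flip_field 1 1 X = X" by (auto simp: flip_field_def flip_def)
        ultimately show ?thesis
          using characteristic_orbit_of_flip[of 1 1, OF _ _ \<rho>U] by simp
      qed
    next
      case 2
      \<comment> \<open>For even \<alpha> the reflection of \<open>x\<close> replaces
        \<open>a\<close> by \<open>- a\<close>, which is positive.\<close>
      interpret fl: nilpotent_field "flip_field (-1) 1 X" "\<lambda>x. 1 * F (- 1 * x)"
        "\<lambda>x. 1 * - 1 * F' (- 1 * x)" "\<lambda>x. - 1 * f (- 1 * x)" "\<lambda>x. - 1 * 1 * \<Phi> (- 1 * x)" \<rho> K L
        by (rule flip) auto
      show ?thesis
      proof (rule fl.orbit_if_positive[OF \<alpha>2 _ M1, of "- a"])
        fix x :: real assume "0 < x" "x \<le> d1"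
        then show "\<bar>- 1 * f (- 1 * x) - - a * x ^ \<alpha>\<bar> \<le> M1 * x ^ (\<alpha> + 1)"
          using f_exp[of "- x"] 2(2) by (simp add: abs_minus_commute)
      next
        show "0 < - a" using 2(1) by simp
      qed (rule characteristic_orbit_of_flip[of "- 1" 1, OF _ _ \<rho>U]; simp)
    next
      case 3
      obtain m where \<alpha>m: "\<alpha> = 2 * m + 1" using 3(2) by (rule oddE)
      have m1: "m \<ge> 1" using \<alpha>2 \<alpha>m by simp
      have nc: "\<not> ?cond (m + 1)"
        using not_cond 3(1) \<alpha>m by (auto dest!: spec[of _ "m + 1"])
      then have "jet (r - 1) \<Phi> \<noteq> (\<lambda>_. 0)" "\<beta> \<le> m" by auto
      with b have b0: "b \<noteq> 0" by blast
      \<comment> \<open>For \<open>\<beta> = m\<close> the choice is \<open>B = |b|\<close>. For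
        \<open>\<beta> < m\<close> the right-hand side exceeds every multiple of
        \<open>x ^ m\<close> near 0, so \<open>B\<close> can be taken as large as the discriminant
        requires.\<close>
      have "\<exists>B M d. B > 0 \<and> B\<^sup>2 + 4 * a * real (m + 1) \<ge> 0 \<and> M \<ge> 0 \<and> d > 0 \<and>
        (\<forall>x. 0 < x \<longrightarrow> x \<le> d \<longrightarrow> B * x ^ m - M * x ^ (m + 1) \<le> \<bar>b\<bar> * x ^ \<beta> - M2 * x ^ (\<beta> + 1))"
      proof (cases "\<beta> = m")
        case True
        then have "\<bar>b\<bar>\<^sup>2 + 4 * a * real (m + 1) \<ge> 0" using nc by auto
        with True b0 M2 show ?thesis
          by (intro exI[of _ "\<bar>b\<bar>"] exI[of _ M2] exI[of _ 1]) auto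
      next
        case False
        \<comment> \<open>Then \<open>B >= 1\<close>, hence \<open>B^2 >= B\<close>, and
          \<open>B + 4 a (m + 1) = 1\<close>.\<close>
        define B where "B = 1 - 4 * a * real (m + 1)"
        have aN: "4 * a * real (m + 1) \<le> 0" using 3(1) by (simp add: mult_nonpos_nonneg)
        then have B: "B \<ge> 1" by (simp add: B_def)
        have "B \<le> B\<^sup>2" using B by (simp add: power2_eq_square mult_le_cancel_left1)
        then have disc: "B\<^sup>2 + 4 * a * real (m + 1) \<ge> 0" by (simp add: B_def)
        have "B * x ^ m - 0 * x ^ (m + 1) \<le> \<bar>b\<bar> * x ^ \<beta> - M2 * x ^ (\<beta> + 1)"
          if x: "0 < x" "x \<le> min 1 (\<bar>b\<bar> / (B + M2))" for x
        proof -
          have "B * x ^ m \<le> B * x ^ (\<beta> + 1)"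
            using x B False \<open>\<beta> \<le> m\<close> by (intro mult_left_mono power_decreasing) auto
          moreover have "(B + M2) * x \<le> \<bar>b\<bar>"
            using x B M2 by (simp add: pos_le_divide_eq mult.commute)
          then have "(B + M2) * x * x ^ \<beta> \<le> \<bar>b\<bar> * x ^ \<beta>"
            using x by (intro mult_right_mono) auto
          ultimately show ?thesis by (simp add: algebra_simps)
        qed
        with B disc b0 M2 show ?thesis
          by (intro exI[of _ B] exI[of _ 0] exI[of _ "min 1 (\<bar>b\<bar> / (B + M2))"]) auto
      qed
      then obtain B M3 d3 where B: "B > 0" "B\<^sup>2 + 4 * a * real (m + 1) \<ge> 0" "M3 \<ge> 0" "d3 > 0"
        "\<And>x. 0 < x \<Longrightarrow> x \<le> d3 \<Longrightarrow> B * x ^ m - M3 * x ^ (m + 1) \<le> \<bar>b\<bar> * x ^ \<beta> - M2 * x ^ (\<beta> + 1)"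
        by blast
      define d where "d = min d1 (min d2 d3)"
      have d: "d > 0" using M1 M2 B by (simp add: d_def)
      have s1: "\<bar>sgn b\<bar> = 1" using b0 by (simp add: abs_sgn_eq)
      \<comment> \<open>The factor \<open>sgn b\<close> makes the leading coefficient of \<Phi>
        positive and leaves \<open>f\<close> unchanged; for \<open>b < 0\<close> it reverses
        time.\<close>
      interpret fl: nilpotent_field "flip_field 1 (sgn b) X" "\<lambda>x. sgn b * F (1 * x)"
        "\<lambda>x. sgn b * 1 * F' (1 * x)" "\<lambda>x. 1 * f (1 * x)" "\<lambda>x. 1 * sgn b * \<Phi> (1 * x)" \<rho> K L
        by (rule flip) (use s1 in auto)
      show ?thesis
      proof (rule fl.orbit_if_real_roots[OF m1 3(1) B(1,2) _ d, of "max M1 M3"])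
        show "0 \<le> max M1 M3" using M1 by auto
        fix x :: real assume x: "0 < x" "x \<le> d"
        have "\<bar>f x - a * x ^ \<alpha>\<bar> \<le> M1 * x ^ (\<alpha> + 1)" using f_exp[of x] x by (simp add: d_def)
        also have "\<dots> \<le> max M1 M3 * x ^ (\<alpha> + 1)" using x by (intro mult_right_mono) auto
        finally show "\<bar>1 * f (1 * x) - a * x ^ (2 * m + 1)\<bar> \<le> max M1 M3 * x ^ (2 * m + 2)"
          by (simp add: \<alpha>m)
        have "B * x ^ m - max M1 M3 * x ^ (m + 1) \<le> B * x ^ m - M3 * x ^ (m + 1)"
          using x by (simp add: mult_right_mono)
        also have "\<dots> \<le> \<bar>b\<bar> * x ^ \<beta> - M2 * x ^ (\<beta> + 1)" using B(5) x by (simp add: d_def)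
        also have "\<dots> \<le> sgn b * \<Phi> x"
        proof -
          have "\<bar>sgn b * (\<Phi> x - b * x ^ \<beta>)\<bar> \<le> M2 * x ^ (\<beta> + 1)"
            using \<Phi>_exp[of x] x s1 by (simp add: d_def abs_mult)
          moreover have "sgn b * (b * x ^ \<beta>) = \<bar>b\<bar> * x ^ \<beta>" by (simp add: abs_sgn mult_ac)
          ultimately show ?thesis unfolding right_diff_distrib by linarith
        qed
        finally show "B * x ^ m - max M1 M3 * x ^ (m + 1) \<le> 1 * sgn b * \<Phi> (1 * x)" by simp
      qed (rule characteristic_orbit_of_flip[of 1 "sgn b", OF _ s1 \<rho>U]; simp)
    qed
  qed
  show ?thesis
    unfolding mono using no_orbit orbit by blast
qed

end
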